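(* Let $k$ be a field and let $L=\langle X\mid r\rangle$ be a one relator Lie algebra over $k$ with $X$ finite, and suppose $r\in F(X)$ is homogeneous with respect to the $\mathbb{N}$-grading of the free Lie algebra $F(X)$ induced by some weight function $\omega:X\to\{1,2,3,\ldots\}$ (so that $L$ is $\mathbb{N}$-graded). Then $L$ is an iterated HNN-extension of Lie algebras $$L=(\ldots((A*_{h_n})*_{h_{n-1}})\ldots)*_{h_1}$$ such that $A$ and all the associated Lie subalgebras in each of the HNN-extensions are free Lie algebras.
   Context: $F(X)$ is the free Lie algebra on $X$ over $k$, and $\langle X\mid r\rangle$ is the quotient of $F(X)$ by the ideal generated by $r$. The weight function induces the grading of $F(X)$ in which $x\in X$ has degree $\omega(x)$. If $B$ is a Lie algebra, $A_0\le B$ a Lie subalgebra and $d:A_0\to B$ a derivation (a $k$-linear map with $d([a,b])=[a,d(b)]+[d(a),b]$ for $a,b\in A_0$), the HNN-extension with base $B$, associated subalgebra $A_0$ and stable letter $h$ is the Lie algebra $\langle B,h\mid [h,a]=d(a)\text{ for }a\in A_0\rangle$ (generators and relations of $B$, one new generator $h$, and the listed relations). It is denoted $B*_h$; the notation suppresses $A_0$ and $d$. An iterated HNN-extension is obtained from $A$ by finitely many such steps. *)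

theory Defs
  imports "HOL-Algebra.Algebra" "HOL-Algebra.Algebraic_Closure_Type"
begin

text \<open>Makes the letter \<open>X\<close> available for sets of generators.\<close>
no_notation Polynomials.var (\<open>X\<index>\<close>)


section \<open>Lie algebras over a field\<close>

text \<open>
  The ground field is a type of class \<^class>\<open>field\<close>, seen as a ring record through
  \<^const>\<open>ring_of_type_algebra\<close>.  An algebra is a \<^type>\<open>module\<close> record whose \<open>mult\<close> component
  is the (in general nonassociative) product, i.e. the bracket in the case of a Lie algebra.
  The component \<open>one\<close> of the record plays no role.
\<close>

abbreviation scalars :: "'k::field ring"
  where "scalars \<equiv> ring_of_type_algebra"

locale lie_algebra = module scalars L for L :: "('k::field, 'a) module" (structure) +
  assumes bracket_closed:
      "\<lbrakk>x \<in> carrier L; y \<in> carrier L\<rbrakk> \<Longrightarrow> x \<otimes> y \<in> carrier L"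
    and bracket_add_left:
      "\<lbrakk>x \<in> carrier L; y \<in> carrier L; z \<in> carrier L\<rbrakk> \<Longrightarrow> (x \<oplus> y) \<otimes> z = x \<otimes> z \<oplus> y \<otimes> z"
    and bracket_add_right:
      "\<lbrakk>x \<in> carrier L; y \<in> carrier L; z \<in> carrier L\<rbrakk> \<Longrightarrow> z \<otimes> (x \<oplus> y) = z \<otimes> x \<oplus> z \<otimes> y"
    and bracket_smult_left:
      "\<lbrakk>x \<in> carrier L; y \<in> carrier L\<rbrakk> \<Longrightarrow> (c \<odot> x) \<otimes> y = c \<odot> (x \<otimes> y)"
    and bracket_smult_right:
      "\<lbrakk>x \<in> carrier L; y \<in> carrier L\<rbrakk> \<Longrightarrow> x \<otimes> (c \<odot> y) = c \<odot> (x \<otimes> y)"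
    and bracket_self:
      "x \<in> carrier L \<Longrightarrow> x \<otimes> x = \<zero>"
    and jacobi:
      "\<lbrakk>x \<in> carrier L; y \<in> carrier L; z \<in> carrier L\<rbrakk>
        \<Longrightarrow> x \<otimes> (y \<otimes> z) \<oplus> y \<otimes> (z \<otimes> x) \<oplus> z \<otimes> (x \<otimes> y) = \<zero>"

definition lie_subalgebra :: "('k::field, 'a) module \<Rightarrow> 'a set \<Rightarrow> bool"
  where "lie_subalgebra L S \<longleftrightarrow>
    submodule S scalars L \<and> (\<forall>x\<in>S. \<forall>y\<in>S. x \<otimes>\<^bsub>L\<^esub> y \<in> S)"

definition lie_iso :: "('k::field, 'a) module \<Rightarrow> ('k, 'b) module \<Rightarrow> bool"
  where "lie_iso L M \<longleftrightarrow> (\<exists>\<phi>. bij_betw \<phi> (carrier L) (carrier M) \<and>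
    (\<forall>x\<in>carrier L. \<forall>y\<in>carrier L. \<phi> (x \<oplus>\<^bsub>L\<^esub> y) = \<phi> x \<oplus>\<^bsub>M\<^esub> \<phi> y) \<and>
    (\<forall>c. \<forall>x\<in>carrier L. \<phi> (c \<odot>\<^bsub>L\<^esub> x) = c \<odot>\<^bsub>M\<^esub> \<phi> x) \<and>
    (\<forall>x\<in>carrier L. \<forall>y\<in>carrier L. \<phi> (x \<otimes>\<^bsub>L\<^esub> y) = \<phi> x \<otimes>\<^bsub>M\<^esub> \<phi> y))"

definition lie_derivation :: "('k::field, 'a) module \<Rightarrow> 'a set \<Rightarrow> ('a \<Rightarrow> 'a) \<Rightarrow> bool"
  where "lie_derivation B S d \<longleftrightarrow> d \<in> S \<rightarrow> carrier B \<and>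
    (\<forall>a\<in>S. \<forall>b\<in>S. d (a \<oplus>\<^bsub>B\<^esub> b) = d a \<oplus>\<^bsub>B\<^esub> d b) \<and>
    (\<forall>c. \<forall>a\<in>S. d (c \<odot>\<^bsub>B\<^esub> a) = c \<odot>\<^bsub>B\<^esub> d a) \<and>
    (\<forall>a\<in>S. \<forall>b\<in>S. d (a \<otimes>\<^bsub>B\<^esub> b) = (a \<otimes>\<^bsub>B\<^esub> d b) \<oplus>\<^bsub>B\<^esub> (d a \<otimes>\<^bsub>B\<^esub> b))"


section \<open>Ideals and quotients\<close>

text \<open>These are two-sided ideals of an arbitrary, possibly nonassociative, algebra.\<close>

definition alg_ideal :: "('k::field, 'a) module \<Rightarrow> 'a set \<Rightarrow> bool"
  where "alg_ideal L I \<longleftrightarrow> submodule I scalars L \<and>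
    (\<forall>x\<in>carrier L. \<forall>a\<in>I. x \<otimes>\<^bsub>L\<^esub> a \<in> I \<and> a \<otimes>\<^bsub>L\<^esub> x \<in> I)"

definition alg_ideal_gen :: "('k::field, 'a) module \<Rightarrow> 'a set \<Rightarrow> 'a set"
  where "alg_ideal_gen L R = \<Inter>{I. alg_ideal L I \<and> R \<subseteq> I}"

definition alg_quot :: "('k::field, 'a) module \<Rightarrow> 'a set \<Rightarrow> ('k, 'a set) module"
  where "alg_quot L I = ring.extend (L Quot I)
    (module.fields (\<lambda>c A. \<Union>a\<in>A. I +>\<^bsub>L\<^esub> (c \<odot>\<^bsub>L\<^esub> a)))"


section \<open>Free Lie algebras and presentations\<close>

datatype 'x magma = Gen 'x | Br "'x magma" "'x magma"

text \<open>
  The free nonassociative algebra on \<open>X\<close>: finitely supported functions on the free magma on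
  \<open>X\<close>, with the bilinear extension of the magma operation as product.  As every element of the
  free magma is a product in at most one way, no summation is needed.
\<close>

definition free_nonassoc :: "'x set \<Rightarrow> ('k::field, 'x magma \<Rightarrow> 'k) module"
  where "free_nonassoc X = \<lparr>
    carrier = {f. finite {m. f m \<noteq> 0} \<and> (\<forall>m. f m \<noteq> 0 \<longrightarrow> set_magma m \<subseteq> X)},
    monoid.mult = (\<lambda>f g m. case m of Gen x \<Rightarrow> 0 | Br u v \<Rightarrow> f u * g v),
    one = (\<lambda>m. 0),
    ring.zero = (\<lambda>m. 0),
    add = (\<lambda>f g m. f m + g m),
    module.smult = (\<lambda>c f m. c * f m)\<rparr>"

definition lie_relators :: "('k::field, 'a) module \<Rightarrow> 'a set"
  where "lie_relators N =
    {x \<otimes>\<^bsub>N\<^esub> x | x. x \<in> carrier N} \<union>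
    {x \<otimes>\<^bsub>N\<^esub> (y \<otimes>\<^bsub>N\<^esub> z) \<oplus>\<^bsub>N\<^esub> y \<otimes>\<^bsub>N\<^esub> (z \<otimes>\<^bsub>N\<^esub> x) \<oplus>\<^bsub>N\<^esub> z \<otimes>\<^bsub>N\<^esub> (x \<otimes>\<^bsub>N\<^esub> y) | x y z.
      x \<in> carrier N \<and> y \<in> carrier N \<and> z \<in> carrier N}"

definition lie_kernel :: "'x set \<Rightarrow> ('x magma \<Rightarrow> 'k::field) set"
  where "lie_kernel X = alg_ideal_gen (free_nonassoc X) (lie_relators (free_nonassoc X))"

type_synonym ('k, 'x) free_lie_elem = "('x magma \<Rightarrow> 'k) set"

definition free_lie :: "'x set \<Rightarrow> ('k::field, ('k, 'x) free_lie_elem) module"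
  where "free_lie X = alg_quot (free_nonassoc X) (lie_kernel X)"

definition free_lie_gen :: "'x set \<Rightarrow> 'x \<Rightarrow> ('k::field, 'x) free_lie_elem"
  where "free_lie_gen X x =
    lie_kernel X +>\<^bsub>free_nonassoc X\<^esub> (\<lambda>m. if m = Gen x then 1 else 0)"

definition lie_presentation ::
    "'x set \<Rightarrow> ('k::field, 'x) free_lie_elem set \<Rightarrow> ('k, ('k, 'x) free_lie_elem set) module"
  where "lie_presentation X R = alg_quot (free_lie X) (alg_ideal_gen (free_lie X) R)"

text \<open>
  A free basis is in bijection with a subset of the algebra, so it can be taken from the element
  type of the algebra.
\<close>

definition is_free_lie :: "('k::field, 'a) module \<Rightarrow> bool"
  where "is_free_lie L \<longleftrightarrow> lie_algebra L \<and> (\<exists>Y :: 'a set. lie_iso (free_lie Y) L)"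


section \<open>Weight grading\<close>

fun magma_weight :: "('x \<Rightarrow> nat) \<Rightarrow> 'x magma \<Rightarrow> nat"
  where
    "magma_weight \<omega> (Gen x) = \<omega> x"
  | "magma_weight \<omega> (Br u v) = magma_weight \<omega> u + magma_weight \<omega> v"

text \<open>
  The component of degree \<open>n\<close> consists of the linear combinations of bracket monomials in the
  generators of total weight \<open>n\<close>.  Zero is homogeneous of every degree.
\<close>

definition free_lie_degree ::
    "('x \<Rightarrow> nat) \<Rightarrow> 'x set \<Rightarrow> nat \<Rightarrow> ('k::field, 'x) free_lie_elem set"
  where "free_lie_degree \<omega> X n = {lie_kernel X +>\<^bsub>free_nonassoc X\<^esub> f | f.
    f \<in> carrier (free_nonassoc X) \<and> (\<forall>m. f m \<noteq> 0 \<longrightarrow> magma_weight \<omega> m = n)}"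

definition weight_homogeneous ::
    "('x \<Rightarrow> nat) \<Rightarrow> 'x set \<Rightarrow> ('k::field, 'x) free_lie_elem \<Rightarrow> bool"
  where "weight_homogeneous \<omega> X r \<longleftrightarrow> (\<exists>n. r \<in> free_lie_degree \<omega> X n)"


section \<open>HNN-extensions\<close>

text \<open>
  The base \<open>B\<close> is presented by all its elements as generators (\<open>Some b\<close>) and its whole
  addition, scalar multiplication and bracket tables as relations; \<open>None\<close> is the stable letter.
\<close>

definition hnn_gens :: "('k::field, 'b) module \<Rightarrow> 'b option set"
  where "hnn_gens B = insert None (Some ` carrier B)"

definition hnn_relators ::
    "('k::field, 'b) module \<Rightarrow> 'b set \<Rightarrow> ('b \<Rightarrow> 'b) \<Rightarrow> ('k, 'b option) free_lie_elem set"
  where "hnn_relators B S d =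
    (let F = free_lie (hnn_gens B);
         \<iota> = (\<lambda>b. free_lie_gen (hnn_gens B) (Some b));
         h = free_lie_gen (hnn_gens B) None
     in {\<iota> (x \<oplus>\<^bsub>B\<^esub> y) \<ominus>\<^bsub>F\<^esub> (\<iota> x \<oplus>\<^bsub>F\<^esub> \<iota> y) | x y. x \<in> carrier B \<and> y \<in> carrier B} \<union>
        {\<iota> (c \<odot>\<^bsub>B\<^esub> x) \<ominus>\<^bsub>F\<^esub> (c \<odot>\<^bsub>F\<^esub> \<iota> x) | c x. x \<in> carrier B} \<union>
        {\<iota> (x \<otimes>\<^bsub>B\<^esub> y) \<ominus>\<^bsub>F\<^esub> (\<iota> x \<otimes>\<^bsub>F\<^esub> \<iota> y) | x y. x \<in> carrier B \<and> y \<in> carrier B} \<union>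
        {(h \<otimes>\<^bsub>F\<^esub> \<iota> a) \<ominus>\<^bsub>F\<^esub> \<iota> (d a) | a. a \<in> S})"

definition hnn_extension ::
    "('k::field, 'b) module \<Rightarrow> 'b set \<Rightarrow> ('b \<Rightarrow> 'b) \<Rightarrow>
      ('k, ('k, 'b option) free_lie_elem set) module"
  where "hnn_extension B S d = lie_presentation (hnn_gens B) (hnn_relators B S d)"

text \<open>
  \<open>iterated_hnn A [S\<^sub>1, \<dots>, S\<^sub>n] L\<close>: up to isomorphism, \<open>L\<close> is
  \<open>(\<dots>((A*\<^bsub>h_n\<^esub>)*\<^bsub>h_(n-1)\<^esub>)\<dots>)*\<^bsub>h_1\<^esub>\<close>, where the extension with stable letter \<open>h_i\<close> has
  associated subalgebra \<open>S\<^sub>i\<close> (as a Lie algebra in its own right).  All intermediate Lie algebras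
  are realised on the element type of \<open>L\<close>.
\<close>

inductive iterated_hnn ::
    "('k::field, 'a) module \<Rightarrow> ('k, 'a) module list \<Rightarrow> ('k, 'a) module \<Rightarrow> bool"
  for A :: "('k::field, 'a) module"
  where
    base: "lie_algebra A \<Longrightarrow> iterated_hnn A [] A"
  | step: "\<lbrakk>iterated_hnn A Ss B; lie_subalgebra B S; lie_derivation B S d;
            lie_algebra L; lie_iso (hnn_extension B S d) L\<rbrakk>
          \<Longrightarrow> iterated_hnn A (B\<lparr>carrier := S\<rparr> # Ss) L"

end

theory Submission
  imports Defs
begin

text \<open>
  Pick a letter \<open>x\<close> that cannot be removed from \<open>r\<close> modulo the Lie identities, and a letter
  \<open>t \<noteq> x\<close> occurring in \<open>r\<close> whose weight is smaller than that of \<open>r\<close>.  By homogeneity \<open>r\<close> has no linear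
  term in \<open>t\<close>, so (Lazard elimination) it is a Lie polynomial \<open>g\<close> in the elements
  \<open>y\<^sub>i = ad(t)\<^sup>i y\<close> for letters \<open>y \<noteq> t\<close>.  Choose \<open>g\<close> with the top index \<open>n\<close> of the \<open>x\<^sub>i\<close> that occur as small as
  possible.  With \<open>B = \<langle>x\<^sub>0, \<dots>, x\<^sub>n, y\<^sub>i (y \<noteq> x, i \<ge> 0) | g\<rangle>\<close> and \<open>S\<close> the subalgebra generated by all these letters
  but \<open>x\<^sub>n\<close>, the algebra \<open>L\<close> is the HNN-extension of \<open>B\<close> with stable letter \<open>t\<close> and derivation
  \<open>y\<^sub>i \<mapsto> y\<^bsub>i+1\<^esub>\<close> of \<open>S\<close>.  As \<open>t\<close> is replaced by heavier letters, this terminates, and it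
  does so when \<open>r\<close> is linear and \<open>L\<close> is free on the letters other than \<open>x\<close>.

  What has to be shown is the Freiheitssatz: \<open>S\<close> is free on its generators.  It is proved along the same
  induction by solving the equation \<open>r = 0\<close> for \<open>x\<close>: there is a vector space \<open>M\<close> with an
  operator for every letter such that \<open>r\<close> acts as zero and \<open>M\<close>, as a module over the free
  algebra on the letters other than \<open>x\<close>, is faithful for the free Lie algebra and injective
  (every derivation extends).  Given such an \<open>M\<close> for \<open>g\<close> and \<open>x\<^sub>n\<close>, injectivity provides an operator \<open>h\<close> with
  \<open>[h, y\<^sub>i] = y\<^bsub>i+1\<^esub>\<close> for all letters but \<open>x\<^sub>n\<close>, and \<open>M\<^sup>\<nat>\<close>, with \<open>t\<close> acting as \<open>h\<close> plus the
  shift and the other letters \<open>y\<close> acting diagonally as \<open>y\<^sub>0\<close>, is such a module for \<open>r\<close> and \<open>x\<close>.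
\<close>


section \<open>Nonassociative algebras\<close>

text \<open>The pair (\<open>r\<close>, \<open>x\<close>) is what the induction carries: minimality
  of \<open>n\<close> serves to make \<open>x_n\<close> irremovable from \<open>g\<close>, so that
  the hypotheses hold again for (\<open>g\<close>, \<open>x_n\<close>). Injectivity of
  \<open>M\<close> belongs to the induction because faithfulness alone does not reproduce itself:
  \<open>h\<close> is found only as the extension of a derivation prescribed on letters. Freeness of
  \<open>S\<close> matters beyond the conclusion, since it makes
  \<open>y_i \<mapsto> y_(i+1)\<close> a well-defined derivation of \<open>S\<close>. The degree
  \<open>w\<close> of the relator never changes; only the alphabet and the weights of its letters
  do. A letter heavier than \<open>w\<close> cannot occur in the relator, so although the alphabet
  of \<open>B\<close> is infinite the relator lives on a finite set of letters, and termination is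
  measured there. Each elimination creates a new alphabet, a new module and a new algebra. To keep
  the induction within fixed types, letters are natural numbers, every module is the full function
  space \<open>nat \<Rightarrow> 'k\<close>, which absorbs its countable powers, and every algebra
  is realised on the element type of \<open>L\<close>. The linear case starts from the cofree
  module, whose faithfulness (Witt) comes from the same elimination and uses no basis of the free
  Lie algebra.\<close>

lemma scalars_simps [simp]:
  "carrier scalars = UNIV" "a \<otimes>\<^bsub>scalars\<^esub> b = a * b" "a \<oplus>\<^bsub>scalars\<^esub> b = a + b"
  "\<zero>\<^bsub>scalars\<^esub> = 0" "\<one>\<^bsub>scalars\<^esub> = 1"
  by (simp_all add: ring_of_type_algebra_def)

lemma cring_scalars [simp, intro]: "cring scalars"
  by (rule cring_from_type_algebra)

lemma scalars_minus [simp]: "\<ominus>\<^bsub>scalars\<^esub> a = - a"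
proof -
  interpret cring "scalars :: 'a ring" ..
  show ?thesis by (rule minus_equality) simp_all
qed

text \<open>The common ground of Lie algebras and of the free nonassociative algebras that they are
  quotients of; homomorphisms, ideals and quotients are needed for both.\<close>

locale nonassoc_algebra = module scalars L for L :: "('k::field, 'a) module" (structure) +
  assumes bracket_closed [simp, intro]:
      "\<lbrakk>x \<in> carrier L; y \<in> carrier L\<rbrakk> \<Longrightarrow> x \<otimes> y \<in> carrier L"
    and bracket_add_left:
      "\<lbrakk>x \<in> carrier L; y \<in> carrier L; z \<in> carrier L\<rbrakk> \<Longrightarrow> (x \<oplus> y) \<otimes> z = x \<otimes> z \<oplus> y \<otimes> z"
    and bracket_add_right:
      "\<lbrakk>x \<in> carrier L; y \<in> carrier L; z \<in> carrier L\<rbrakk> \<Longrightarrow> z \<otimes> (x \<oplus> y) = z \<otimes> x \<oplus> z \<otimes> y"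
    and bracket_smult_left:
      "\<lbrakk>x \<in> carrier L; y \<in> carrier L\<rbrakk> \<Longrightarrow> (c \<odot> x) \<otimes> y = c \<odot> (x \<otimes> y)"
    and bracket_smult_right:
      "\<lbrakk>x \<in> carrier L; y \<in> carrier L\<rbrakk> \<Longrightarrow> x \<otimes> (c \<odot> y) = c \<odot> (x \<otimes> y)"

sublocale lie_algebra \<subseteq> nonassoc_algebra
  by unfold_locales
    (fact bracket_closed bracket_add_left bracket_add_right bracket_smult_left bracket_smult_right)+

lemma lie_algebra_iff:
  "lie_algebra L \<longleftrightarrow> nonassoc_algebra L \<and> (\<forall>x\<in>carrier L. x \<otimes>\<^bsub>L\<^esub> x = \<zero>\<^bsub>L\<^esub>) \<and>
    (\<forall>x\<in>carrier L. \<forall>y\<in>carrier L. \<forall>z\<in>carrier L.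
      x \<otimes>\<^bsub>L\<^esub> (y \<otimes>\<^bsub>L\<^esub> z) \<oplus>\<^bsub>L\<^esub> y \<otimes>\<^bsub>L\<^esub> (z \<otimes>\<^bsub>L\<^esub> x) \<oplus>\<^bsub>L\<^esub> z \<otimes>\<^bsub>L\<^esub> (x \<otimes>\<^bsub>L\<^esub> y) = \<zero>\<^bsub>L\<^esub>)"
  (is "?l = ?r")
proof
  assume ?l
  then interpret lie_algebra L .
  show ?r using nonassoc_algebra_axioms bracket_self jacobi by blast
next
  assume ?r
  then interpret nonassoc_algebra L by simp
  show ?l using \<open>?r\<close> bracket_add_left bracket_add_right bracket_smult_left bracket_smult_right
    by unfold_locales auto
qed

lemma nonassoc_algebraI:
  fixes L :: "('k::field, 'a) module" (structure)
  assumes zero: "\<zero> \<in> carrier L"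
    and add: "\<And>x y. \<lbrakk>x \<in> carrier L; y \<in> carrier L\<rbrakk> \<Longrightarrow> x \<oplus> y \<in> carrier L"
    and smult: "\<And>c x. x \<in> carrier L \<Longrightarrow> c \<odot> x \<in> carrier L"
    and mult: "\<And>x y. \<lbrakk>x \<in> carrier L; y \<in> carrier L\<rbrakk> \<Longrightarrow> x \<otimes> y \<in> carrier L"
    and assoc: "\<And>x y z. \<lbrakk>x \<in> carrier L; y \<in> carrier L; z \<in> carrier L\<rbrakk> \<Longrightarrow> (x \<oplus> y) \<oplus> z = x \<oplus> (y \<oplus> z)"
    and comm: "\<And>x y. \<lbrakk>x \<in> carrier L; y \<in> carrier L\<rbrakk> \<Longrightarrow> x \<oplus> y = y \<oplus> x"
    and l_zero: "\<And>x. x \<in> carrier L \<Longrightarrow> \<zero> \<oplus> x = x"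
    and smult_zero: "\<And>x. x \<in> carrier L \<Longrightarrow> 0 \<odot> x = \<zero>"
    and l_distr: "\<And>a b x. x \<in> carrier L \<Longrightarrow> (a + b) \<odot> x = a \<odot> x \<oplus> b \<odot> x"
    and r_distr: "\<And>a x y. \<lbrakk>x \<in> carrier L; y \<in> carrier L\<rbrakk> \<Longrightarrow> a \<odot> (x \<oplus> y) = a \<odot> x \<oplus> a \<odot> y"
    and smult_assoc: "\<And>a b x. x \<in> carrier L \<Longrightarrow> (a * b) \<odot> x = a \<odot> (b \<odot> x)"
    and smult_one: "\<And>x. x \<in> carrier L \<Longrightarrow> 1 \<odot> x = x"
    and "\<And>x y z. \<lbrakk>x \<in> carrier L; y \<in> carrier L; z \<in> carrier L\<rbrakk> \<Longrightarrow> (x \<oplus> y) \<otimes> z = x \<otimes> z \<oplus> y \<otimes> z"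
    and "\<And>x y z. \<lbrakk>x \<in> carrier L; y \<in> carrier L; z \<in> carrier L\<rbrakk> \<Longrightarrow> z \<otimes> (x \<oplus> y) = z \<otimes> x \<oplus> z \<otimes> y"
    and "\<And>c x y. \<lbrakk>x \<in> carrier L; y \<in> carrier L\<rbrakk> \<Longrightarrow> (c \<odot> x) \<otimes> y = c \<odot> (x \<otimes> y)"
    and "\<And>c x y. \<lbrakk>x \<in> carrier L; y \<in> carrier L\<rbrakk> \<Longrightarrow> x \<otimes> (c \<odot> y) = c \<odot> (x \<otimes> y)"
  shows "nonassoc_algebra L"
proof -
  have "\<exists>y\<in>carrier L. y \<oplus> x = \<zero>" if "x \<in> carrier L" for x
  proof
    have "(- 1 + 1) \<odot> x = (- 1) \<odot> x \<oplus> 1 \<odot> x" using l_distr[OF that] .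
    then show "(- 1) \<odot> x \<oplus> x = \<zero>" using smult_zero smult_one that by simp
  qed (use smult that in blast)
  then have "abelian_group L"
    by (intro abelian_groupI) (use zero add assoc comm l_zero in auto)
  then have "module scalars L"
    by (intro moduleI) (use smult l_distr r_distr smult_assoc smult_one in auto)
  then show ?thesis
    by (intro nonassoc_algebra.intro nonassoc_algebra_axioms.intro) (use assms in auto)
qed

context nonassoc_algebra
begin

lemma smult_in [simp, intro]: "x \<in> carrier L \<Longrightarrow> c \<odot> x \<in> carrier L"
  using smult_closed by simp

lemma smult_zero_left [simp]: "x \<in> carrier L \<Longrightarrow> 0 \<odot> x = \<zero>"
  using smult_l_null by simp

lemma smult_zero_right [simp]: "c \<odot> \<zero> = \<zero>"
  using smult_r_null[of c] by simp

lemma smult_one' [simp]: "x \<in> carrier L \<Longrightarrow> 1 \<odot> x = x"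
  using smult_one by simp

lemma smult_add_left: "x \<in> carrier L \<Longrightarrow> (a + b) \<odot> x = a \<odot> x \<oplus> b \<odot> x"
  using smult_l_distr[of a b] by simp

lemma smult_add_right: "x \<in> carrier L \<Longrightarrow> y \<in> carrier L \<Longrightarrow> a \<odot> (x \<oplus> y) = a \<odot> x \<oplus> a \<odot> y"
  using smult_r_distr[of a] by simp

lemma smult_smult: "x \<in> carrier L \<Longrightarrow> a \<odot> (b \<odot> x) = (a * b) \<odot> x"
  using smult_assoc1[of a b] by simp

lemma minus_conv: "x \<in> carrier L \<Longrightarrow> \<ominus> x = (- 1) \<odot> x"
  using smult_l_minus[of 1 x] by simp

lemma zero_bracket [simp]: "x \<in> carrier L \<Longrightarrow> \<zero> \<otimes> x = \<zero>"
  using bracket_smult_left[of \<zero> x 0] by simp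

lemma bracket_zero [simp]: "x \<in> carrier L \<Longrightarrow> x \<otimes> \<zero> = \<zero>"
  using bracket_smult_right[of x \<zero> 0] by simp

lemma minus_bracket: "x \<in> carrier L \<Longrightarrow> y \<in> carrier L \<Longrightarrow> (\<ominus> x) \<otimes> y = \<ominus> (x \<otimes> y)"
  by (simp add: minus_conv bracket_smult_left)

lemma bracket_minus: "x \<in> carrier L \<Longrightarrow> y \<in> carrier L \<Longrightarrow> x \<otimes> (\<ominus> y) = \<ominus> (x \<otimes> y)"
  by (simp add: minus_conv bracket_smult_right)

lemma diff_zero_iff: "x \<in> carrier L \<Longrightarrow> y \<in> carrier L \<Longrightarrow> x \<ominus> y = \<zero> \<longleftrightarrow> x = y"
  by (metis a_inv_closed minus_eq minus_equality minus_minus r_neg)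

lemma diff_closed [simp, intro]: "x \<in> carrier L \<Longrightarrow> y \<in> carrier L \<Longrightarrow> x \<ominus> y \<in> carrier L"
  by (simp add: minus_eq)

end

context lie_algebra
begin

lemma bracket_anti:
  assumes x: "x \<in> carrier L" and y: "y \<in> carrier L"
  shows "x \<otimes> y = \<ominus> (y \<otimes> x)"
proof -
  have "(x \<oplus> y) \<otimes> (x \<oplus> y) = x \<otimes> y \<oplus> y \<otimes> x"
    using x y by (simp add: bracket_add_left bracket_add_right bracket_self[OF x] bracket_self[OF y] a_comm)
  then have "x \<otimes> y \<oplus> y \<otimes> x = \<zero>" using bracket_self[of "x \<oplus> y"] x y by simp
  then show ?thesis using x y by (metis bracket_closed minus_equality)
qed

text \<open>The Jacobi identity read as: \<open>ad(t)\<close> is a derivation. In this form it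
  pushes a bracket with the eliminated letter down to single letters.\<close>

lemma bracket_leibniz:
  assumes "t \<in> carrier L" "x \<in> carrier L" "y \<in> carrier L"
  shows "t \<otimes> (x \<otimes> y) = (t \<otimes> x) \<otimes> y \<oplus> x \<otimes> (t \<otimes> y)"
proof -
  have 1: "t \<otimes> (x \<otimes> y) \<oplus> x \<otimes> (y \<otimes> t) \<oplus> y \<otimes> (t \<otimes> x) = \<zero>" using jacobi assms .
  have 2: "x \<otimes> (y \<otimes> t) = \<ominus> (x \<otimes> (t \<otimes> y))"
    using bracket_anti[of y t] assms by (simp add: bracket_minus)
  have 3: "y \<otimes> (t \<otimes> x) = \<ominus> ((t \<otimes> x) \<otimes> y)" using bracket_anti[of y "t \<otimes> x"] assms by simp
  let ?p = "t \<otimes> (x \<otimes> y)" and ?q = "(t \<otimes> x) \<otimes> y" and ?r = "x \<otimes> (t \<otimes> y)"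
  have c: "?p \<in> carrier L" "?q \<in> carrier L" "?r \<in> carrier L" using assms by auto
  have "?p \<oplus> (\<ominus> (?q \<oplus> ?r)) = ?p \<oplus> \<ominus> ?r \<oplus> \<ominus> ?q"
    using c by (simp add: minus_add a_ac)
  also have "\<dots> = \<zero>" using 1 2 3 by simp
  finally show ?thesis using c by (metis a_closed minus_eq diff_zero_iff)
qed

end


subsection \<open>Homomorphisms and ideals\<close>

definition alg_hom :: "('k::field, 'a) module \<Rightarrow> ('k, 'b) module \<Rightarrow> ('a \<Rightarrow> 'b) \<Rightarrow> bool"
  where "alg_hom L M \<phi> \<longleftrightarrow> \<phi> \<in> carrier L \<rightarrow> carrier M \<and>
    (\<forall>x\<in>carrier L. \<forall>y\<in>carrier L. \<phi> (x \<oplus>\<^bsub>L\<^esub> y) = \<phi> x \<oplus>\<^bsub>M\<^esub> \<phi> y) \<and>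
    (\<forall>c. \<forall>x\<in>carrier L. \<phi> (c \<odot>\<^bsub>L\<^esub> x) = c \<odot>\<^bsub>M\<^esub> \<phi> x) \<and>
    (\<forall>x\<in>carrier L. \<forall>y\<in>carrier L. \<phi> (x \<otimes>\<^bsub>L\<^esub> y) = \<phi> x \<otimes>\<^bsub>M\<^esub> \<phi> y)"

lemma alg_homI:
  assumes "\<And>x. x \<in> carrier L \<Longrightarrow> \<phi> x \<in> carrier M"
    and "\<And>x y. \<lbrakk>x \<in> carrier L; y \<in> carrier L\<rbrakk> \<Longrightarrow> \<phi> (x \<oplus>\<^bsub>L\<^esub> y) = \<phi> x \<oplus>\<^bsub>M\<^esub> \<phi> y"
    and "\<And>c x. x \<in> carrier L \<Longrightarrow> \<phi> (c \<odot>\<^bsub>L\<^esub> x) = c \<odot>\<^bsub>M\<^esub> \<phi> x"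
    and "\<And>x y. \<lbrakk>x \<in> carrier L; y \<in> carrier L\<rbrakk> \<Longrightarrow> \<phi> (x \<otimes>\<^bsub>L\<^esub> y) = \<phi> x \<otimes>\<^bsub>M\<^esub> \<phi> y"
  shows "alg_hom L M \<phi>"
  using assms by (simp add: alg_hom_def)

lemma alg_homD:
  assumes "alg_hom L M \<phi>"
  shows "x \<in> carrier L \<Longrightarrow> \<phi> x \<in> carrier M"
    and "\<lbrakk>x \<in> carrier L; y \<in> carrier L\<rbrakk> \<Longrightarrow> \<phi> (x \<oplus>\<^bsub>L\<^esub> y) = \<phi> x \<oplus>\<^bsub>M\<^esub> \<phi> y"
    and "x \<in> carrier L \<Longrightarrow> \<phi> (c \<odot>\<^bsub>L\<^esub> x) = c \<odot>\<^bsub>M\<^esub> \<phi> x"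
    and "\<lbrakk>x \<in> carrier L; y \<in> carrier L\<rbrakk> \<Longrightarrow> \<phi> (x \<otimes>\<^bsub>L\<^esub> y) = \<phi> x \<otimes>\<^bsub>M\<^esub> \<phi> y"
  using assms by (auto simp: alg_hom_def)

lemma lie_iso_alg_hom:
  "lie_iso L M \<longleftrightarrow> (\<exists>\<phi>. alg_hom L M \<phi> \<and> bij_betw \<phi> (carrier L) (carrier M))"
  unfolding lie_iso_def alg_hom_def using bij_betw_imp_funcset by blast

lemma alg_hom_comp: "alg_hom L M \<phi> \<Longrightarrow> alg_hom M P \<psi> \<Longrightarrow> alg_hom L P (\<lambda>x. \<psi> (\<phi> x))"
  unfolding alg_hom_def by (auto simp: Pi_iff)

lemma alg_hom_zero:
  assumes "alg_hom L M \<phi>" "nonassoc_algebra L" "nonassoc_algebra M"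
  shows "\<phi> \<zero>\<^bsub>L\<^esub> = \<zero>\<^bsub>M\<^esub>"
proof -
  interpret L: nonassoc_algebra L by fact
  interpret M: nonassoc_algebra M by fact
  have "\<phi> (0 \<odot>\<^bsub>L\<^esub> \<zero>\<^bsub>L\<^esub>) = 0 \<odot>\<^bsub>M\<^esub> \<phi> \<zero>\<^bsub>L\<^esub>" using assms(1) L.zero_closed by (simp only: alg_homD)
  then show ?thesis using alg_homD(1)[OF assms(1) L.zero_closed] by simp
qed

lemma alg_hom_diff:
  assumes "alg_hom L M \<phi>" "nonassoc_algebra L" "nonassoc_algebra M" "x \<in> carrier L" "y \<in> carrier L"
  shows "\<phi> (x \<ominus>\<^bsub>L\<^esub> y) = \<phi> x \<ominus>\<^bsub>M\<^esub> \<phi> y"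
proof -
  interpret L: nonassoc_algebra L by fact
  interpret M: nonassoc_algebra M by fact
  show ?thesis using assms by (simp add: L.minus_eq M.minus_eq L.minus_conv M.minus_conv alg_homD)
qed

lemma alg_idealI:
  assumes "nonassoc_algebra L" "I \<subseteq> carrier L" "\<zero>\<^bsub>L\<^esub> \<in> I"
    and "\<And>x y. \<lbrakk>x \<in> I; y \<in> I\<rbrakk> \<Longrightarrow> x \<oplus>\<^bsub>L\<^esub> y \<in> I"
    and smult: "\<And>c x. x \<in> I \<Longrightarrow> c \<odot>\<^bsub>L\<^esub> x \<in> I"
    and "\<And>x a. \<lbrakk>x \<in> carrier L; a \<in> I\<rbrakk> \<Longrightarrow> x \<otimes>\<^bsub>L\<^esub> a \<in> I"
    and "\<And>x a. \<lbrakk>x \<in> carrier L; a \<in> I\<rbrakk> \<Longrightarrow> a \<otimes>\<^bsub>L\<^esub> x \<in> I"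
  shows "alg_ideal L I"
proof -
  interpret nonassoc_algebra L by fact
  have "\<ominus>\<^bsub>L\<^esub> a \<in> I" if "a \<in> I" for a
    using smult[OF that, of "- 1"] minus_conv[of a] that assms(2) by auto
  then show ?thesis unfolding alg_ideal_def by (intro conjI submoduleI) (use assms in auto)
qed

lemma alg_idealD:
  assumes "nonassoc_algebra L" "alg_ideal L I"
  shows "I \<subseteq> carrier L" and "\<zero>\<^bsub>L\<^esub> \<in> I"
    and "\<lbrakk>x \<in> I; y \<in> I\<rbrakk> \<Longrightarrow> x \<oplus>\<^bsub>L\<^esub> y \<in> I"
    and "x \<in> I \<Longrightarrow> c \<odot>\<^bsub>L\<^esub> x \<in> I"
    and "\<lbrakk>x \<in> carrier L; a \<in> I\<rbrakk> \<Longrightarrow> x \<otimes>\<^bsub>L\<^esub> a \<in> I"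
    and "\<lbrakk>x \<in> carrier L; a \<in> I\<rbrakk> \<Longrightarrow> a \<otimes>\<^bsub>L\<^esub> x \<in> I"
proof -
  interpret nonassoc_algebra L by fact
  have s: "submodule I scalars L" using assms(2) by (simp add: alg_ideal_def)
  then interpret s: subgroup I "add_monoid L" by (simp add: submodule_def)
  show "I \<subseteq> carrier L" "\<zero>\<^bsub>L\<^esub> \<in> I" "\<lbrakk>x \<in> I; y \<in> I\<rbrakk> \<Longrightarrow> x \<oplus>\<^bsub>L\<^esub> y \<in> I"
    using s.subset s.one_closed s.m_closed by auto
  show "x \<in> I \<Longrightarrow> c \<odot>\<^bsub>L\<^esub> x \<in> I" using submoduleE(4)[OF s, of c x] by simp
  show "\<lbrakk>x \<in> carrier L; a \<in> I\<rbrakk> \<Longrightarrow> x \<otimes>\<^bsub>L\<^esub> a \<in> I" "\<lbrakk>x \<in> carrier L; a \<in> I\<rbrakk> \<Longrightarrow> a \<otimes>\<^bsub>L\<^esub> x \<in> I"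
    using assms(2) by (auto simp: alg_ideal_def)
qed

lemma alg_ideal_vimage:
  assumes "alg_hom L M \<phi>" "nonassoc_algebra L" "nonassoc_algebra M" "alg_ideal M I"
  shows "alg_ideal L {x \<in> carrier L. \<phi> x \<in> I}"
proof -
  interpret L: nonassoc_algebra L by fact
  show ?thesis using alg_idealD[OF assms(3,4)] alg_homD[OF assms(1)] alg_hom_zero[OF assms(1-3)]
    by (intro alg_idealI[OF assms(2)]) auto
qed

lemma alg_ideal_zero: "nonassoc_algebra L \<Longrightarrow> alg_ideal L {\<zero>\<^bsub>L\<^esub>}"
proof -
  assume *: "nonassoc_algebra L"
  then interpret nonassoc_algebra L .
  show ?thesis by (rule alg_idealI[OF *]) auto
qed

lemma alg_ideal_carrier: "nonassoc_algebra L \<Longrightarrow> alg_ideal L (carrier L)"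
proof -
  assume *: "nonassoc_algebra L"
  then interpret nonassoc_algebra L .
  show ?thesis by (rule alg_idealI[OF *]) auto
qed

lemma alg_ideal_gen_min: "alg_ideal L I \<Longrightarrow> R \<subseteq> I \<Longrightarrow> alg_ideal_gen L R \<subseteq> I"
  by (auto simp: alg_ideal_gen_def)

lemma alg_ideal_gen_superset: "R \<subseteq> alg_ideal_gen L R"
  by (auto simp: alg_ideal_gen_def)

lemma alg_ideal_gen_ideal:
  assumes "nonassoc_algebra L" "R \<subseteq> carrier L"
  shows "alg_ideal L (alg_ideal_gen L R)"
proof (rule alg_idealI[OF assms(1)])
  interpret nonassoc_algebra L by fact
  show "alg_ideal_gen L R \<subseteq> carrier L"
    by (rule alg_ideal_gen_min[OF alg_ideal_carrier[OF assms(1)] assms(2)])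
qed (use assms(1) in \<open>auto simp: alg_ideal_gen_def alg_idealD\<close>)

lemma alg_ideal_gen_hom:
  assumes "alg_hom L M \<phi>" "nonassoc_algebra L" "nonassoc_algebra M" "alg_ideal M I"
    and "R \<subseteq> carrier L" "\<And>x. x \<in> R \<Longrightarrow> \<phi> x \<in> I" "x \<in> alg_ideal_gen L R"
  shows "\<phi> x \<in> I"
  using alg_ideal_gen_min[OF alg_ideal_vimage[OF assms(1-4)], of R] assms(5-7) by auto

lemma lie_relators_subset: "nonassoc_algebra L \<Longrightarrow> lie_relators L \<subseteq> carrier L"
proof -
  assume *: "nonassoc_algebra L"
  then interpret nonassoc_algebra L .
  show ?thesis by (auto simp: lie_relators_def)
qed

lemma lie_relators_hom:
  assumes "alg_hom L M \<phi>" "nonassoc_algebra L" "x \<in> lie_relators L"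
  shows "\<phi> x \<in> lie_relators M"
proof -
  interpret L: nonassoc_algebra L by fact
  show ?thesis using assms(3) unfolding lie_relators_def
    by (auto simp: alg_homD[OF assms(1)]) (metis alg_homD(1)[OF assms(1)])+
qed

lemma lie_algebra_iff_relators:
  assumes "nonassoc_algebra L"
  shows "lie_algebra L \<longleftrightarrow> lie_relators L \<subseteq> {\<zero>\<^bsub>L\<^esub>}"
  using assms unfolding lie_algebra_iff lie_relators_def by blast


subsection \<open>Quotients\<close>

context
  fixes L :: "('k::field, 'a) module" and I
  assumes L: "nonassoc_algebra L" and I: "alg_ideal L I"
begin

interpretation L: nonassoc_algebra L by (rule L)

interpretation I: abelian_subgroup I L
  using I L.abelian_group_axioms
  by (auto intro!: abelian_subgroupI3 additive_subgroup.intro simp: alg_ideal_def submodule_def)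

lemma alg_coset_eq_iff:
  assumes "x \<in> carrier L" "y \<in> carrier L"
  shows "I +>\<^bsub>L\<^esub> x = I +>\<^bsub>L\<^esub> y \<longleftrightarrow> x \<ominus>\<^bsub>L\<^esub> y \<in> I"
proof
  assume "I +>\<^bsub>L\<^esub> x = I +>\<^bsub>L\<^esub> y"
  then have "x \<in> I +>\<^bsub>L\<^esub> y" using I.a_rcos_self[OF assms(1)] by simp
  then show "x \<ominus>\<^bsub>L\<^esub> y \<in> I" using I.a_rcos_module_imp[OF assms(2)] by (simp add: L.minus_eq)
next
  assume "x \<ominus>\<^bsub>L\<^esub> y \<in> I"
  then have "x \<in> I +>\<^bsub>L\<^esub> y" using I.a_rcos_module_rev[OF assms(2,1)] by (simp add: L.minus_eq)
  then show "I +>\<^bsub>L\<^esub> x = I +>\<^bsub>L\<^esub> y"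
    using L.a_repr_independence[OF _ assms(2), of x I] I.a_subgroup by auto
qed

lemma alg_coset_mem: "x \<in> carrier L \<Longrightarrow> y \<in> I +>\<^bsub>L\<^esub> x \<longleftrightarrow> y \<in> carrier L \<and> I +>\<^bsub>L\<^esub> y = I +>\<^bsub>L\<^esub> x"
  using I.a_elemrcos_carrier I.a_rcos_self L.a_repr_independence[of y I x] I.a_subgroup by metis

lemma alg_quot_simps:
  "carrier (alg_quot L I) = (\<lambda>x. I +>\<^bsub>L\<^esub> x) ` carrier L"
  "\<zero>\<^bsub>alg_quot L I\<^esub> = I +>\<^bsub>L\<^esub> \<zero>\<^bsub>L\<^esub>"
  "x \<in> carrier L \<Longrightarrow> y \<in> carrier L \<Longrightarrow> (I +>\<^bsub>L\<^esub> x) \<oplus>\<^bsub>alg_quot L I\<^esub> (I +>\<^bsub>L\<^esub> y) = I +>\<^bsub>L\<^esub> (x \<oplus>\<^bsub>L\<^esub> y)"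
  "x \<in> carrier L \<Longrightarrow> c \<odot>\<^bsub>alg_quot L I\<^esub> (I +>\<^bsub>L\<^esub> x) = I +>\<^bsub>L\<^esub> (c \<odot>\<^bsub>L\<^esub> x)"
  "x \<in> carrier L \<Longrightarrow> y \<in> carrier L \<Longrightarrow> (I +>\<^bsub>L\<^esub> x) \<otimes>\<^bsub>alg_quot L I\<^esub> (I +>\<^bsub>L\<^esub> y) = I +>\<^bsub>L\<^esub> (x \<otimes>\<^bsub>L\<^esub> y)"
proof -
  show "carrier (alg_quot L I) = (\<lambda>x. I +>\<^bsub>L\<^esub> x) ` carrier L"
    by (auto simp: alg_quot_def ring.defs module.defs FactRing_simps)
  show "\<zero>\<^bsub>alg_quot L I\<^esub> = I +>\<^bsub>L\<^esub> \<zero>\<^bsub>L\<^esub>"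
    using I.a_rcos_const[of "\<zero>\<^bsub>L\<^esub>"] by (simp add: alg_quot_def ring.defs module.defs FactRing_simps)
  show "x \<in> carrier L \<Longrightarrow> y \<in> carrier L \<Longrightarrow> (I +>\<^bsub>L\<^esub> x) \<oplus>\<^bsub>alg_quot L I\<^esub> (I +>\<^bsub>L\<^esub> y) = I +>\<^bsub>L\<^esub> (x \<oplus>\<^bsub>L\<^esub> y)"
    using I.a_rcos_sum by (simp add: alg_quot_def ring.defs module.defs FactRing_simps)
  \<comment> \<open>The scalar action of \<open>alg_quot\<close> is a union over all
    representatives, so each of them has to give the same coset.\<close>
  have key: "I +>\<^bsub>L\<^esub> (c \<odot>\<^bsub>L\<^esub> a) = I +>\<^bsub>L\<^esub> (c \<odot>\<^bsub>L\<^esub> x)" if x: "x \<in> carrier L" and "a \<in> I +>\<^bsub>L\<^esub> x" for c x a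
  proof -
    have a: "a \<in> carrier L" and "a \<ominus>\<^bsub>L\<^esub> x \<in> I"
      using that alg_coset_mem[OF x] alg_coset_eq_iff by auto
    then have "c \<odot>\<^bsub>L\<^esub> (a \<ominus>\<^bsub>L\<^esub> x) \<in> I" using alg_idealD(4)[OF L I] by auto
    moreover have "c \<odot>\<^bsub>L\<^esub> (a \<ominus>\<^bsub>L\<^esub> x) = c \<odot>\<^bsub>L\<^esub> a \<ominus>\<^bsub>L\<^esub> c \<odot>\<^bsub>L\<^esub> x"
      using a x by (simp add: L.minus_eq L.minus_conv L.smult_add_right L.smult_smult)
    ultimately show ?thesis using a x by (subst alg_coset_eq_iff) auto
  qed
  show "c \<odot>\<^bsub>alg_quot L I\<^esub> (I +>\<^bsub>L\<^esub> x) = I +>\<^bsub>L\<^esub> (c \<odot>\<^bsub>L\<^esub> x)" if x: "x \<in> carrier L"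
  proof -
    have "(\<Union>a\<in>I +>\<^bsub>L\<^esub> x. I +>\<^bsub>L\<^esub> (c \<odot>\<^bsub>L\<^esub> a)) = I +>\<^bsub>L\<^esub> (c \<odot>\<^bsub>L\<^esub> x)"
      using key[OF x] I.a_rcos_self[OF x] by blast
    then show ?thesis by (simp add: alg_quot_def ring.defs module.defs FactRing_simps)
  qed
  \<comment> \<open>Likewise for products, by the splitting
    \<open>ab - xy = (a - x)b + x(b - y)\<close>.\<close>
  have key2: "I +>\<^bsub>L\<^esub> (a \<otimes>\<^bsub>L\<^esub> b) = I +>\<^bsub>L\<^esub> (x \<otimes>\<^bsub>L\<^esub> y)"
    if x: "x \<in> carrier L" and y: "y \<in> carrier L" and "a \<in> I +>\<^bsub>L\<^esub> x" "b \<in> I +>\<^bsub>L\<^esub> y" for x y a b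
  proof -
    have a: "a \<in> carrier L" "a \<ominus>\<^bsub>L\<^esub> x \<in> I" and b: "b \<in> carrier L" "b \<ominus>\<^bsub>L\<^esub> y \<in> I"
      using that alg_coset_mem alg_coset_eq_iff by auto
    then have "(a \<ominus>\<^bsub>L\<^esub> x) \<otimes>\<^bsub>L\<^esub> b \<oplus>\<^bsub>L\<^esub> x \<otimes>\<^bsub>L\<^esub> (b \<ominus>\<^bsub>L\<^esub> y) \<in> I"
      using alg_idealD(3,5,6)[OF L I] x by auto
    moreover have "(a \<ominus>\<^bsub>L\<^esub> x) \<otimes>\<^bsub>L\<^esub> b \<oplus>\<^bsub>L\<^esub> x \<otimes>\<^bsub>L\<^esub> (b \<ominus>\<^bsub>L\<^esub> y)
      = (a \<otimes>\<^bsub>L\<^esub> b \<oplus>\<^bsub>L\<^esub> \<ominus>\<^bsub>L\<^esub> (x \<otimes>\<^bsub>L\<^esub> b)) \<oplus>\<^bsub>L\<^esub> (x \<otimes>\<^bsub>L\<^esub> b \<oplus>\<^bsub>L\<^esub> \<ominus>\<^bsub>L\<^esub> (x \<otimes>\<^bsub>L\<^esub> y))"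
      using a b x y by (simp add: L.minus_eq L.bracket_add_left L.bracket_add_right
        L.minus_bracket L.bracket_minus)
    moreover have "\<dots> = a \<otimes>\<^bsub>L\<^esub> b \<ominus>\<^bsub>L\<^esub> x \<otimes>\<^bsub>L\<^esub> y"
      using a b x y by (simp add: L.minus_eq L.a_assoc L.r_neg1)
    ultimately show ?thesis using a b x y by (subst alg_coset_eq_iff) auto
  qed
  show "(I +>\<^bsub>L\<^esub> x) \<otimes>\<^bsub>alg_quot L I\<^esub> (I +>\<^bsub>L\<^esub> y) = I +>\<^bsub>L\<^esub> (x \<otimes>\<^bsub>L\<^esub> y)"
    if x: "x \<in> carrier L" and y: "y \<in> carrier L"
  proof -
    have "rcoset_mult L I (I +>\<^bsub>L\<^esub> x) (I +>\<^bsub>L\<^esub> y) = I +>\<^bsub>L\<^esub> (x \<otimes>\<^bsub>L\<^esub> y)"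
      unfolding rcoset_mult_def using key2[OF x y] I.a_rcos_self[OF x] I.a_rcos_self[OF y] by blast
    then show ?thesis by (simp add: alg_quot_def ring.defs module.defs FactRing_simps)
  qed
qed

lemma alg_quot_algebra: "nonassoc_algebra (alg_quot L I)"
  by (rule nonassoc_algebraI)
    (auto simp: alg_quot_simps L.smult_add_left L.smult_add_right L.smult_smult L.bracket_add_left
      L.bracket_add_right L.bracket_smult_left L.bracket_smult_right L.a_ac)

lemma alg_quot_hom: "alg_hom L (alg_quot L I) (\<lambda>x. I +>\<^bsub>L\<^esub> x)"
  by (rule alg_homI) (auto simp: alg_quot_simps)

lemma alg_quot_zero_iff: "x \<in> carrier L \<Longrightarrow> I +>\<^bsub>L\<^esub> x = \<zero>\<^bsub>alg_quot L I\<^esub> \<longleftrightarrow> x \<in> I"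
  by (simp add: alg_quot_simps alg_coset_eq_iff L.minus_eq L.minus_conv)

lemma alg_quot_lie_algebra:
  assumes "lie_relators L \<subseteq> I"
  shows "lie_algebra (alg_quot L I)"
  unfolding lie_algebra_iff
proof (intro conjI ballI)
  show "nonassoc_algebra (alg_quot L I)" by (rule alg_quot_algebra)
  show "X \<otimes>\<^bsub>alg_quot L I\<^esub> X = \<zero>\<^bsub>alg_quot L I\<^esub>" if X: "X \<in> carrier (alg_quot L I)" for X
  proof -
    obtain x where x: "x \<in> carrier L" "X = I +>\<^bsub>L\<^esub> x" using X by (auto simp: alg_quot_simps)
    have "x \<otimes>\<^bsub>L\<^esub> x \<in> I" using assms x by (auto simp: lie_relators_def)
    then show ?thesis using x alg_quot_zero_iff[of "x \<otimes>\<^bsub>L\<^esub> x"] by (simp add: alg_quot_simps(3-5))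
  qed
  show "X \<otimes>\<^bsub>alg_quot L I\<^esub> (Y \<otimes>\<^bsub>alg_quot L I\<^esub> Z) \<oplus>\<^bsub>alg_quot L I\<^esub> Y \<otimes>\<^bsub>alg_quot L I\<^esub> (Z \<otimes>\<^bsub>alg_quot L I\<^esub> X)
      \<oplus>\<^bsub>alg_quot L I\<^esub> Z \<otimes>\<^bsub>alg_quot L I\<^esub> (X \<otimes>\<^bsub>alg_quot L I\<^esub> Y) = \<zero>\<^bsub>alg_quot L I\<^esub>"
    if X: "X \<in> carrier (alg_quot L I)" "Y \<in> carrier (alg_quot L I)" "Z \<in> carrier (alg_quot L I)" for X Y Z
  proof -
    obtain x y z where x: "x \<in> carrier L" "X = I +>\<^bsub>L\<^esub> x" "y \<in> carrier L" "Y = I +>\<^bsub>L\<^esub> y"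
      "z \<in> carrier L" "Z = I +>\<^bsub>L\<^esub> z" using X by (auto simp: alg_quot_simps)
    let ?j = "x \<otimes>\<^bsub>L\<^esub> (y \<otimes>\<^bsub>L\<^esub> z) \<oplus>\<^bsub>L\<^esub> y \<otimes>\<^bsub>L\<^esub> (z \<otimes>\<^bsub>L\<^esub> x) \<oplus>\<^bsub>L\<^esub> z \<otimes>\<^bsub>L\<^esub> (x \<otimes>\<^bsub>L\<^esub> y)"
    have "?j \<in> I" using assms x unfolding lie_relators_def by blast
    then show ?thesis using x alg_quot_zero_iff[of ?j] by (simp add: alg_quot_simps(3-5))
  qed
qed

end

text \<open>Two preimages of an element differ by something in the kernel of \<open>\<pi>\<close>,
  so a chosen preimage will do. An arbitrary surjection stands in for the coset map, because
  presented algebras are later transported to other types.\<close>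

lemma alg_hom_factor:
  assumes \<pi>: "alg_hom N L \<pi>" and \<phi>: "alg_hom N M \<phi>"
    and alg: "nonassoc_algebra N" "nonassoc_algebra L" "nonassoc_algebra M"
    and surj: "\<pi> ` carrier N = carrier L"
    and ker: "\<And>f. f \<in> carrier N \<Longrightarrow> \<pi> f = \<zero>\<^bsub>L\<^esub> \<Longrightarrow> \<phi> f = \<zero>\<^bsub>M\<^esub>"
  obtains \<Phi> where "alg_hom L M \<Phi>" "\<And>f. f \<in> carrier N \<Longrightarrow> \<Phi> (\<pi> f) = \<phi> f"
proof -
  interpret N: nonassoc_algebra N by fact
  interpret L: nonassoc_algebra L by fact
  interpret M: nonassoc_algebra M by fact
  define \<Phi> where "\<Phi> = (\<lambda>l. \<phi> (inv_into (carrier N) \<pi> l))"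
  have *: "\<Phi> (\<pi> f) = \<phi> f" if f: "f \<in> carrier N" for f
  proof -
    let ?g = "inv_into (carrier N) \<pi> (\<pi> f)"
    have g: "?g \<in> carrier N" "\<pi> ?g = \<pi> f"
      using f by (auto intro: inv_into_into f_inv_into_f)
    then have "\<pi> (?g \<ominus>\<^bsub>N\<^esub> f) = \<zero>\<^bsub>L\<^esub>"
      using f alg_homD(1)[OF \<pi>] by (simp add: alg_hom_diff[OF \<pi> alg(1,2)] L.diff_zero_iff)
    then have "\<phi> ?g \<ominus>\<^bsub>M\<^esub> \<phi> f = \<zero>\<^bsub>M\<^esub>"
      using ker[of "?g \<ominus>\<^bsub>N\<^esub> f"] f g by (simp add: alg_hom_diff[OF \<phi> alg(1,3)])
    then show ?thesis using f g alg_homD(1)[OF \<phi>] by (simp add: \<Phi>_def M.diff_zero_iff)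
  qed
  have "alg_hom L M \<Phi>"
  proof (rule alg_homI)
    fix x y c assume "x \<in> carrier L" "y \<in> carrier L"
    then obtain f g where f: "f \<in> carrier N" "x = \<pi> f" and g: "g \<in> carrier N" "y = \<pi> g"
      using surj by blast
    show "\<Phi> (x \<oplus>\<^bsub>L\<^esub> y) = \<Phi> x \<oplus>\<^bsub>M\<^esub> \<Phi> y"
      using f g *[of "f \<oplus>\<^bsub>N\<^esub> g"] * by (simp add: alg_homD[OF \<pi>] alg_homD[OF \<phi>])
    show "\<Phi> (x \<otimes>\<^bsub>L\<^esub> y) = \<Phi> x \<otimes>\<^bsub>M\<^esub> \<Phi> y"
      using f g *[of "f \<otimes>\<^bsub>N\<^esub> g"] * by (simp add: alg_homD[OF \<pi>] alg_homD[OF \<phi>])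
  next
    fix x c assume "x \<in> carrier L"
    then obtain f where f: "f \<in> carrier N" "x = \<pi> f" using surj by blast
    show "\<Phi> x \<in> carrier M" using f * by (simp add: alg_homD[OF \<phi>])
    show "\<Phi> (c \<odot>\<^bsub>L\<^esub> x) = c \<odot>\<^bsub>M\<^esub> \<Phi> x"
      using f *[of "c \<odot>\<^bsub>N\<^esub> f"] * by (simp add: alg_homD[OF \<pi>] alg_homD[OF \<phi>])
  qed
  with * show thesis using that by blast
qed

subsection \<open>The free nonassociative algebra\<close>

definition mon :: "'x magma \<Rightarrow> 'x magma \<Rightarrow> 'k::field"
  where "mon m = (\<lambda>m'. if m' = m then 1 else 0)"

abbreviation gen :: "'x \<Rightarrow> 'x magma \<Rightarrow> 'k::field"
  where "gen x \<equiv> mon (Gen x)"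

lemma free_nonassoc_simps:
  "carrier (free_nonassoc X) = {f. finite {m. f m \<noteq> 0} \<and> (\<forall>m. f m \<noteq> 0 \<longrightarrow> set_magma m \<subseteq> X)}"
  "f \<otimes>\<^bsub>free_nonassoc X\<^esub> g = (\<lambda>m. case m of Gen x \<Rightarrow> 0 | Br u v \<Rightarrow> f u * g v)"
  "f \<oplus>\<^bsub>free_nonassoc X\<^esub> g = (\<lambda>m. f m + g m)"
  "\<zero>\<^bsub>free_nonassoc X\<^esub> = (\<lambda>m. 0)"
  "c \<odot>\<^bsub>free_nonassoc X\<^esub> f = (\<lambda>m. c * f m)"
  by (simp_all add: free_nonassoc_def)

lemma free_nonassoc_algebra [simp, intro]: "nonassoc_algebra (free_nonassoc X)"
proof (rule nonassoc_algebraI)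
  fix f g :: "'a magma \<Rightarrow> 'b" and c
  assume f: "f \<in> carrier (free_nonassoc X)" and g: "g \<in> carrier (free_nonassoc X)"
  have "{m. f m + g m \<noteq> 0} \<subseteq> {m. f m \<noteq> 0} \<union> {m. g m \<noteq> 0}" by auto
  moreover have "finite ({m. f m \<noteq> 0} \<union> {m. g m \<noteq> 0})"
    using f g by (simp add: free_nonassoc_simps)
  ultimately have "finite {m. f m + g m \<noteq> 0}" by (rule finite_subset)
  moreover have "f m + g m \<noteq> 0 \<Longrightarrow> f m \<noteq> 0 \<or> g m \<noteq> 0" for m by auto
  ultimately show "f \<oplus>\<^bsub>free_nonassoc X\<^esub> g \<in> carrier (free_nonassoc X)"
    using f g by (fastforce simp: free_nonassoc_simps)
  let ?h = "f \<otimes>\<^bsub>free_nonassoc X\<^esub> g"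
  have "{m. ?h m \<noteq> 0} \<subseteq> (\<lambda>(u, v). Br u v) ` ({m. f m \<noteq> 0} \<times> {m. g m \<noteq> 0})"
  proof
    fix m assume "m \<in> {m. ?h m \<noteq> 0}"
    then show "m \<in> (\<lambda>(u, v). Br u v) ` ({m. f m \<noteq> 0} \<times> {m. g m \<noteq> 0})"
      by (cases m) (auto simp: free_nonassoc_simps)
  qed
  moreover have "finite ((\<lambda>(u, v). Br u v) ` ({m. f m \<noteq> 0} \<times> {m. g m \<noteq> 0}))"
    using f g by (simp add: free_nonassoc_simps)
  ultimately have "finite {m. ?h m \<noteq> 0}" by (rule finite_subset)
  moreover have "set_magma m \<subseteq> X" if "?h m \<noteq> 0" for m
    using that f g by (cases m) (auto simp: free_nonassoc_simps)
  ultimately show "?h \<in> carrier (free_nonassoc X)" by (simp add: free_nonassoc_simps)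
next
  fix f :: "'a magma \<Rightarrow> 'b" and c
  assume f: "f \<in> carrier (free_nonassoc X)"
  have "finite {m. c * f m \<noteq> 0}" 
    by (rule finite_subset[of _ "{m. f m \<noteq> 0}"]) (use f in \<open>auto simp: free_nonassoc_simps\<close>)
  then show "c \<odot>\<^bsub>free_nonassoc X\<^esub> f \<in> carrier (free_nonassoc X)"
    using f by (simp add: free_nonassoc_simps)
qed (auto simp: free_nonassoc_simps algebra_simps fun_eq_iff split: magma.splits)

abbreviation polys :: "'x set \<Rightarrow> ('x magma \<Rightarrow> 'k::field) set"
  where "polys X \<equiv> carrier (free_nonassoc X)"

lemma mon_closed: "set_magma m \<subseteq> X \<Longrightarrow> mon m \<in> polys X"
  by (simp add: mon_def free_nonassoc_simps)

lemma gen_closed [simp]: "x \<in> X \<Longrightarrow> gen x \<in> polys X"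
  by (simp add: mon_closed)

lemma mon_Br: "mon (Br u v) = mon u \<otimes>\<^bsub>free_nonassoc X\<^esub> mon v"
  by (auto simp: mon_def free_nonassoc_simps fun_eq_iff split: magma.split)

lemma free_nonassoc_mono: "X \<subseteq> Y \<Longrightarrow> f \<in> polys X \<Longrightarrow> f \<in> polys Y"
  by (auto simp: free_nonassoc_simps)

text \<open>The predicate \<open>Q\<close> confines the monomials that are added, so that an
  induction can stay inside an alphabet, a weight component or the Lie kernel.\<close>

lemma fin_supp_induct [consumes 2, case_names zero add]:
  assumes "finite {m. f m \<noteq> (0::'k::field)}" and "\<forall>m. f m \<noteq> 0 \<longrightarrow> Q m"
    and zero: "P (\<lambda>m. 0)"
    and add: "\<And>m c g. Q m \<Longrightarrow> finite {m. g m \<noteq> 0} \<Longrightarrow> (\<And>m. g m \<noteq> 0 \<Longrightarrow> Q m) \<Longrightarrow> P g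
      \<Longrightarrow> P (\<lambda>m'. g m' + c * mon m m')"
  shows "P f"
proof -
  have "finite S \<Longrightarrow> S = {m. f m \<noteq> 0} \<Longrightarrow> (\<And>m. f m \<noteq> 0 \<Longrightarrow> Q m) \<Longrightarrow> P f" for S
  proof (induction S arbitrary: f rule: finite_induct)
    case empty
    then have "f = (\<lambda>m. 0)" by auto
    then show ?case using zero by simp
  next
    case (insert m S)
    define g where "g = f(m := 0)"
    have S: "S = {m. g m \<noteq> 0}" using insert.hyps insert.prems(1) by (auto simp: g_def)
    have Q: "Q m'" if "g m' \<noteq> 0" for m'
      using that insert.prems(2) by (auto simp: g_def split: if_splits)
    have "P (\<lambda>m'. g m' + f m * mon m m')"
      using insert.IH[OF S Q] S insert.hyps insert.prems Q by (intro add) auto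
    moreover have "(\<lambda>m'. g m' + f m * mon m m') = f" by (auto simp: g_def mon_def)
    ultimately show ?case by simp
  qed
  then show ?thesis using assms(1,2) by blast
qed

lemma free_nonassoc_induct [consumes 1, case_names zero add smult mult gen]:
  assumes "f \<in> polys X"
    and zero: "P \<zero>\<^bsub>free_nonassoc X\<^esub>"
    and add: "\<And>f g. \<lbrakk>f \<in> polys X; g \<in> polys X; P f; P g\<rbrakk>
      \<Longrightarrow> P (f \<oplus>\<^bsub>free_nonassoc X\<^esub> g)"
    and smult: "\<And>c f. \<lbrakk>f \<in> polys X; P f\<rbrakk> \<Longrightarrow> P (c \<odot>\<^bsub>free_nonassoc X\<^esub> f)"
    and mult: "\<And>f g. \<lbrakk>f \<in> polys X; g \<in> polys X; P f; P g\<rbrakk>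
      \<Longrightarrow> P (f \<otimes>\<^bsub>free_nonassoc X\<^esub> g)"
    and gen: "\<And>x. x \<in> X \<Longrightarrow> P (gen x)"
  shows "P f"
proof -
  have m: "P (mon m)" if "set_magma m \<subseteq> X" for m
    using that by (induction m) (auto simp: gen mon_Br[of _ _ X] intro!: mult mon_closed)
  have "finite {m. f m \<noteq> 0}" "\<forall>m. f m \<noteq> 0 \<longrightarrow> set_magma m \<subseteq> X"
    using assms(1) by (auto simp: free_nonassoc_simps)
  then have "f \<in> polys X \<and> P f"
  proof (induction rule: fin_supp_induct)
    case zero
    then show ?case using assms(2) by (simp add: free_nonassoc_simps)
  next
    case (add m c g)
    interpret nonassoc_algebra "free_nonassoc X :: ('b, 'a magma \<Rightarrow> 'b) module" ..
    have "g \<oplus>\<^bsub>free_nonassoc X\<^esub> c \<odot>\<^bsub>free_nonassoc X\<^esub> mon m = (\<lambda>m'. g m' + c * mon m m')"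
      by (simp add: free_nonassoc_simps)
    moreover have "(mon m :: 'a magma \<Rightarrow> 'b) \<in> polys X" using add by (intro mon_closed)
    ultimately show ?case
      using assms(3)[of g "c \<odot>\<^bsub>free_nonassoc X\<^esub> mon m"] add m[of m] smult[of "mon m" c]
        a_closed[of g "c \<odot>\<^bsub>free_nonassoc X\<^esub> mon m"] smult_in[of "mon m" c] by simp
  qed
  then show ?thesis by simp
qed

section \<open>Evaluation: the universal property of the free nonassociative algebra\<close>

primrec ev_magma :: "('k::field, 'a) module \<Rightarrow> ('x \<Rightarrow> 'a) \<Rightarrow> 'x magma \<Rightarrow> 'a"
  where
    "ev_magma G \<phi> (Gen x) = \<phi> x"
  | "ev_magma G \<phi> (Br u v) = ev_magma G \<phi> u \<otimes>\<^bsub>G\<^esub> ev_magma G \<phi> v"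

definition ev :: "('k::field, 'a) module \<Rightarrow> ('x \<Rightarrow> 'a) \<Rightarrow> ('x magma \<Rightarrow> 'k) \<Rightarrow> 'a"
  where "ev G \<phi> f = finsum G (\<lambda>m. f m \<odot>\<^bsub>G\<^esub> ev_magma G \<phi> m) {m. f m \<noteq> 0}"

context nonassoc_algebra
begin

context
  fixes \<phi> :: "'x \<Rightarrow> 'a" and X
  assumes \<phi>: "\<phi> \<in> X \<rightarrow> carrier L"
begin

lemma ev_magma_closed: "set_magma m \<subseteq> X \<Longrightarrow> ev_magma L \<phi> m \<in> carrier L"
  using \<phi> by (induction m) auto

lemma ev_superset:
  assumes "finite S" "{m. f m \<noteq> 0} \<subseteq> S" "\<And>m. m \<in> S \<Longrightarrow> set_magma m \<subseteq> X"
  shows "ev L \<phi> f = finsum L (\<lambda>m. f m \<odot> ev_magma L \<phi> m) S"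
  unfolding ev_def
  by (rule add.finprod_mono_neutral_cong_left) (use assms ev_magma_closed in auto)

lemma ev_zero: "ev L \<phi> (\<lambda>m. 0) = \<zero>"
  by (simp add: ev_def)

lemma ev_closed: "f \<in> polys X \<Longrightarrow> ev L \<phi> f \<in> carrier L"
  unfolding ev_def using ev_magma_closed by (intro finsum_closed) (auto simp: free_nonassoc_simps)

lemma ev_mon: "set_magma m \<subseteq> X \<Longrightarrow> ev L \<phi> (mon m) = ev_magma L \<phi> m"
proof -
  assume *: "set_magma m \<subseteq> X"
  have "ev L \<phi> (mon m) = finsum L (\<lambda>m'. mon m m' \<odot> ev_magma L \<phi> m') {m}"
    by (rule ev_superset) (use * in \<open>auto simp: mon_def\<close>)
  also have "\<dots> = ev_magma L \<phi> m"
    using ev_magma_closed[OF *] by (simp add: mon_def)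
  finally show ?thesis .
qed

lemma ev_add:
  assumes "f \<in> polys X" "g \<in> polys X"
  shows "ev L \<phi> (\<lambda>m. f m + g m) = ev L \<phi> f \<oplus> ev L \<phi> g"
proof -
  let ?S = "{m. f m \<noteq> 0} \<union> {m. g m \<noteq> 0}"
  have fin: "finite ?S" and S: "\<And>m. m \<in> ?S \<Longrightarrow> set_magma m \<subseteq> X"
    using assms by (auto simp: free_nonassoc_simps)
  have "ev L \<phi> (\<lambda>m. f m + g m) = finsum L (\<lambda>m. (f m + g m) \<odot> ev_magma L \<phi> m) ?S"
    by (rule ev_superset[OF fin]) (use S in auto)
  also have "\<dots> = finsum L (\<lambda>m. f m \<odot> ev_magma L \<phi> m \<oplus> g m \<odot> ev_magma L \<phi> m) ?S"
    by (rule finsum_cong') (use S ev_magma_closed in \<open>auto simp: smult_add_left\<close>)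
  also have "\<dots> = finsum L (\<lambda>m. f m \<odot> ev_magma L \<phi> m) ?S \<oplus> finsum L (\<lambda>m. g m \<odot> ev_magma L \<phi> m) ?S"
    by (rule finsum_addf) (use S ev_magma_closed in auto)
  also have "\<dots> = ev L \<phi> f \<oplus> ev L \<phi> g"
    using ev_superset[OF fin _ S, of f] ev_superset[OF fin _ S, of g] by auto
  finally show ?thesis .
qed

lemma ev_smult:
  assumes "f \<in> polys X"
  shows "ev L \<phi> (\<lambda>m. c * f m) = c \<odot> ev L \<phi> f"
proof -
  have "finite {m. f m \<noteq> 0}" "\<forall>m. f m \<noteq> 0 \<longrightarrow> set_magma m \<subseteq> X"
    using assms by (auto simp: free_nonassoc_simps)
  then have "f \<in> polys X \<and> ev L \<phi> (\<lambda>m. c * f m) = c \<odot> ev L \<phi> f"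
  proof (induction rule: fin_supp_induct)
    case zero
    then show ?case by (simp add: ev_zero free_nonassoc_simps)
  next
    case (add m b g)
    interpret N: nonassoc_algebra "free_nonassoc X :: ('k, 'x magma \<Rightarrow> 'k) module" ..
    have 1: "(\<lambda>m'. a * mon m m') \<in> polys X" for a :: 'k
      using N.smult_in[OF mon_closed[of m X], of a] add by (simp add: free_nonassoc_simps(5))
    have 2: "(\<lambda>m. c * g m) \<in> polys X"
      using N.smult_in[of g c] add by (simp add: free_nonassoc_simps(5))
    have 3: "ev L \<phi> (\<lambda>m'. a * mon m m') = a \<odot> ev_magma L \<phi> m" for a
    proof -
      have "ev L \<phi> (\<lambda>m'. a * mon m m') = finsum L (\<lambda>m'. (a * mon m m') \<odot> ev_magma L \<phi> m') {m}"
        by (rule ev_superset) (use add in \<open>auto simp: mon_def\<close>)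
      also have "\<dots> = a \<odot> ev_magma L \<phi> m"
        using ev_magma_closed[of m] add by (simp add: mon_def)
      finally show ?thesis .
    qed
    have g: "g \<in> polys X" using add by simp
    have "ev L \<phi> (\<lambda>m'. c * (g m' + b * mon m m'))
      = ev L \<phi> (\<lambda>m'. c * g m' + (c * b) * mon m m')" by (simp add: algebra_simps)
    also have "\<dots> = c \<odot> ev L \<phi> g \<oplus> (c * b) \<odot> ev_magma L \<phi> m"
      by (subst ev_add[OF 2 1]) (use 3 add in simp)
    also have "\<dots> = c \<odot> (ev L \<phi> g \<oplus> b \<odot> ev_magma L \<phi> m)"
      using ev_closed[OF g] ev_magma_closed[of m] add by (simp add: smult_add_right smult_smult)
    also have "ev L \<phi> g \<oplus> b \<odot> ev_magma L \<phi> m = ev L \<phi> (\<lambda>m'. g m' + b * mon m m')"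
      by (subst ev_add[OF g 1]) (use 3 in simp)
    finally show ?case using N.a_closed[OF g 1[of b]] by (simp add: free_nonassoc_simps(3))
  qed
  then show ?thesis by simp
qed

lemma ev_mult_mon:
  assumes "f \<in> polys X" "set_magma u \<subseteq> X"
  shows "ev L \<phi> (mon u \<otimes>\<^bsub>free_nonassoc X\<^esub> f) = ev_magma L \<phi> u \<otimes> ev L \<phi> f"
proof -
  interpret N: nonassoc_algebra "free_nonassoc X :: ('k, 'x magma \<Rightarrow> 'k) module" ..
  have "finite {m. f m \<noteq> 0}" "\<forall>m. f m \<noteq> 0 \<longrightarrow> set_magma m \<subseteq> X"
    using assms by (auto simp: free_nonassoc_simps)
  then have "f \<in> polys X \<and> 
    ev L \<phi> (mon u \<otimes>\<^bsub>free_nonassoc X\<^esub> f) = ev_magma L \<phi> u \<otimes> ev L \<phi> f"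
  proof (induction rule: fin_supp_induct)
    case zero
    have "mon u \<otimes>\<^bsub>free_nonassoc X\<^esub> (\<lambda>m. 0) = (\<lambda>m. 0 :: 'k)"
      using N.bracket_zero[OF mon_closed[OF assms(2)]] by (simp add: free_nonassoc_simps(4))
    then show ?case using ev_magma_closed[OF assms(2)] by (simp add: ev_zero free_nonassoc_simps(1))
  next
    case (add m c g)
    have g: "g \<in> polys X" and m: "(mon m :: _ \<Rightarrow> 'k) \<in> polys X"
      and u: "(mon u :: _ \<Rightarrow> 'k) \<in> polys X"
      using add mon_closed[of m X] mon_closed[of u X] assms(2) by auto
    have eq: "(\<lambda>m'. g m' + c * mon m m') = g \<oplus>\<^bsub>free_nonassoc X\<^esub> c \<odot>\<^bsub>free_nonassoc X\<^esub> mon m"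
      by (simp add: free_nonassoc_simps)
    have h: "mon u \<otimes>\<^bsub>free_nonassoc X\<^esub> (g \<oplus>\<^bsub>free_nonassoc X\<^esub> c \<odot>\<^bsub>free_nonassoc X\<^esub> mon m)
      = (mon u \<otimes>\<^bsub>free_nonassoc X\<^esub> g) \<oplus>\<^bsub>free_nonassoc X\<^esub> c \<odot>\<^bsub>free_nonassoc X\<^esub> mon (Br u m)"
      using g m u by (simp add: N.bracket_add_right N.bracket_smult_right mon_Br[of u m X])
    have add': "ev L \<phi> (a \<oplus>\<^bsub>free_nonassoc X\<^esub> c \<odot>\<^bsub>free_nonassoc X\<^esub> b) = ev L \<phi> a \<oplus> c \<odot> ev L \<phi> b"
      if "a \<in> polys X" "b \<in> polys X" for a b
      using that ev_add[of a "c \<odot>\<^bsub>free_nonassoc X\<^esub> b"] ev_smult[of b c] N.smult_in[of b c]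
      by (simp add: free_nonassoc_simps(3,5))
    have b: "(mon (Br u m) :: _ \<Rightarrow> 'k) \<in> polys X" using add assms(2) by (intro mon_closed) simp
    have "ev L \<phi> (mon u \<otimes>\<^bsub>free_nonassoc X\<^esub> (\<lambda>m'. g m' + c * mon m m'))
      = ev_magma L \<phi> u \<otimes> ev L \<phi> g \<oplus> c \<odot> (ev_magma L \<phi> u \<otimes> ev_magma L \<phi> m)"
      using add assms(2) by (simp add: eq h add'[OF N.bracket_closed[OF u g] b] ev_mon)
    also have "\<dots> = ev_magma L \<phi> u \<otimes> ev L \<phi> (\<lambda>m'. g m' + c * mon m m')"
      using add assms(2) ev_magma_closed[of u] ev_magma_closed[of m] ev_closed[OF g]
      by (simp add: eq add'[OF g m] ev_mon bracket_add_right bracket_smult_right)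
    finally show ?case using eq N.a_closed[OF g N.smult_in[OF m, of c]] by simp
  qed
  then show ?thesis by simp
qed

lemma ev_mult:
  assumes "f \<in> polys X" "g \<in> polys X"
  shows "ev L \<phi> (f \<otimes>\<^bsub>free_nonassoc X\<^esub> g) = ev L \<phi> f \<otimes> ev L \<phi> g"
proof -
  interpret N: nonassoc_algebra "free_nonassoc X :: ('k, 'x magma \<Rightarrow> 'k) module" ..
  have "finite {m. f m \<noteq> 0}" "\<forall>m. f m \<noteq> 0 \<longrightarrow> set_magma m \<subseteq> X"
    using assms by (auto simp: free_nonassoc_simps)
  then have "f \<in> polys X \<and> 
    ev L \<phi> (f \<otimes>\<^bsub>free_nonassoc X\<^esub> g) = ev L \<phi> f \<otimes> ev L \<phi> g"
  proof (induction rule: fin_supp_induct)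
    case zero
    have "(\<lambda>m. 0) \<otimes>\<^bsub>free_nonassoc X\<^esub> g = (\<lambda>m. 0 :: 'k)"
      using N.zero_bracket[OF assms(2)] by (simp add: free_nonassoc_simps(4))
    then show ?case using ev_closed[OF assms(2)] by (simp add: ev_zero free_nonassoc_simps(1))
  next
    case (add m c f)
    have f: "f \<in> polys X" and m: "(mon m :: _ \<Rightarrow> 'k) \<in> polys X"
      using add mon_closed[of m X] by auto
    have eq: "(\<lambda>m'. f m' + c * mon m m') = f \<oplus>\<^bsub>free_nonassoc X\<^esub> c \<odot>\<^bsub>free_nonassoc X\<^esub> mon m"
      by (simp add: free_nonassoc_simps)
    have h: "(f \<oplus>\<^bsub>free_nonassoc X\<^esub> c \<odot>\<^bsub>free_nonassoc X\<^esub> mon m) \<otimes>\<^bsub>free_nonassoc X\<^esub> g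
      = (f \<otimes>\<^bsub>free_nonassoc X\<^esub> g) \<oplus>\<^bsub>free_nonassoc X\<^esub> c \<odot>\<^bsub>free_nonassoc X\<^esub> (mon m \<otimes>\<^bsub>free_nonassoc X\<^esub> g)"
      using f m assms(2) by (simp add: N.bracket_add_left N.bracket_smult_left)
    have add': "ev L \<phi> (a \<oplus>\<^bsub>free_nonassoc X\<^esub> c \<odot>\<^bsub>free_nonassoc X\<^esub> b) = ev L \<phi> a \<oplus> c \<odot> ev L \<phi> b"
      if "a \<in> polys X" "b \<in> polys X" for a b
      using that ev_add[of a "c \<odot>\<^bsub>free_nonassoc X\<^esub> b"] ev_smult[of b c] N.smult_in[of b c]
      by (simp add: free_nonassoc_simps(3,5))
    have "ev L \<phi> ((\<lambda>m'. f m' + c * mon m m') \<otimes>\<^bsub>free_nonassoc X\<^esub> g)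
      = ev L \<phi> f \<otimes> ev L \<phi> g \<oplus> c \<odot> (ev_magma L \<phi> m \<otimes> ev L \<phi> g)"
      using add by (simp add: eq h add'[OF N.bracket_closed[OF f assms(2)] N.bracket_closed[OF m assms(2)]]
        ev_mult_mon[OF assms(2)])
    also have "\<dots> = ev L \<phi> (\<lambda>m'. f m' + c * mon m m') \<otimes> ev L \<phi> g"
      using add ev_magma_closed[of m] ev_closed[OF f] ev_closed[OF assms(2)]
      by (simp add: eq add'[OF f m] ev_mon bracket_add_left bracket_smult_left)
    finally show ?case using eq N.a_closed[OF f N.smult_in[OF m, of c]] by simp
  qed
  then show ?thesis by simp
qed

lemma ev_hom: "alg_hom (free_nonassoc X) L (ev L \<phi>)"
  by (rule alg_homI)
    (auto simp: ev_closed ev_mult ev_add[unfolded free_nonassoc_simps(3)] free_nonassoc_simps(3,5) ev_add ev_smult)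

lemma ev_gen: "x \<in> X \<Longrightarrow> ev L \<phi> (gen x) = \<phi> x"
  by (simp add: ev_mon)

end

end

lemma free_nonassoc_hom_eq:
  assumes "alg_hom (free_nonassoc X) G \<theta>" "alg_hom (free_nonassoc X) G \<theta>'" "nonassoc_algebra G"
    and gen: "\<And>x. x \<in> X \<Longrightarrow> \<theta> (gen x) = \<theta>' (gen x)" and "f \<in> polys X"
  shows "\<theta> f = \<theta>' f"
  using assms(5)
proof (induction rule: free_nonassoc_induct)
  case zero
  show ?case
    using alg_hom_zero[OF assms(1) _ assms(3)] alg_hom_zero[OF assms(2) _ assms(3)] by simp
next
  case (add f g)
  then show ?case using alg_homD(2)[OF assms(1)] alg_homD(2)[OF assms(2)] by simp
next
  case (smult c f)
  then show ?case using alg_homD(3)[OF assms(1)] alg_homD(3)[OF assms(2)] by simp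
next
  case (mult f g)
  then show ?case using alg_homD(4)[OF assms(1)] alg_homD(4)[OF assms(2)] by simp
qed (rule gen)

lemma ev_unique:
  assumes "alg_hom (free_nonassoc X) G \<theta>" "nonassoc_algebra G"
    and "\<And>x. x \<in> X \<Longrightarrow> \<theta> (gen x) = \<phi> x" and "f \<in> polys X"
  shows "\<theta> f = ev G \<phi> f"
proof -
  interpret nonassoc_algebra G by fact
  have *: "\<phi> \<in> X \<rightarrow> carrier G" using alg_homD(1)[OF assms(1) gen_closed] assms(3) by force
  show ?thesis
    by (rule free_nonassoc_hom_eq[OF assms(1) ev_hom[OF *] assms(2) _ assms(4)])
      (simp add: assms(3) ev_gen[OF *])
qed

lemma ev_cong:
  "f \<in> polys X \<Longrightarrow> nonassoc_algebra G \<Longrightarrow> \<phi> \<in> X \<rightarrow> carrier G \<Longrightarrow>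
    (\<And>x. x \<in> X \<Longrightarrow> \<phi> x = \<psi> x) \<Longrightarrow> ev G \<phi> f = ev G \<psi> f"
  by (rule ev_unique) (auto intro: nonassoc_algebra.ev_hom simp: nonassoc_algebra.ev_gen)

lemma hom_ev:
  assumes "alg_hom G H \<theta>" "nonassoc_algebra G" "nonassoc_algebra H" "\<phi> \<in> X \<rightarrow> carrier G"
    "f \<in> polys X"
  shows "\<theta> (ev G \<phi> f) = ev H (\<lambda>x. \<theta> (\<phi> x)) f"
proof (rule ev_unique[where X = X and \<theta> = "\<lambda>f. \<theta> (ev G \<phi> f)"])
  show "alg_hom (free_nonassoc X) H (\<lambda>f. \<theta> (ev G \<phi> f))"
    by (rule alg_hom_comp[OF nonassoc_algebra.ev_hom[OF assms(2,4)] assms(1)])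
qed (use assms in \<open>auto simp: nonassoc_algebra.ev_gen[OF assms(2,4)]\<close>)

text \<open>Only the carrier of \<open>free_nonassoc X\<close> depends on \<open>X\<close>, not its
  operations; hence a polynomial is the same function over every alphabet that contains its
  letters.\<close>

lemma free_nonassoc_inclusion: "X \<subseteq> Y \<Longrightarrow> alg_hom (free_nonassoc X) (free_nonassoc Y) (\<lambda>f. f)"
  by (rule alg_homI) (auto intro: free_nonassoc_mono simp: free_nonassoc_simps)

lemma alg_hom_restrict:
  assumes "alg_hom (free_nonassoc Y) G \<phi>" "X \<subseteq> Y"
  shows "alg_hom (free_nonassoc X) G \<phi>"
proof (rule alg_homI)
  note D = alg_homD[OF assms(1)] and m = free_nonassoc_mono[OF assms(2)]
  fix f g :: "'a magma \<Rightarrow> 'b" and c assume f: "f \<in> polys X"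
  show "\<phi> f \<in> carrier G" using D(1)[OF m[OF f]] .
  show "\<phi> (c \<odot>\<^bsub>free_nonassoc X\<^esub> f) = c \<odot>\<^bsub>G\<^esub> \<phi> f"
    using D(3)[OF m[OF f]] by (simp add: free_nonassoc_simps)
  assume g: "g \<in> polys X"
  show "\<phi> (f \<oplus>\<^bsub>free_nonassoc X\<^esub> g) = \<phi> f \<oplus>\<^bsub>G\<^esub> \<phi> g"
    using D(2)[OF m[OF f] m[OF g]] by (simp add: free_nonassoc_simps)
  show "\<phi> (f \<otimes>\<^bsub>free_nonassoc X\<^esub> g) = \<phi> f \<otimes>\<^bsub>G\<^esub> \<phi> g"
    using D(4)[OF m[OF f] m[OF g]] by (simp add: free_nonassoc_simps)
qed


section \<open>Presentations\<close>

text \<open>Lie identities and relators go into one ideal of the free nonassociative algebra. This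
  replaces the quotient of a quotient in \<open>lie_presentation\<close> and lets relators be
  concrete polynomials.\<close>

definition pres_ideal :: "'x set \<Rightarrow> ('x magma \<Rightarrow> 'k::field) set \<Rightarrow> ('x magma \<Rightarrow> 'k) set"
  where "pres_ideal X R = alg_ideal_gen (free_nonassoc X) (lie_relators (free_nonassoc X) \<union> R)"

text \<open>A relation instead of a construction: the same algebra has to be presented over
  different alphabets, by different relators, and on a prescribed element type.\<close>

definition presents ::
    "'x set \<Rightarrow> ('x magma \<Rightarrow> 'k::field) set \<Rightarrow> ('k, 'a) module \<Rightarrow> (('x magma \<Rightarrow> 'k) \<Rightarrow> 'a) \<Rightarrow> bool"
  where "presents X R L \<pi> \<longleftrightarrow> lie_algebra L \<and> R \<subseteq> polys X \<and>
    alg_hom (free_nonassoc X) L \<pi> \<and> \<pi> ` polys X = carrier L \<and>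
    (\<forall>f\<in>polys X. \<pi> f = \<zero>\<^bsub>L\<^esub> \<longleftrightarrow> f \<in> pres_ideal X R)"

lemma lie_kernel_eq: "lie_kernel X = pres_ideal X {}"
  by (simp add: lie_kernel_def pres_ideal_def)

lemma pres_ideal_ideal: "R \<subseteq> polys X \<Longrightarrow> alg_ideal (free_nonassoc X) (pres_ideal X R)"
  unfolding pres_ideal_def by (rule alg_ideal_gen_ideal) (auto simp: lie_relators_subset)

lemma lie_kernel_ideal: "alg_ideal (free_nonassoc X) (lie_kernel X)"
  by (simp add: lie_kernel_eq pres_ideal_ideal)

lemma pres_ideal_relators: "R \<subseteq> pres_ideal X R" "lie_relators (free_nonassoc X) \<subseteq> pres_ideal X R"
  unfolding pres_ideal_def by (meson alg_ideal_gen_superset le_sup_iff)+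

lemma lie_kernel_subset: "R \<subseteq> polys X \<Longrightarrow> lie_kernel X \<subseteq> pres_ideal X R"
  unfolding lie_kernel_def
  by (rule alg_ideal_gen_min[OF pres_ideal_ideal pres_ideal_relators(2)])

lemma pres_ideal_hom:
  assumes "alg_hom (free_nonassoc X) M \<phi>" "nonassoc_algebra M" "alg_ideal M I"
    and "lie_relators M \<subseteq> I" "R \<subseteq> polys X" "\<And>r. r \<in> R \<Longrightarrow> \<phi> r \<in> I"
    and "f \<in> pres_ideal X R"
  shows "\<phi> f \<in> I"
proof (rule alg_ideal_gen_hom[OF assms(1) _ assms(2,3) _ _ assms(7)[unfolded pres_ideal_def]])
  show "lie_relators (free_nonassoc X) \<union> R \<subseteq> polys X"
    using assms(5) lie_relators_subset by auto
qed (use assms lie_relators_hom[OF assms(1)] in auto)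

lemma hom_pres_ideal:
  assumes "alg_hom (free_nonassoc X) M \<phi>" "lie_algebra M"
    and "R \<subseteq> polys X" "\<And>r. r \<in> R \<Longrightarrow> \<phi> r = \<zero>\<^bsub>M\<^esub>" "f \<in> pres_ideal X R"
  shows "\<phi> f = \<zero>\<^bsub>M\<^esub>"
proof -
  have M: "nonassoc_algebra M" "lie_relators M \<subseteq> {\<zero>\<^bsub>M\<^esub>}"
    using assms(2) lie_algebra_iff[of M] lie_algebra_iff_relators[of M] by simp_all
  have "\<phi> f \<in> {\<zero>\<^bsub>M\<^esub>}"
    by (rule pres_ideal_hom[OF assms(1) M(1) alg_ideal_zero[OF M(1)] M(2) assms(3) _ assms(5)])
      (simp add: assms(4))
  then show ?thesis by simp
qed

lemma hom_lie_kernel: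
  assumes "alg_hom (free_nonassoc X) M \<phi>" "lie_algebra M" "f \<in> lie_kernel X"
  shows "\<phi> f = \<zero>\<^bsub>M\<^esub>"
  using hom_pres_ideal[of X M \<phi> "{}" f] assms by (simp add: lie_kernel_eq)

lemma presentsI:
  assumes "lie_algebra L" "R \<subseteq> polys X"
    and "alg_hom (free_nonassoc X) L \<pi>" "carrier L \<subseteq> \<pi> ` polys X"
    and "\<And>r. r \<in> R \<Longrightarrow> \<pi> r = \<zero>\<^bsub>L\<^esub>"
    and "\<And>f. f \<in> polys X \<Longrightarrow> \<pi> f = \<zero>\<^bsub>L\<^esub> \<Longrightarrow> f \<in> pres_ideal X R"
  shows "presents X R L \<pi>"
  unfolding presents_def using assms hom_pres_ideal[OF assms(3,1,2,5)] alg_homD(1)[OF assms(3)] by auto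

lemma presentsD:
  assumes "presents X R L \<pi>"
  shows "lie_algebra L" "nonassoc_algebra L" "R \<subseteq> polys X" "alg_hom (free_nonassoc X) L \<pi>"
    "\<pi> ` polys X = carrier L" "r \<in> R \<Longrightarrow> \<pi> r = \<zero>\<^bsub>L\<^esub>"
    "f \<in> polys X \<Longrightarrow> \<pi> f = \<zero>\<^bsub>L\<^esub> \<longleftrightarrow> f \<in> pres_ideal X R"
  using assms pres_ideal_relators(1)[of R X] by (auto simp: presents_def lie_algebra_iff)

lemma presents_ev:
  assumes "presents X R L \<pi>" "f \<in> polys X"
  shows "\<pi> f = ev L (\<lambda>x. \<pi> (gen x)) f"
  by (rule ev_unique[OF presentsD(4,2)[OF assms(1)] _ assms(2)]) simp

lemma presents_quot:
  assumes "R \<subseteq> polys X"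
  shows "presents X R (alg_quot (free_nonassoc X) (pres_ideal X R))
    (\<lambda>f. pres_ideal X R +>\<^bsub>free_nonassoc X\<^esub> f)"
  unfolding presents_def
  using alg_quot_lie_algebra[OF _ pres_ideal_ideal[OF assms] pres_ideal_relators(2)]
    alg_quot_hom[OF _ pres_ideal_ideal[OF assms]] assms alg_quot_simps(1)[OF _ pres_ideal_ideal[OF assms]]
    alg_quot_zero_iff[OF _ pres_ideal_ideal[OF assms]]
  by auto

lemma presents_lift:
  assumes "presents X R L \<pi>" "lie_algebra G" "\<phi> \<in> X \<rightarrow> carrier G"
    and "\<And>r. r \<in> R \<Longrightarrow> ev G \<phi> r = \<zero>\<^bsub>G\<^esub>"
  obtains \<Phi> where "alg_hom L G \<Phi>" "\<And>f. f \<in> polys X \<Longrightarrow> \<Phi> (\<pi> f) = ev G \<phi> f"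
proof -
  have G: "nonassoc_algebra G" using assms(2) lie_algebra_iff by auto
  have e: "alg_hom (free_nonassoc X) G (ev G \<phi>)" by (rule nonassoc_algebra.ev_hom[OF G assms(3)])
  have "ev G \<phi> f = \<zero>\<^bsub>G\<^esub>" if "f \<in> polys X" "\<pi> f = \<zero>\<^bsub>L\<^esub>" for f
    using presentsD(7)[OF assms(1) that(1)] that(2)
    by (intro hom_pres_ideal[OF e assms(2) presentsD(3)[OF assms(1)] assms(4)]) auto
  from alg_hom_factor[OF presentsD(4)[OF assms(1)] e free_nonassoc_algebra presentsD(2)[OF assms(1)] G
      presentsD(5)[OF assms(1)] this]
  show ?thesis using that by blast
qed

lemma presents_hom_eq:
  assumes "presents X R L \<pi>" "nonassoc_algebra G" "alg_hom L G \<Phi>" "alg_hom L G \<Psi>"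
    and "\<And>x. x \<in> X \<Longrightarrow> \<Phi> (\<pi> (gen x)) = \<Psi> (\<pi> (gen x))" "l \<in> carrier L"
  shows "\<Phi> l = \<Psi> l"
proof -
  obtain f where f: "f \<in> polys X" "l = \<pi> f"
    using presentsD(5)[OF assms(1)] assms(6) by auto
  have "\<Phi> (\<pi> f) = \<Psi> (\<pi> f)"
    by (rule free_nonassoc_hom_eq[OF alg_hom_comp[OF presentsD(4)[OF assms(1)] assms(3)]
      alg_hom_comp[OF presentsD(4)[OF assms(1)] assms(4)] assms(2,5) f(1)])
  then show ?thesis by (simp add: f)
qed

lemma alg_hom_id: "alg_hom L L (\<lambda>x. x)"
  by (rule alg_homI) auto

lemma mutually_inverse_lie_iso:
  assumes "alg_hom L M \<Phi>" "alg_hom M L \<Psi>"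
    and "\<And>x. x \<in> carrier L \<Longrightarrow> \<Psi> (\<Phi> x) = x" "\<And>y. y \<in> carrier M \<Longrightarrow> \<Phi> (\<Psi> y) = y"
  shows "lie_iso L M"
proof -
  have "bij_betw \<Phi> (carrier L) (carrier M)"
    by (rule bij_betw_byWitness[of _ \<Psi>])
      (use assms(3,4) alg_homD(1)[OF assms(1)] alg_homD(1)[OF assms(2)] in auto)
  then show ?thesis unfolding lie_iso_alg_hom using assms(1) by blast
qed

lemma presents_iso:
  assumes "presents X R L \<pi>" "presents X R M \<pi>'"
  shows "lie_iso L M"
proof -
  obtain \<Phi> where \<Phi>: "alg_hom L M \<Phi>" "\<And>f. f \<in> polys X \<Longrightarrow> \<Phi> (\<pi> f) = \<pi>' f"
    by (rule alg_hom_factor[OF presentsD(4)[OF assms(1)] presentsD(4)[OF assms(2)] _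
        presentsD(2)[OF assms(1)] presentsD(2)[OF assms(2)] presentsD(5)[OF assms(1)]])
      (auto simp: presentsD(7)[OF assms(1)] presentsD(7)[OF assms(2)])
  obtain \<Psi> where \<Psi>: "alg_hom M L \<Psi>" "\<And>f. f \<in> polys X \<Longrightarrow> \<Psi> (\<pi>' f) = \<pi> f"
    by (rule alg_hom_factor[OF presentsD(4)[OF assms(2)] presentsD(4)[OF assms(1)] _
        presentsD(2)[OF assms(2)] presentsD(2)[OF assms(1)] presentsD(5)[OF assms(2)]])
      (auto simp: presentsD(7)[OF assms(1)] presentsD(7)[OF assms(2)])
  show ?thesis
  proof (rule mutually_inverse_lie_iso[OF \<Phi>(1) \<Psi>(1)])
    show "\<Psi> (\<Phi> x) = x" if "x \<in> carrier L" for x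
      using that \<Phi>(2) \<Psi>(2) unfolding presentsD(5)[OF assms(1), symmetric] by auto
    show "\<Phi> (\<Psi> x) = x" if "x \<in> carrier M" for x
      using that \<Phi>(2) \<Psi>(2) unfolding presentsD(5)[OF assms(2), symmetric] by auto
  qed
qed

lemma presents_transport:
  assumes "presents X R L \<pi>" "alg_hom L M \<psi>" "bij_betw \<psi> (carrier L) (carrier M)" "lie_algebra M"
  shows "presents X R M (\<lambda>f. \<psi> (\<pi> f))"
proof -
  have M: "nonassoc_algebra M" using assms(4) lie_algebra_iff by auto
  interpret L: nonassoc_algebra L by (rule presentsD(2)[OF assms(1)])
  have 0: "\<psi> l = \<zero>\<^bsub>M\<^esub> \<longleftrightarrow> l = \<zero>\<^bsub>L\<^esub>" if "l \<in> carrier L" for l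
    using alg_hom_zero[OF assms(2) L.nonassoc_algebra_axioms M] that bij_betw_imp_inj_on[OF assms(3)]
    by (metis L.zero_closed inj_onD)
  show ?thesis unfolding presents_def
  proof (intro conjI ballI)
    show "(\<lambda>f. \<psi> (\<pi> f)) ` polys X = carrier M"
      using presentsD(5)[OF assms(1)] bij_betw_imp_surj_on[OF assms(3)] by (metis image_image)
    show "(\<psi> (\<pi> f) = \<zero>\<^bsub>M\<^esub>) = (f \<in> pres_ideal X R)" if "f \<in> polys X" for f
      using 0[OF alg_homD(1)[OF presentsD(4)[OF assms(1)] that]] presentsD(7)[OF assms(1) that] by simp
  qed (use assms presentsD(3)[OF assms(1)] alg_hom_comp[OF presentsD(4)[OF assms(1)] assms(2)] in auto)
qed

text \<open>The bridge from the two successive quotients in the statement of the theorem to the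
  single quotient behind \<open>presents\<close>.\<close>

lemma presents_lie_presentation:
  fixes R :: "('x magma \<Rightarrow> 'k::field) set"
  assumes "R \<subseteq> polys X"
  defines "cls \<equiv> \<lambda>f. lie_kernel X +>\<^bsub>free_nonassoc X\<^esub> f"
  shows "\<exists>\<pi>. presents X R (lie_presentation X (cls ` R)) \<pi>"
proof -
  let ?N = "free_nonassoc X :: ('k, 'x magma \<Rightarrow> 'k) module"
  let ?F = "free_lie X :: ('k, ('k, 'x) free_lie_elem) module"
  have k: "alg_ideal ?N (lie_kernel X)" by (rule lie_kernel_ideal)
  have F: "lie_algebra ?F" unfolding free_lie_def
    by (rule alg_quot_lie_algebra[OF _ k]) (auto simp: lie_kernel_eq pres_ideal_relators)
  then have F': "nonassoc_algebra ?F" by (simp add: lie_algebra_iff)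
  have cls: "alg_hom ?N ?F cls" unfolding free_lie_def cls_def by (rule alg_quot_hom[OF _ k]) simp
  have cF: "carrier ?F = cls ` carrier ?N"
    unfolding free_lie_def cls_def by (rule alg_quot_simps(1)[OF _ k]) simp
  have RF: "cls ` R \<subseteq> carrier ?F" using assms cF by auto
  let ?I = "alg_ideal_gen ?F (cls ` R)"
  have I: "alg_ideal ?F ?I" by (rule alg_ideal_gen_ideal[OF F' RF])
  have J: "alg_ideal ?N (pres_ideal X R)" by (rule pres_ideal_ideal[OF assms(1)])
  note JD = alg_idealD[OF free_nonassoc_algebra J]
  have lie: "lie_relators ?F \<subseteq> ?I"
    using F F' lie_algebra_iff_relators alg_idealD(2)[OF F' I] by fastforce
  \<comment> \<open>As \<open>cls\<close> is surjective, it maps the ideal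
    \<open>pres_ideal X R\<close> onto an ideal of the free Lie algebra, which therefore contains
    the one generated by the classes of the relators.\<close>
  have sub: "?I \<subseteq> cls ` pres_ideal X R"
  proof (rule alg_ideal_gen_min)
    show "cls ` R \<subseteq> cls ` pres_ideal X R" using pres_ideal_relators(1)[of R X] by auto
    show "alg_ideal ?F (cls ` pres_ideal X R)"
    proof (rule alg_idealI[OF F'])
      show "cls ` pres_ideal X R \<subseteq> carrier ?F" using JD(1) cF by auto
      show "\<zero>\<^bsub>?F\<^esub> \<in> cls ` pres_ideal X R"
        using alg_hom_zero[OF cls _ F'] JD(2) by (metis free_nonassoc_algebra image_eqI)
    next
      fix x y assume "x \<in> cls ` pres_ideal X R" "y \<in> cls ` pres_ideal X R"
      then obtain f g where fg: "x = cls f" "f \<in> pres_ideal X R" "y = cls g" "g \<in> pres_ideal X R" by auto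
      then have "x \<oplus>\<^bsub>?F\<^esub> y = cls (f \<oplus>\<^bsub>?N\<^esub> g)" using alg_homD(2)[OF cls, of f g] JD(1) by auto
      then show "x \<oplus>\<^bsub>?F\<^esub> y \<in> cls ` pres_ideal X R" using JD(3)[OF fg(2,4)] by blast
    next
      fix c x assume "x \<in> cls ` pres_ideal X R"
      then obtain f where f: "x = cls f" "f \<in> pres_ideal X R" by auto
      then have "c \<odot>\<^bsub>?F\<^esub> x = cls (c \<odot>\<^bsub>?N\<^esub> f)" using alg_homD(3)[OF cls, of f c] JD(1) by auto
      then show "c \<odot>\<^bsub>?F\<^esub> x \<in> cls ` pres_ideal X R" using JD(4)[OF f(2)] by blast
    next
      fix x a assume "x \<in> carrier ?F" "a \<in> cls ` pres_ideal X R"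
      then obtain f g where f: "x = cls f" "f \<in> carrier ?N" "a = cls g" "g \<in> pres_ideal X R"
        using cF by auto
      have "x \<otimes>\<^bsub>?F\<^esub> a = cls (f \<otimes>\<^bsub>?N\<^esub> g)" "a \<otimes>\<^bsub>?F\<^esub> x = cls (g \<otimes>\<^bsub>?N\<^esub> f)"
        using alg_homD(4)[OF cls] f JD(1) by auto
      then show "x \<otimes>\<^bsub>?F\<^esub> a \<in> cls ` pres_ideal X R" "a \<otimes>\<^bsub>?F\<^esub> x \<in> cls ` pres_ideal X R"
        using JD(5,6)[OF f(2,4)] by blast+
    qed
  qed
  show ?thesis
  proof (intro exI presentsI)
    let ?\<pi> = "\<lambda>f. ?I +>\<^bsub>?F\<^esub> cls f"
    show "lie_algebra (lie_presentation X (cls ` R))"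
      unfolding lie_presentation_def by (rule alg_quot_lie_algebra[OF F' I lie])
    have q: "alg_hom ?F (lie_presentation X (cls ` R)) (\<lambda>x. ?I +>\<^bsub>?F\<^esub> x)"
      unfolding lie_presentation_def by (rule alg_quot_hom[OF F' I])
    show "alg_hom ?N (lie_presentation X (cls ` R)) ?\<pi>" by (rule alg_hom_comp[OF cls q])
    show "carrier (lie_presentation X (cls ` R)) \<subseteq> ?\<pi> ` carrier ?N"
      unfolding lie_presentation_def alg_quot_simps(1)[OF F' I] cF by auto
    have z: "?\<pi> f = \<zero>\<^bsub>lie_presentation X (cls ` R)\<^esub> \<longleftrightarrow> cls f \<in> ?I" if "f \<in> carrier ?N" for f
      unfolding lie_presentation_def by (rule alg_quot_zero_iff[OF F' I]) (use that cF in auto)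
    show "?\<pi> r = \<zero>\<^bsub>lie_presentation X (cls ` R)\<^esub>" if "r \<in> R" for r
    proof (subst z)
      show "r \<in> carrier ?N" using assms(1) that by auto
      show "cls r \<in> ?I" using alg_ideal_gen_superset[of "cls ` R" ?F] that by auto
    qed
    show "f \<in> pres_ideal X R" if f: "f \<in> carrier ?N" "?\<pi> f = \<zero>\<^bsub>lie_presentation X (cls ` R)\<^esub>" for f
    proof -
      interpret N: nonassoc_algebra ?N ..
      obtain g where g: "g \<in> pres_ideal X R" "cls f = cls g" using z[OF f(1)] f(2) sub by auto
      then have gc: "g \<in> carrier ?N" using JD(1) by auto
      have "f \<ominus>\<^bsub>?N\<^esub> g \<in> lie_kernel X"
        using g f gc alg_coset_eq_iff[OF _ k f(1) gc] by (simp add: cls_def)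
      then have "f \<ominus>\<^bsub>?N\<^esub> g \<in> pres_ideal X R" using lie_kernel_subset[OF assms(1)] by auto
      then have "f \<ominus>\<^bsub>?N\<^esub> g \<oplus>\<^bsub>?N\<^esub> g \<in> pres_ideal X R" using JD(3) g(1) by auto
      then show ?thesis using f gc by (simp add: N.minus_eq N.a_assoc N.l_neg)
    qed
  qed (use assms in auto)
qed

lemma presents_free_lie: "\<exists>\<pi>. presents X {} (free_lie X) \<pi>"
  using presents_quot[of "{}" X] by (auto simp: free_lie_def lie_kernel_eq)

text \<open>Serves twice: to turn letters into natural numbers, and to name a free basis by elements
  of the algebra's type, as \<open>is_free_lie\<close> demands.\<close>

lemma presents_relabel:
  fixes R :: "('x magma \<Rightarrow> 'k::field) set" and j :: "'x \<Rightarrow> 'y"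
  assumes "presents X R L \<pi>" "inj_on j X"
  shows "\<exists>\<pi>'. presents (j ` X) (ev (free_nonassoc (j ` X)) (\<lambda>x. gen (j x)) ` R) L \<pi>'"
proof -
  define fwd :: "('x magma \<Rightarrow> 'k) \<Rightarrow> 'y magma \<Rightarrow> 'k" where "fwd = ev (free_nonassoc (j ` X)) (\<lambda>x. gen (j x))"
  define bwd :: "('y magma \<Rightarrow> 'k) \<Rightarrow> 'x magma \<Rightarrow> 'k" where "bwd = ev (free_nonassoc X) (\<lambda>y. gen (inv_into X j y))"
  have p0: "(\<lambda>x. gen (j x) :: _ \<Rightarrow> 'k) \<in> X \<rightarrow> polys (j ` X)" by auto
  have b0: "(\<lambda>y. gen (inv_into X j y) :: _ \<Rightarrow> 'k) \<in> j ` X \<rightarrow> polys X"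
    by (auto intro!: gen_closed inv_into_into)
  have p: "alg_hom (free_nonassoc X) (free_nonassoc (j ` X)) fwd"
    unfolding fwd_def by (rule nonassoc_algebra.ev_hom[OF _ p0]) simp
  have b: "alg_hom (free_nonassoc (j ` X)) (free_nonassoc X) bwd"
    unfolding bwd_def by (rule nonassoc_algebra.ev_hom[OF _ b0]) simp
  have pg: "fwd (gen x) = gen (j x)" if "x \<in> X" for x
    unfolding fwd_def by (rule nonassoc_algebra.ev_gen[OF _ p0 that]) simp
  have bg: "bwd (gen (j x)) = gen x" if "x \<in> X" for x
    using nonassoc_algebra.ev_gen[OF _ b0, of "j x"] that assms(2)
    by (simp add: bwd_def)
  have bp: "bwd (fwd f) = f" if "f \<in> polys X" for f
    by (rule free_nonassoc_hom_eq[OF alg_hom_comp[OF p b] alg_hom_id _ _ that]) (auto simp: pg bg)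
  have pb: "fwd (bwd f) = f" if "f \<in> polys (j ` X)" for f
    by (rule free_nonassoc_hom_eq[OF alg_hom_comp[OF b p] alg_hom_id _ _ that]) (auto simp: pg bg)
  have R: "fwd ` R \<subseteq> polys (j ` X)"
    using presentsD(3)[OF assms(1)] alg_homD(1)[OF p] by auto
  have "presents (j ` X) (fwd ` R) L (\<lambda>f. \<pi> (bwd f))"
  proof (rule presentsI)
    show "lie_algebra L" by (rule presentsD(1)[OF assms(1)])
    show "alg_hom (free_nonassoc (j ` X)) L (\<lambda>f. \<pi> (bwd f))"
      by (rule alg_hom_comp[OF b presentsD(4)[OF assms(1)]])
    show "carrier L \<subseteq> (\<lambda>f. \<pi> (bwd f)) ` polys (j ` X)"
    proof
      fix l assume "l \<in> carrier L"
      then obtain f where "f \<in> polys X" "l = \<pi> f" using presentsD(5)[OF assms(1)] by auto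
      then show "l \<in> (\<lambda>f. \<pi> (bwd f)) ` polys (j ` X)"
        using bp alg_homD(1)[OF p] by (intro image_eqI[of _ _ "fwd f"]) auto
    qed
    show "\<pi> (bwd r) = \<zero>\<^bsub>L\<^esub>" if "r \<in> fwd ` R" for r
      using that bp presentsD(3,6)[OF assms(1)] by auto
    show "f \<in> pres_ideal (j ` X) (fwd ` R)"
      if f: "f \<in> polys (j ` X)" "\<pi> (bwd f) = \<zero>\<^bsub>L\<^esub>" for f
    proof -
      have "bwd f \<in> pres_ideal X R" using presentsD(7)[OF assms(1)] f alg_homD(1)[OF b] by auto
      then have "fwd (bwd f) \<in> pres_ideal (j ` X) (fwd ` R)"
        using pres_ideal_relators(1)[of "fwd ` R"]
        by (intro pres_ideal_hom[OF p free_nonassoc_algebra pres_ideal_ideal[OF R] pres_ideal_relators(2)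
          presentsD(3)[OF assms(1)], of "bwd f"]) auto
      then show ?thesis using pb f by simp
    qed
  qed (use R in auto)
  then show ?thesis unfolding fwd_def by blast
qed

text \<open>Only the size of the basis matters: \<open>j\<close> may name the letters by any
  elements of type \<open>'a\<close>, not necessarily by their images under
  \<open>\<pi>\<close>.\<close>

lemma is_free_lieI:
  fixes L :: "('k::field, 'a) module" and j :: "'x \<Rightarrow> 'a"
  assumes "presents X {} L \<pi>" "inj_on j X"
  shows "is_free_lie L"
proof -
  obtain \<pi>' where 1: "presents (j ` X) {} L \<pi>'" using presents_relabel[OF assms] by auto
  obtain \<pi>'' where 2: "presents (j ` X) {} (free_lie (j ` X) :: ('k, ('k, 'a) free_lie_elem) module) \<pi>''"
    using presents_free_lie by blast
  show ?thesis unfolding is_free_lie_def using presentsD(1)[OF assms(1)] presents_iso[OF 2 1] by blast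
qed

text \<open>Sending the letters outside \<open>X\<close> to zero retracts the larger free algebra
  onto the smaller one. So whether a polynomial vanishes in the free Lie algebra can be decided over
  the alphabet \<open>UNIV\<close>.\<close>

lemma lie_kernel_retract:
  assumes "f \<in> polys X" "f \<in> lie_kernel Y" "X \<subseteq> Y"
  shows "f \<in> lie_kernel X"
proof -
  interpret N: nonassoc_algebra "free_nonassoc X :: ('b, 'a magma \<Rightarrow> 'b) module" ..
  let ?\<phi> = "\<lambda>x. if x \<in> X then gen x else \<zero>\<^bsub>free_nonassoc X\<^esub> :: 'a magma \<Rightarrow> 'b"
  have \<phi>: "?\<phi> \<in> Y \<rightarrow> polys X" by auto
  have "ev (free_nonassoc X) ?\<phi> f \<in> lie_kernel X"
    by (rule pres_ideal_hom[OF N.ev_hom[OF \<phi>] _ lie_kernel_ideal _ _ _ assms(2)[unfolded lie_kernel_eq]])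
      (auto simp: lie_kernel_eq pres_ideal_relators)
  moreover have "ev (free_nonassoc X) ?\<phi> f = f"
    by (rule ev_unique[OF alg_hom_id _ _ assms(1), symmetric]) auto
  ultimately show ?thesis by simp
qed

section \<open>Linear operators on function spaces\<close>

text \<open>Vector spaces are full function spaces (products, not direct sums): this fits cofree
  modules, and countable powers of such a space are again of this kind.\<close>

definition linop :: "(('i \<Rightarrow> 'k::field) \<Rightarrow> 'j \<Rightarrow> 'k) \<Rightarrow> bool"
  where "linop A \<longleftrightarrow> (\<forall>m m'. A (\<lambda>i. m i + m' i) = (\<lambda>j. A m j + A m' j)) \<and>
    (\<forall>c m. A (\<lambda>i. c * m i) = (\<lambda>j. c * A m j))"

definition gl :: "('k::field, ('i \<Rightarrow> 'k) \<Rightarrow> 'i \<Rightarrow> 'k) module"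
  where "gl = \<lparr>carrier = {A. linop A}, monoid.mult = (\<lambda>A B m i. A (B m) i - B (A m) i),
    one = (\<lambda>m i. 0), ring.zero = (\<lambda>m i. 0), add = (\<lambda>A B m i. A m i + B m i),
    module.smult = (\<lambda>c A m i. c * A m i)\<rparr>"

lemma linop_add: "linop A \<Longrightarrow> A (\<lambda>i. m i + m' i) = (\<lambda>j. A m j + A m' j)"
  and linop_smult: "linop A \<Longrightarrow> A (\<lambda>i. c * m i) = (\<lambda>j. c * A m j)"
  by (simp_all add: linop_def)

lemma linopI:
  "(\<And>m m'. A (\<lambda>i. m i + m' i) = (\<lambda>j. A m j + A m' j)) \<Longrightarrow>
    (\<And>c m. A (\<lambda>i. c * m i) = (\<lambda>j. c * A m j)) \<Longrightarrow> linop A"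
  by (simp add: linop_def)

lemma linop_zero: "linop A \<Longrightarrow> A (\<lambda>i. 0) = (\<lambda>j. 0)"
  using linop_smult[of A 0] by simp

lemma linop_diff: "linop A \<Longrightarrow> A (\<lambda>i. m i - m' i) = (\<lambda>j. A m j - A m' j)"
  using linop_add[of A m "\<lambda>i. (- 1) * m' i"] linop_smult[of A "- 1" m'] by simp

lemma gl_simps:
  "carrier gl = {A. linop A}" "A \<otimes>\<^bsub>gl\<^esub> B = (\<lambda>m i. A (B m) i - B (A m) i)" "\<zero>\<^bsub>gl\<^esub> = (\<lambda>m i. 0)"
  "A \<oplus>\<^bsub>gl\<^esub> B = (\<lambda>m i. A m i + B m i)" "c \<odot>\<^bsub>gl\<^esub> A = (\<lambda>m i. c * A m i)"
  by (simp_all add: gl_def)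

lemma gl_lie_algebra: "lie_algebra gl"
proof -
  have "nonassoc_algebra gl"
    by (rule nonassoc_algebraI)
      (auto simp: gl_simps linop_add linop_smult algebra_simps intro!: ext linopI)
  moreover have "A \<otimes>\<^bsub>gl\<^esub> (B \<otimes>\<^bsub>gl\<^esub> C) \<oplus>\<^bsub>gl\<^esub> B \<otimes>\<^bsub>gl\<^esub> (C \<otimes>\<^bsub>gl\<^esub> A) \<oplus>\<^bsub>gl\<^esub> C \<otimes>\<^bsub>gl\<^esub> (A \<otimes>\<^bsub>gl\<^esub> B) = \<zero>\<^bsub>gl\<^esub>"
    if "A \<in> carrier gl" "B \<in> carrier gl" "C \<in> carrier gl"
    for A B C :: "('a \<Rightarrow> 'b) \<Rightarrow> 'a \<Rightarrow> 'b"
    using that by (simp add: gl_simps linop_diff fun_eq_iff)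
  ultimately show ?thesis by (simp add: lie_algebra_iff) (simp add: gl_simps)
qed

lemma gl_algebra: "nonassoc_algebra gl"
  using gl_lie_algebra lie_algebra_iff by blast

lemma gl_ev_hom: "(\<And>x. x \<in> X \<Longrightarrow> linop (\<rho> x)) \<Longrightarrow> alg_hom (free_nonassoc X) gl (ev gl \<rho>)"
  by (rule nonassoc_algebra.ev_hom[OF gl_algebra]) (auto simp: gl_simps)

lemma gl_ev_gen: "linop (\<rho> x) \<Longrightarrow> ev gl \<rho> (gen x) = \<rho> x"
  using nonassoc_algebra.ev_gen[OF gl_algebra, of \<rho> "{x}" x] by (auto simp: gl_simps)

text \<open>Brackets act as commutators, so an intertwiner for the letters intertwines all Lie
  polynomials. Applied to the projections of a power onto its factors and to maps into the cofree
  module.\<close>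

lemma ev_intertwine:
  fixes \<rho> :: "'x \<Rightarrow> ('i \<Rightarrow> 'k::field) \<Rightarrow> 'i \<Rightarrow> 'k" and \<sigma> :: "'x \<Rightarrow> ('j \<Rightarrow> 'k) \<Rightarrow> 'j \<Rightarrow> 'k"
  assumes "f \<in> polys X" and \<Theta>: "linop \<Theta>"
    and \<rho>: "\<And>x. x \<in> X \<Longrightarrow> linop (\<rho> x)" and \<sigma>: "\<And>x. x \<in> X \<Longrightarrow> linop (\<sigma> x)"
    and eq: "\<And>x m. x \<in> X \<Longrightarrow> \<Theta> (\<rho> x m) = \<sigma> x (\<Theta> m)"
  shows "\<Theta> (ev gl \<rho> f m) = ev gl \<sigma> f (\<Theta> m)"
proof -
  note r = gl_ev_hom[of X \<rho>, OF \<rho>] and s = gl_ev_hom[of X \<sigma>, OF \<sigma>]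
  have "\<forall>m. \<Theta> (ev gl \<rho> f m) = ev gl \<sigma> f (\<Theta> m)"
    using assms(1)
  proof (induction rule: free_nonassoc_induct)
    case zero
    show ?case using alg_hom_zero[OF r _ gl_algebra] alg_hom_zero[OF s _ gl_algebra] \<Theta>
      by (simp add: gl_simps linop_zero)
  next
    case (add f g)
    then show ?case using alg_homD(2)[OF r] alg_homD(2)[OF s] \<Theta> by (simp add: gl_simps linop_add)
  next
    case (smult c f)
    then show ?case using alg_homD(3)[OF r] alg_homD(3)[OF s] \<Theta> by (simp add: gl_simps linop_smult)
  next
    case (mult f g)
    then show ?case using alg_homD(4)[OF r] alg_homD(4)[OF s] \<Theta> by (simp add: gl_simps linop_diff)
  next
    case (gen x)
    then show ?case using \<rho> \<sigma> eq by (simp add: gl_ev_gen)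
  qed
  then show ?thesis by simp
qed


section \<open>Elimination of a letter\<close>

text \<open>
  From here on letters are natural numbers.  The letter \<open>prod_encode (y, i)\<close> stands for
  \<open>ad(t)\<^sup>i y\<close>, where \<open>t\<close> is the letter being eliminated.
\<close>

definition lazard :: "('k::field, 'a) module \<Rightarrow> (nat \<Rightarrow> 'a) \<Rightarrow> nat \<Rightarrow> nat \<Rightarrow> 'a"
  where "lazard G \<phi> t z = (case prod_decode z of (y, i) \<Rightarrow> ((\<lambda>x. \<phi> t \<otimes>\<^bsub>G\<^esub> x) ^^ i) (\<phi> y))"

definition succ_letter :: "nat \<Rightarrow> nat"
  where "succ_letter z = (case prod_decode z of (y, i) \<Rightarrow> prod_encode (y, Suc i))"

definition elim_letters :: "nat \<Rightarrow> nat set \<Rightarrow> nat set"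
  where "elim_letters t P = {prod_encode (y, i) | y i. y \<in> P - {t}}"

text \<open>The weight of the bracket \<open>ad(t)^i y\<close>, so that passing to the new letters
  and back preserves the degree of a polynomial.\<close>

definition elim_weight :: "(nat \<Rightarrow> nat) \<Rightarrow> nat \<Rightarrow> nat \<Rightarrow> nat"
  where "elim_weight wt t z = (case prod_decode z of (y, i) \<Rightarrow> wt y + i * wt t)"

definition graded :: "('x \<Rightarrow> nat) \<Rightarrow> 'x set \<Rightarrow> nat set \<Rightarrow> ('x magma \<Rightarrow> 'k::field) set"
  where "graded wt X A =
    {f \<in> polys X. \<forall>m. f m \<noteq> 0 \<longrightarrow> magma_weight wt m \<in> A}"

text \<open>Equality in the free Lie algebra, taken over all letters so that no alphabet has to be
  tracked; \<open>lie_kernel_retract\<close> brings it back to a given one.\<close>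

definition lie_equiv :: "('x magma \<Rightarrow> 'k::field) \<Rightarrow> ('x magma \<Rightarrow> 'k) \<Rightarrow> bool" (infix \<open>\<doteq>\<close> 50)
  where "f \<doteq> g \<longleftrightarrow> (\<lambda>m. f m - g m) \<in> lie_kernel UNIV"

lemma lazard_encode [simp]: "lazard G \<phi> t (prod_encode (y, i)) = ((\<lambda>x. \<phi> t \<otimes>\<^bsub>G\<^esub> x) ^^ i) (\<phi> y)"
  by (simp add: lazard_def)

lemma succ_letter_encode [simp]: "succ_letter (prod_encode (y, i)) = prod_encode (y, Suc i)"
  by (simp add: succ_letter_def)

lemma elim_weight_encode [simp]: "elim_weight wt t (prod_encode (y, i)) = wt y + i * wt t"
  by (simp add: elim_weight_def)

lemma encode_elim_letters [simp]: "prod_encode (y, i) \<in> elim_letters t P \<longleftrightarrow> y \<in> P \<and> y \<noteq> t"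
  by (auto simp: elim_letters_def)

lemma lazard_succ: "lazard G \<phi> t (succ_letter z) = \<phi> t \<otimes>\<^bsub>G\<^esub> lazard G \<phi> t z"
  by (cases "prod_decode z") (simp add: lazard_def succ_letter_def)

lemma elim_weight_succ: "elim_weight wt t (succ_letter z) = wt t + elim_weight wt t z"
  by (cases "prod_decode z") (simp add: elim_weight_def succ_letter_def)

lemma succ_elim_letters: "z \<in> elim_letters t P \<Longrightarrow> succ_letter z \<in> elim_letters t P"
  by (auto simp: elim_letters_def)

lemma lazard_closed:
  assumes "nonassoc_algebra G" "\<phi> t \<in> carrier G" "\<And>y. y \<in> P \<Longrightarrow> \<phi> y \<in> carrier G" "z \<in> elim_letters t P"
  shows "lazard G \<phi> t z \<in> carrier G"
proof -
  interpret nonassoc_algebra G by fact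
  have "((\<lambda>x. \<phi> t \<otimes>\<^bsub>G\<^esub> x) ^^ i) (\<phi> y) \<in> carrier G" if "y \<in> P" for y i
    using assms(2,3) that by (induction i) auto
  then show ?thesis using assms(4) by (auto simp: elim_letters_def)
qed

section \<open>Polynomials of prescribed weights\<close>

lemma gradedD: "f \<in> graded wt X A \<Longrightarrow> f \<in> polys X"
  by (simp add: graded_def)

lemma graded_weight: "f \<in> graded wt X A \<Longrightarrow> f m \<noteq> 0 \<Longrightarrow> magma_weight wt m \<in> A"
  by (simp add: graded_def)

lemma graded_zero: "\<zero>\<^bsub>free_nonassoc X\<^esub> \<in> graded wt X A"
  by (simp add: graded_def free_nonassoc_simps)

lemma graded_mono: "f \<in> graded wt X A \<Longrightarrow> X \<subseteq> Y \<Longrightarrow> A \<subseteq> B \<Longrightarrow> f \<in> graded wt Y B"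
  using free_nonassoc_mono[of X Y f] by (auto simp: graded_def)

lemma graded_add:
  assumes "f \<in> graded wt X A" "g \<in> graded wt X A"
  shows "f \<oplus>\<^bsub>free_nonassoc X\<^esub> g \<in> graded wt X A"
proof -
  interpret nonassoc_algebra "free_nonassoc X :: ('b, 'a magma \<Rightarrow> 'b) module" ..
  have "f \<oplus>\<^bsub>free_nonassoc X\<^esub> g \<in> polys X" using assms by (simp add: graded_def)
  moreover have "f m \<noteq> 0 \<or> g m \<noteq> 0" if "(f \<oplus>\<^bsub>free_nonassoc X\<^esub> g) m \<noteq> 0" for m
    using that by (auto simp: free_nonassoc_simps)
  ultimately show ?thesis using assms by (fastforce simp: graded_def)
qed

lemma graded_smult:
  assumes "f \<in> graded wt X A"
  shows "c \<odot>\<^bsub>free_nonassoc X\<^esub> f \<in> graded wt X A"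
proof -
  interpret nonassoc_algebra "free_nonassoc X :: ('b, 'a magma \<Rightarrow> 'b) module" ..
  show ?thesis using assms smult_in[of f c] by (auto simp: graded_def free_nonassoc_simps(5))
qed

lemma graded_mult:
  assumes "f \<in> graded wt X {a}" "g \<in> graded wt X {b}"
  shows "f \<otimes>\<^bsub>free_nonassoc X\<^esub> g \<in> graded wt X {a + b}"
proof -
  interpret nonassoc_algebra "free_nonassoc X :: ('b, 'a magma \<Rightarrow> 'b) module" ..
  have "f \<otimes>\<^bsub>free_nonassoc X\<^esub> g \<in> polys X" using assms by (simp add: graded_def)
  moreover have "magma_weight wt m = a + b" if "(f \<otimes>\<^bsub>free_nonassoc X\<^esub> g) m \<noteq> 0" for m
    using that assms by (cases m) (auto simp: free_nonassoc_simps graded_def)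
  ultimately show ?thesis by (simp add: graded_def)
qed

lemma mon_graded: "set_magma m \<subseteq> X \<Longrightarrow> mon m \<in> graded wt X {magma_weight wt m}"
  by (simp add: graded_def mon_closed) (simp add: mon_def)

lemma graded_singleton_induct [consumes 1, case_names zero add]:
  assumes "f \<in> graded wt X A"
    and zero: "P \<zero>\<^bsub>free_nonassoc X\<^esub>"
    and add: "\<And>m c g. \<lbrakk>set_magma m \<subseteq> X; magma_weight wt m \<in> A; g \<in> graded wt X A; P g\<rbrakk>
      \<Longrightarrow> P (g \<oplus>\<^bsub>free_nonassoc X\<^esub> c \<odot>\<^bsub>free_nonassoc X\<^esub> mon m)"
  shows "P f"
proof -
  have "finite {m. f m \<noteq> 0}" "\<forall>m. f m \<noteq> 0 \<longrightarrow> set_magma m \<subseteq> X \<and> magma_weight wt m \<in> A"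
    using assms(1) by (auto simp: graded_def free_nonassoc_simps)
  then have "f \<in> graded wt X A \<and> P f"
  proof (induction rule: fin_supp_induct)
    case zero
    show ?case using assms(2) graded_zero[of X wt A] by (simp add: free_nonassoc_simps)
  next
    case (add m c g)
    have "(mon m :: _ \<Rightarrow> 'b) \<in> graded wt X A"
      using add by (intro graded_mono[OF mon_graded[of m X]]) auto
    then have "g \<oplus>\<^bsub>free_nonassoc X\<^esub> c \<odot>\<^bsub>free_nonassoc X\<^esub> mon m \<in> graded wt X A"
      using add by (intro graded_add graded_smult) auto
    then show ?case using assms(3)[of m g c] add by (simp add: free_nonassoc_simps)
  qed
  then show ?thesis by simp
qed

lemma lazard_ev:
  fixes f :: "nat magma \<Rightarrow> 'k::field"
  assumes "nonassoc_algebra G" "\<phi> \<in> UNIV \<rightarrow> carrier G" "f \<in> polys UNIV"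
  shows "ev G \<phi> (ev (free_nonassoc UNIV) (lazard (free_nonassoc UNIV) gen t) f) = ev G (lazard G \<phi> t) f"
proof -
  let ?N = "free_nonassoc UNIV :: ('k, nat magma \<Rightarrow> 'k) module"
  interpret N: nonassoc_algebra ?N ..
  interpret G: nonassoc_algebra G by fact
  have h: "alg_hom ?N G (ev G \<phi>)" by (rule G.ev_hom[OF assms(2)])
  have p: "((\<lambda>x. gen t \<otimes>\<^bsub>?N\<^esub> x) ^^ i) (gen y) \<in> carrier ?N \<and>
      ev G \<phi> (((\<lambda>x. gen t \<otimes>\<^bsub>?N\<^esub> x) ^^ i) (gen y)) = ((\<lambda>x. \<phi> t \<otimes>\<^bsub>G\<^esub> x) ^^ i) (\<phi> y)" for i y
    by (induction i) (auto simp: alg_homD(4)[OF h] G.ev_gen[OF assms(2)])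
  then have c: "lazard ?N gen t \<in> UNIV \<rightarrow> carrier ?N"
    by (auto simp: lazard_def split: prod.splits)
  have e: "ev G \<phi> (lazard ?N gen t z) = lazard G \<phi> t z" for z
    using p by (auto simp: lazard_def split: prod.splits)
  show ?thesis by (simp add: hom_ev[OF h N.nonassoc_algebra_axioms assms(1) c assms(3)] e)
qed

section \<open>Equivalence modulo the Lie identities\<close>

lemma lie_equiv_refl [simp]: "f \<doteq> f"
  using alg_idealD(2)[OF _ lie_kernel_ideal[of UNIV]] by (simp add: lie_equiv_def free_nonassoc_simps)

lemma free_nonassoc_diff:
  assumes "f \<in> polys X" "g \<in> polys X"
  shows "f \<ominus>\<^bsub>free_nonassoc X\<^esub> g = (\<lambda>m. f m - g m)"
proof -
  interpret N: nonassoc_algebra "free_nonassoc X :: ('b, 'a magma \<Rightarrow> 'b) module" ..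
  show ?thesis using assms by (simp add: N.minus_eq N.minus_conv) (simp add: free_nonassoc_simps)
qed

lemma lie_equiv_diff:
  assumes "f \<doteq> g" "f \<in> polys X" "g \<in> polys X"
  shows "f \<ominus>\<^bsub>free_nonassoc X\<^esub> g \<in> lie_kernel X"
proof -
  interpret N: nonassoc_algebra "free_nonassoc X :: ('b, 'a magma \<Rightarrow> 'b) module" ..
  show ?thesis
    using assms(1) lie_kernel_retract[OF N.diff_closed[OF assms(2,3)] _ subset_UNIV]
    by (simp add: free_nonassoc_diff[OF assms(2,3)] lie_equiv_def)
qed

lemma lie_equiv_iff:
  assumes "presents UNIV {} L \<kappa>" "f \<in> polys UNIV" "g \<in> polys UNIV"
  shows "f \<doteq> g \<longleftrightarrow> \<kappa> f = \<kappa> g"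
proof -
  interpret N: nonassoc_algebra "free_nonassoc UNIV :: ('b, 'a magma \<Rightarrow> 'b) module" ..
  interpret L: nonassoc_algebra L by (rule presentsD(2)[OF assms(1)])
  note h = presentsD(4)[OF assms(1)]
  have "\<kappa> f = \<kappa> g \<longleftrightarrow> \<kappa> (f \<ominus>\<^bsub>free_nonassoc UNIV\<^esub> g) = \<zero>\<^bsub>L\<^esub>"
    using assms alg_homD(1)[OF h]
    by (simp add: alg_hom_diff[OF h N.nonassoc_algebra_axioms L.nonassoc_algebra_axioms] L.diff_zero_iff)
  also have "\<dots> \<longleftrightarrow> f \<ominus>\<^bsub>free_nonassoc UNIV\<^esub> g \<in> lie_kernel UNIV"
    using presentsD(7)[OF assms(1), of "f \<ominus>\<^bsub>free_nonassoc UNIV\<^esub> g"] assms by (simp add: lie_kernel_eq)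
  finally show ?thesis by (simp add: lie_equiv_def free_nonassoc_diff[OF assms(2,3)])
qed

lemma lie_equiv_ev:
  assumes "f \<doteq> g" "f \<in> polys X" "g \<in> polys X" "lie_algebra G"
    and "\<phi> \<in> X \<rightarrow> carrier G"
  shows "ev G \<phi> f = ev G \<phi> g"
proof -
  interpret N: nonassoc_algebra "free_nonassoc X :: ('b, 'a magma \<Rightarrow> 'b) module" ..
  interpret G: lie_algebra G by fact
  note h = G.ev_hom[OF assms(5)]
  have "ev G \<phi> (f \<ominus>\<^bsub>free_nonassoc X\<^esub> g) = \<zero>\<^bsub>G\<^esub>"
    by (rule hom_lie_kernel[OF h assms(4) lie_equiv_diff[OF assms(1-3)]])
  then show ?thesis
    using assms G.ev_closed[OF assms(5)]
    by (simp add: alg_hom_diff[OF h N.nonassoc_algebra_axioms G.nonassoc_algebra_axioms] G.diff_zero_iff)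
qed

section \<open>Rewriting in the elements \<open>ad(t)^i y\<close>\<close>

context
  fixes L :: "('k::field, 'a) module" (structure) and a :: "nat \<Rightarrow> 'a" and t :: nat and wt :: "nat \<Rightarrow> nat"
  assumes L: "lie_algebra L" and a: "\<And>x. a x \<in> carrier L"
begin

interpretation lie_algebra L by (rule L)

private lemma laz_in: "lazard L a t \<in> elim_letters t P \<rightarrow> carrier L"
  using lazard_closed[OF nonassoc_algebra_axioms, of a t P] a by auto

private lemma laz_hom: "alg_hom (free_nonassoc (elim_letters t P)) L (ev L (lazard L a t))"
  by (rule ev_hom[OF laz_in])

text \<open>On letters \<open>ad(t)\<close> is \<open>succ_letter\<close>, and it is a derivation;
  so it preserves the subalgebra generated by the elements \<open>ad(t)^i y\<close> and raises
  weights by that of \<open>t\<close>.\<close>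

lemma ad_lazard_mon:
  assumes "set_magma m \<subseteq> elim_letters t P"
  shows "\<exists>g \<in> graded (elim_weight wt t) (elim_letters t P) {wt t + magma_weight (elim_weight wt t) m}.
    a t \<otimes> ev L (lazard L a t) (mon m) = ev L (lazard L a t) g"
  using assms
proof (induction m)
  case (Gen z)
  let ?g = "gen (succ_letter z) :: nat magma \<Rightarrow> 'k"
  have "?g \<in> graded (elim_weight wt t) (elim_letters t P) {wt t + magma_weight (elim_weight wt t) (Gen z)}"
    using mon_graded[of "Gen (succ_letter z)" "elim_letters t P" "elim_weight wt t"] Gen succ_elim_letters
    by (simp add: elim_weight_succ)
  moreover have "a t \<otimes> ev L (lazard L a t) (gen z) = ev L (lazard L a t) ?g"
    using Gen succ_elim_letters by (simp add: ev_gen[OF laz_in[of P]] lazard_succ)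
  ultimately show ?case by blast
next
  case (Br u v)
  let ?G = "graded (elim_weight wt t) (elim_letters t P)" and ?e = "ev L (lazard L a t)"
    and ?w = "magma_weight (elim_weight wt t)" and ?N = "free_nonassoc (elim_letters t P) :: ('k, nat magma \<Rightarrow> 'k) module"
  interpret N: nonassoc_algebra ?N ..
  obtain gu gv where gu: "gu \<in> ?G {wt t + ?w u}" "a t \<otimes> ?e (mon u) = ?e gu"
    and gv: "gv \<in> ?G {wt t + ?w v}" "a t \<otimes> ?e (mon v) = ?e gv"
    using Br by auto
  have u: "(mon u :: _ \<Rightarrow> 'k) \<in> ?G {?w u}" and v: "(mon v :: _ \<Rightarrow> 'k) \<in> ?G {?w v}"
    using Br.prems by (auto intro!: mon_graded)
  note c = gradedD[OF gu(1)] gradedD[OF gv(1)] gradedD[OF u] gradedD[OF v]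
  let ?g = "gu \<otimes>\<^bsub>?N\<^esub> mon v \<oplus>\<^bsub>?N\<^esub> mon u \<otimes>\<^bsub>?N\<^esub> gv"
  have "?g \<in> ?G {wt t + ?w (Br u v)}"
    using graded_mult[OF gu(1) v] graded_mult[OF u gv(1)] by (intro graded_add) (simp_all add: add_ac)
  moreover have "a t \<otimes> ?e (mon (Br u v)) = ?e ?g"
    using c a[of t] alg_homD(1)[OF laz_hom[of P]] gu(2) gv(2)
    by (simp add: mon_Br[of u v "elim_letters t P"] alg_homD(2,4)[OF laz_hom] bracket_leibniz)
  ultimately show ?case by blast
qed

lemma ad_lazard:
  assumes "f \<in> graded (elim_weight wt t) (elim_letters t P) {n}"
  shows "\<exists>g \<in> graded (elim_weight wt t) (elim_letters t P) {wt t + n}.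
    a t \<otimes> ev L (lazard L a t) f = ev L (lazard L a t) g"
  using assms
proof (induction rule: graded_singleton_induct)
  case zero
  then show ?case using graded_zero[of "elim_letters t P"] a[of t]
    by (intro bexI[of _ "\<zero>\<^bsub>free_nonassoc (elim_letters t P)\<^esub>"])
      (auto simp: alg_hom_zero[OF laz_hom _ nonassoc_algebra_axioms])
next
  case (add m c f)
  let ?N = "free_nonassoc (elim_letters t P) :: ('k, nat magma \<Rightarrow> 'k) module"
  interpret N: nonassoc_algebra ?N ..
  obtain g where g: "g \<in> graded (elim_weight wt t) (elim_letters t P) {wt t + n}"
    "a t \<otimes> ev L (lazard L a t) f = ev L (lazard L a t) g" using add by auto
  obtain g' where g': "g' \<in> graded (elim_weight wt t) (elim_letters t P) {wt t + n}"
    "a t \<otimes> ev L (lazard L a t) (mon m) = ev L (lazard L a t) g'" using ad_lazard_mon[OF add(1)] add(2) by auto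
  have m: "(mon m :: _ \<Rightarrow> 'k) \<in> carrier ?N" using add by (intro mon_closed)
  note c = gradedD[OF g(1)] gradedD[OF g'(1)] m gradedD[OF add(3)]
  have "g \<oplus>\<^bsub>?N\<^esub> c \<odot>\<^bsub>?N\<^esub> g' \<in> graded (elim_weight wt t) (elim_letters t P) {wt t + n}"
    using g(1) g'(1) by (intro graded_add graded_smult)
  moreover have "a t \<otimes> ev L (lazard L a t) (f \<oplus>\<^bsub>?N\<^esub> c \<odot>\<^bsub>?N\<^esub> mon m) = ev L (lazard L a t) (g \<oplus>\<^bsub>?N\<^esub> c \<odot>\<^bsub>?N\<^esub> g')"
    using c a[of t] alg_homD(1)[OF laz_hom[of P]] g(2) g'(2)
    by (simp add: alg_homD(2,3)[OF laz_hom] bracket_add_right bracket_smult_right)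
  ultimately show ?case by blast
qed

text \<open>Brackets with \<open>t\<close> on either side are absorbed by \<open>ad_lazard\<close>,
  up to a sign, and \<open>[t, t]\<close> vanishes. Hence \<open>t\<close> itself is the only
  monomial that escapes.\<close>

lemma lazard_rewrite_mon:
  assumes "set_magma m \<subseteq> P" "m \<noteq> Gen t"
  shows "\<exists>g \<in> graded (elim_weight wt t) (elim_letters t P) {magma_weight wt m}.
    ev L a (mon m) = ev L (lazard L a t) g"
  using assms
proof (induction m)
  case (Gen x)
  let ?g = "gen (prod_encode (x, 0)) :: nat magma \<Rightarrow> 'k"
  have "?g \<in> graded (elim_weight wt t) (elim_letters t P) {magma_weight wt (Gen x)}"
    using mon_graded[of "Gen (prod_encode (x, 0))" "elim_letters t P" "elim_weight wt t"] Gen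
    by simp
  moreover have "ev L a (gen x) = ev L (lazard L a t) ?g"
    using Gen a by (simp add: ev_gen[OF laz_in[of P]] ev_gen[of a UNIV])
  ultimately show ?case by blast
next
  case (Br u v)
  let ?G = "graded (elim_weight wt t) (elim_letters t P)" and ?e = "ev L (lazard L a t)"
    and ?w = "magma_weight wt" and ?N = "free_nonassoc (elim_letters t P) :: ('k, nat magma \<Rightarrow> 'k) module"
  interpret N: nonassoc_algebra ?N ..
  have aU: "a \<in> UNIV \<rightarrow> carrier L" using a by auto
  have br: "ev L a (mon (Br u v)) = ev L a (mon u) \<otimes> ev L a (mon v)"
    by (simp add: ev_mon[OF aU])
  have at: "ev L a (gen t) = a t" by (simp add: ev_mon[OF aU])
  show ?case
  proof (cases "u = Gen t"; cases "v = Gen t")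
    assume "u = Gen t" "v = Gen t"
    then have "ev L a (mon (Br u v)) = ?e \<zero>\<^bsub>?N\<^esub>"
      using at br a by (simp add: bracket_self alg_hom_zero[OF laz_hom _ nonassoc_algebra_axioms])
    then show ?thesis using graded_zero by blast
  next
    assume u: "u = Gen t" and "v \<noteq> Gen t"
    then obtain g where g: "g \<in> ?G {?w v}" "ev L a (mon v) = ?e g" using Br by auto
    from ad_lazard[OF g(1)] obtain g' where "g' \<in> ?G {wt t + ?w v}" "a t \<otimes> ?e g = ?e g'" by auto
    then show ?thesis using u g br at by (intro bexI[of _ g']) auto
  next
    assume "u \<noteq> Gen t" and v: "v = Gen t"
    then obtain g where g: "g \<in> ?G {?w u}" "ev L a (mon u) = ?e g" using Br by auto
    from ad_lazard[OF g(1)] obtain g' where g': "g' \<in> ?G {wt t + ?w u}" "a t \<otimes> ?e g = ?e g'" by auto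
    have "ev L a (mon (Br u v)) = \<ominus> ?e g'"
      using br v at g g' a[of t] alg_homD(1)[OF laz_hom gradedD[OF g(1)]] bracket_anti[of "?e g" "a t"] by simp
    also have "\<dots> = ?e ((- 1) \<odot>\<^bsub>?N\<^esub> g')"
      using alg_homD(1,3)[OF laz_hom gradedD[OF g'(1)]] minus_conv by simp
    finally show ?thesis using graded_smult[OF g'(1)] v by (intro bexI[of _ "(- 1) \<odot>\<^bsub>?N\<^esub> g'"]) (auto simp: add.commute)
  next
    assume "u \<noteq> Gen t" "v \<noteq> Gen t"
    then obtain g g' where g: "g \<in> ?G {?w u}" "ev L a (mon u) = ?e g" and
      g': "g' \<in> ?G {?w v}" "ev L a (mon v) = ?e g'" using Br by auto
    have "ev L a (mon (Br u v)) = ?e (g \<otimes>\<^bsub>?N\<^esub> g')"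
      using br g g' by (simp add: alg_homD(4)[OF laz_hom] gradedD)
    then show ?thesis using graded_mult[OF g(1) g'(1)] by auto
  qed
qed

lemma lazard_rewrite_aux:
  assumes "f \<in> graded wt P A"
  shows "\<exists>g \<in> graded (elim_weight wt t) (elim_letters t P) A.
    ev L a f = f (Gen t) \<odot> a t \<oplus> ev L (lazard L a t) g"
  using assms
proof (induction rule: graded_singleton_induct)
  case zero
  have "a \<in> UNIV \<rightarrow> carrier L" using a by auto
  then have "ev L a \<zero>\<^bsub>free_nonassoc P\<^esub> = \<zero>" using ev_zero[of a UNIV] by (simp add: free_nonassoc_simps)
  then show ?case using graded_zero[of "elim_letters t P"] a[of t]
    by (intro bexI[of _ "\<zero>\<^bsub>free_nonassoc (elim_letters t P)\<^esub>"])
      (auto simp: alg_hom_zero[OF laz_hom _ nonassoc_algebra_axioms] free_nonassoc_simps(4)[of P])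
next
  case (add m c f)
  let ?G = "graded (elim_weight wt t) (elim_letters t P)" and ?e = "ev L (lazard L a t)"
    and ?w = "magma_weight wt" and ?N = "free_nonassoc (elim_letters t P) :: ('k, nat magma \<Rightarrow> 'k) module"
    and ?M = "free_nonassoc P :: ('k, nat magma \<Rightarrow> 'k) module"
  interpret N: nonassoc_algebra ?N ..
  have aP: "a \<in> P \<rightarrow> carrier L" and aU: "a \<in> UNIV \<rightarrow> carrier L" using a by auto
  note h = ev_hom[OF aP]
  interpret M: nonassoc_algebra ?M ..
  obtain g where g: "g \<in> ?G A" "ev L a f = f (Gen t) \<odot> a t \<oplus> ?e g" using add by auto
  have m: "(mon m :: _ \<Rightarrow> 'k) \<in> carrier ?M" using add by (intro mon_closed)
  have f: "f \<in> carrier ?M" by (rule gradedD[OF add(3)])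
  have e: "ev L a (f \<oplus>\<^bsub>?M\<^esub> c \<odot>\<^bsub>?M\<^esub> mon m) = ev L a f \<oplus> c \<odot> ev L a (mon m)"
    using f m by (simp add: alg_homD(2,3)[OF h])
  have ge: "?e g \<in> carrier L" using alg_homD(1)[OF laz_hom gradedD[OF g(1)]] .
  show ?case
  proof (cases "m = Gen t")
    case True
    have "ev L a (mon m) = a t" using True by (simp add: ev_mon[OF aU])
    moreover have "(f \<oplus>\<^bsub>?M\<^esub> c \<odot>\<^bsub>?M\<^esub> mon m) (Gen t) = f (Gen t) + c"
      using True by (simp add: free_nonassoc_simps mon_def)
    ultimately show ?thesis using g e a[of t] ge
      by (intro bexI[of _ g]) (auto simp: smult_add_left a_ac)
  next
    case False
    obtain g' where g': "g' \<in> ?G {?w m}" "ev L a (mon m) = ?e g'"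
      using lazard_rewrite_mon[OF add(1) False] by auto
    have "g' \<in> ?G A" using graded_mono[OF g'(1)] add(2) by auto
    then have "g \<oplus>\<^bsub>?N\<^esub> c \<odot>\<^bsub>?N\<^esub> g' \<in> ?G A" using g(1) by (intro graded_add graded_smult)
    moreover have "?e (g \<oplus>\<^bsub>?N\<^esub> c \<odot>\<^bsub>?N\<^esub> g') = ?e g \<oplus> c \<odot> ?e g'"
      using gradedD[OF g(1)] gradedD[OF g'(1)] by (simp add: alg_homD(2,3)[OF laz_hom])
    moreover have "(f \<oplus>\<^bsub>?M\<^esub> c \<odot>\<^bsub>?M\<^esub> mon m) (Gen t) = f (Gen t)"
      using False by (simp add: free_nonassoc_simps mon_def)
    ultimately show ?thesis using g e a[of t] ge g' alg_homD(1)[OF laz_hom gradedD[OF g'(1)]]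
      by (intro bexI[of _ "g \<oplus>\<^bsub>?N\<^esub> c \<odot>\<^bsub>?N\<^esub> g'"]) (auto simp: a_ac)
  qed
qed

end

abbreviation lazard_subst :: "nat \<Rightarrow> (nat magma \<Rightarrow> 'k::field) \<Rightarrow> nat magma \<Rightarrow> 'k"
  where "lazard_subst t \<equiv> ev (free_nonassoc UNIV) (lazard (free_nonassoc UNIV) gen t)"

lemma lazard_subst_closed:
  fixes f :: "nat magma \<Rightarrow> 'k::field"
  assumes "f \<in> polys (elim_letters t P)" "t \<in> Q" "P \<subseteq> Q"
  shows "lazard_subst t f \<in> polys Q"
proof -
  interpret Q: nonassoc_algebra "free_nonassoc Q :: ('k, nat magma \<Rightarrow> 'k) module" ..
  let ?l = "lazard (free_nonassoc Q) gen t :: nat \<Rightarrow> nat magma \<Rightarrow> 'k"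
  have 1: "?l \<in> elim_letters t P \<rightarrow> polys Q"
  proof
    show "?l z \<in> polys Q" if "z \<in> elim_letters t P" for z
      by (rule lazard_closed[OF Q.nonassoc_algebra_axioms _ _ that]) (use assms in auto)
  qed
  have eq: "?l = lazard (free_nonassoc UNIV) gen t"
    by (simp add: lazard_def fun_eq_iff free_nonassoc_simps)
  have "ev (free_nonassoc Q) ?l f = lazard_subst t f"
    unfolding eq[symmetric]
    using hom_ev[OF free_nonassoc_inclusion[of Q UNIV] _ _ 1 assms(1)] by simp
  then show ?thesis using Q.ev_closed[OF 1 assms(1)] by simp
qed

lemma lazard_subst_hom:
  "alg_hom (free_nonassoc UNIV) (free_nonassoc UNIV) (lazard_subst t :: _ \<Rightarrow> nat magma \<Rightarrow> 'k::field)"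
proof -
  let ?N = "free_nonassoc UNIV :: ('k, nat magma \<Rightarrow> 'k) module"
  interpret N: nonassoc_algebra ?N ..
  have "((\<lambda>x. gen t \<otimes>\<^bsub>?N\<^esub> x) ^^ i) (gen y) \<in> carrier ?N" for i y
    by (induction i) auto
  then show ?thesis by (intro N.ev_hom) (auto simp: lazard_def split: prod.split)
qed

text \<open>\<open>lazard_rewrite_aux\<close> at the generators of the free Lie algebra on all
  letters, where equality of values means \<open>\<doteq>\<close>. The coefficient of
  \<open>t\<close> stays visible because faithfulness will have to kill it.\<close>

lemma lazard_rewrite:
  fixes f :: "nat magma \<Rightarrow> 'k::field"
  assumes "f \<in> graded wt P A"
  shows "\<exists>g \<in> graded (elim_weight wt t) (elim_letters t P) A.
    f \<doteq> (\<lambda>m. f (Gen t) * gen t m + lazard_subst t g m)"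
proof -
  let ?N = "free_nonassoc UNIV :: ('k, nat magma \<Rightarrow> 'k) module"
  interpret N: nonassoc_algebra ?N ..
  obtain \<kappa> where \<kappa>: "presents (UNIV :: nat set) {} (free_lie UNIV :: ('k, ('k, nat) free_lie_elem) module) \<kappa>"
    using presents_free_lie by blast
  define a where "a = (\<lambda>x::nat. \<kappa> (gen x))"
  let ?F = "free_lie UNIV :: ('k, ('k, nat) free_lie_elem) module"
  note h = presentsD(4)[OF \<kappa>]
  have a: "a x \<in> carrier ?F" for x using alg_homD(1)[OF h] by (simp add: a_def)
  then have aU: "a \<in> UNIV \<rightarrow> carrier ?F" by auto
  have \<kappa>ev: "\<kappa> f = ev ?F a f" if "f \<in> carrier ?N" for f
    using presents_ev[OF \<kappa> that] by (simp add: a_def)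
  note he = nonassoc_algebra.ev_hom[OF presentsD(2)[OF \<kappa>] aU]
  obtain g where g: "g \<in> graded (elim_weight wt t) (elim_letters t P) A"
    "ev ?F a f = f (Gen t) \<odot>\<^bsub>?F\<^esub> a t \<oplus>\<^bsub>?F\<^esub> ev ?F (lazard ?F a t) g"
    using lazard_rewrite_aux[OF presentsD(1)[OF \<kappa>], of a, OF a assms, of t] by blast
  have gN: "g \<in> carrier ?N" using free_nonassoc_mono[OF subset_UNIV gradedD[OF g(1)]] .
  have fN: "f \<in> carrier ?N" using free_nonassoc_mono[OF subset_UNIV gradedD[OF assms]] .
  have LN: "lazard_subst t g \<in> carrier ?N"
    using lazard_subst_closed[OF gradedD[OF g(1)], of UNIV] by simp
  have eq: "(\<lambda>m. f (Gen t) * gen t m + lazard_subst t g m)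
    = f (Gen t) \<odot>\<^bsub>?N\<^esub> gen t \<oplus>\<^bsub>?N\<^esub> lazard_subst t g" by (simp add: free_nonassoc_simps)
  have "\<kappa> f = \<kappa> (f (Gen t) \<odot>\<^bsub>?N\<^esub> gen t \<oplus>\<^bsub>?N\<^esub> lazard_subst t g)"
    using LN fN g(2)
    by (simp add: \<kappa>ev alg_homD(2,3)[OF he] lazard_ev[OF presentsD(2)[OF \<kappa>] aU gN] a_def[symmetric]
      nonassoc_algebra.ev_gen[OF presentsD(2)[OF \<kappa>] aU])
  then show ?thesis
    using lie_equiv_iff[OF \<kappa> fN, of "f (Gen t) \<odot>\<^bsub>?N\<^esub> gen t \<oplus>\<^bsub>?N\<^esub> lazard_subst t g"] LN g(1)
    by (intro bexI[of _ g]) (auto simp: eq)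
qed

section \<open>Representations that extend derivations\<close>

definition faithful :: "(nat \<Rightarrow> (nat \<Rightarrow> 'k::field) \<Rightarrow> nat \<Rightarrow> 'k) \<Rightarrow> nat set \<Rightarrow> bool"
  where "faithful \<rho> Y \<longleftrightarrow>
    (\<forall>f\<in>polys Y. ev gl \<rho> f = (\<lambda>m i. 0) \<longrightarrow> f \<in> lie_kernel UNIV)"

text \<open>
  Says that the first cohomology of the free associative algebra on \<open>Y\<close> with values in
  \<open>Hom(Q, M)\<close> vanishes, where \<open>M\<close> is the module given by \<open>\<rho>\<close> and \<open>Q\<close> the one given by \<open>q\<close>;
  that is, \<open>M\<close> is injective as far as modules \<open>Q\<close> on the same type are concerned.
\<close>

definition deriv_ext :: "(nat \<Rightarrow> (nat \<Rightarrow> 'k::field) \<Rightarrow> nat \<Rightarrow> 'k) \<Rightarrow> nat set \<Rightarrow> bool"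
  where "deriv_ext \<rho> Y \<longleftrightarrow>
    (\<forall>q \<delta> :: nat \<Rightarrow> (nat \<Rightarrow> 'k) \<Rightarrow> nat \<Rightarrow> 'k. (\<forall>x. linop (q x)) \<longrightarrow> (\<forall>x. linop (\<delta> x)) \<longrightarrow>
      (\<exists>H. linop H \<and> (\<forall>y\<in>Y. \<forall>m. H (q y m) = (\<lambda>i. \<rho> y (H m) i + \<delta> y m i))))"

text \<open>The \<open>j\<close>-th component of a vector of \<open>M^nat\<close>, the power being
  coded on the type of \<open>M\<close> by a pairing of the natural numbers.\<close>

definition slice :: "(nat \<Rightarrow> 'k) \<Rightarrow> nat \<Rightarrow> nat \<Rightarrow> 'k"
  where "slice m j = (\<lambda>v. m (prod_encode (j, v)))"

definition unslice :: "(nat \<Rightarrow> nat \<Rightarrow> 'k) \<Rightarrow> nat \<Rightarrow> 'k"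
  where "unslice F = (\<lambda>n. case prod_decode n of (j, v) \<Rightarrow> F j v)"

lemma slice_unslice [simp]: "slice (unslice F) j = F j"
  by (simp add: slice_def unslice_def)

lemma slice_eqI: "(\<And>j. slice m j = slice m' j) \<Longrightarrow> m = m'"
  unfolding slice_def fun_eq_iff by (metis prod_decode_inverse prod.collapse)

lemma slice_add: "slice (\<lambda>i. m i + m' i) j = (\<lambda>i. slice m j i + slice m' j i)"
  and slice_diff: "slice (\<lambda>i. m i - m' i) j = (\<lambda>i. slice m j i - slice m' j i)"
  and slice_smult: "slice (\<lambda>i. c * m i) j = (\<lambda>i. c * slice m j i)"
  and slice_zero: "slice (\<lambda>i. 0) j = (\<lambda>i. 0)"
  by (simp_all add: slice_def)

lemma linop_slice: "linop (\<lambda>m. slice m j)"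
  by (rule linopI) (simp_all add: slice_add slice_smult)

lemma linop_unslice: "(\<And>j. linop (F j)) \<Longrightarrow> linop (\<lambda>m. unslice (\<lambda>j. F j m))"
  by (rule linopI; rule slice_eqI) (simp_all add: slice_add slice_smult linop_add linop_smult)

lemma linop_comp: "linop A \<Longrightarrow> linop B \<Longrightarrow> linop (\<lambda>m. A (B m))"
  and linop_plus: "linop A \<Longrightarrow> linop B \<Longrightarrow> linop (\<lambda>m i. A m i + B m i)"
  and linop_minus: "linop A \<Longrightarrow> linop B \<Longrightarrow> linop (\<lambda>m i. A m i - B m i)"
  and linop_times: "linop A \<Longrightarrow> linop (\<lambda>m i. c * A m i)"
  and linop_null: "linop (\<lambda>m i. 0)"
  by (simp_all add: linop_def algebra_simps)

text \<open>
  The module \<open>M\<^sup>\<nat>\<close> on which the eliminated letter \<open>t\<close> acts as \<open>h\<close> plus a shift and every other letter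
  diagonally.  If \<open>[h, z] = succ_letter z\<close> on \<open>M\<close>, then \<open>ad(t)\<^sup>i y\<close> acts diagonally as the
  letter \<open>prod_encode (y, i)\<close>; the shift makes \<open>t\<close> independent of these.
\<close>

definition elim_rep ::
    "(nat \<Rightarrow> (nat \<Rightarrow> 'k::field) \<Rightarrow> nat \<Rightarrow> 'k) \<Rightarrow> ((nat \<Rightarrow> 'k) \<Rightarrow> nat \<Rightarrow> 'k) \<Rightarrow> nat \<Rightarrow>
      nat \<Rightarrow> (nat \<Rightarrow> 'k) \<Rightarrow> nat \<Rightarrow> 'k"
  where "elim_rep \<rho> h t y m = unslice (\<lambda>j. if y = t then (\<lambda>v. h (slice m j) v + slice m (Suc j) v)
    else \<rho> (prod_encode (y, 0)) (slice m j))"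

text \<open>\<open>[h, z] = succ_letter z\<close> on \<open>M\<close>. The set \<open>W\<close> will
  leave out the top letter \<open>x_n\<close>, over which injectivity gives no control.\<close>

definition shifts :: "(nat \<Rightarrow> (nat \<Rightarrow> 'k::field) \<Rightarrow> nat \<Rightarrow> 'k) \<Rightarrow> ((nat \<Rightarrow> 'k) \<Rightarrow> nat \<Rightarrow> 'k) \<Rightarrow> nat set \<Rightarrow> bool"
  where "shifts \<rho> h W \<longleftrightarrow> (\<forall>z\<in>W. \<forall>m. h (\<rho> z m) = (\<lambda>i. \<rho> z (h m) i + \<rho> (succ_letter z) m i))"

text \<open>Values prescribed on letters extend to a derivation of the free algebra into
  \<open>End M\<close>, and \<open>deriv_ext\<close> makes this derivation inner.\<close>

lemma shifts_exist:
  assumes "deriv_ext \<rho> W" "\<And>x. linop (\<rho> x)"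
  obtains h where "linop h" "shifts \<rho> h W"
proof -
  have "\<exists>H. linop H \<and> (\<forall>y\<in>W. \<forall>m. H (\<rho> y m) = (\<lambda>i. \<rho> y (H m) i + \<rho> (succ_letter y) m i))"
    using assms(1)[unfolded deriv_ext_def, rule_format, of \<rho> "\<lambda>y. \<rho> (succ_letter y)"] assms(2) by blast
  then show ?thesis using that by (auto simp: shifts_def)
qed

context
  fixes \<rho> :: "nat \<Rightarrow> (nat \<Rightarrow> 'k::field) \<Rightarrow> nat \<Rightarrow> 'k" and h :: "(nat \<Rightarrow> 'k) \<Rightarrow> nat \<Rightarrow> 'k" and W :: "nat set"
    and t :: nat
  assumes \<rho>: "\<And>x. linop (\<rho> x)" and h: "linop h" and sh: "shifts \<rho> h W"
begin

lemma elim_rep_linop: "linop (elim_rep \<rho> h t y)"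
proof -
  have "linop (\<lambda>m. unslice (\<lambda>j. (\<lambda>v. h (slice m j) v + slice m (Suc j) v)))"
    by (rule linop_unslice) (intro linop_plus linop_comp[OF h] linop_slice)
  moreover have "linop (\<lambda>m. unslice (\<lambda>j. \<rho> (prod_encode (y, 0)) (slice m j)))"
    by (rule linop_unslice) (intro linop_comp[OF \<rho>] linop_slice)
  ultimately show ?thesis by (cases "y = t") (simp_all add: elim_rep_def[abs_def])
qed

lemma shiftsD: "z \<in> W \<Longrightarrow> h (\<rho> z m) i = \<rho> z (h m) i + \<rho> (succ_letter z) m i"
  using sh by (simp add: shifts_def)

text \<open>The shift commutes with diagonal operators and drops out of the commutators. Climbing to
  index \<open>i\<close> uses the relation for \<open>h\<close> at smaller indices only, so the
  letter reached may itself lie outside \<open>W\<close>; this is what admits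
  \<open>x_n\<close>.\<close>

lemma elim_rep_lazard:
  assumes "y \<noteq> t" "\<And>i'. i' < i \<Longrightarrow> prod_encode (y, i') \<in> W"
  shows "slice (lazard gl (elim_rep \<rho> h t) t (prod_encode (y, i)) m) j = \<rho> (prod_encode (y, i)) (slice m j)"
  using assms(2)
proof (induction i arbitrary: m j)
  case 0
  then show ?case using assms(1) by (simp add: elim_rep_def)
next
  case (Suc i)
  define A where "A = lazard gl (elim_rep \<rho> h t) t (prod_encode (y, i))"
  have IH: "slice (A m) j = \<rho> (prod_encode (y, i)) (slice m j)" for m j
    unfolding A_def using Suc.prems by (intro Suc.IH) simp
  have 1: "lazard gl (elim_rep \<rho> h t) t (prod_encode (y, Suc i)) m
    = (\<lambda>k. elim_rep \<rho> h t t (A m) k - A (elim_rep \<rho> h t t m) k)"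
    by (simp add: gl_simps A_def)
  show ?case unfolding 1
    using shiftsD[OF Suc.prems[of i]]
    by (simp add: slice_diff IH elim_rep_def linop_add[OF \<rho>])
qed

lemma elim_rep_subst:
  assumes "f \<in> polys V"
    and V: "\<And>y i. prod_encode (y, i) \<in> V \<Longrightarrow> y \<noteq> t \<and> (\<forall>i'<i. prod_encode (y, i') \<in> W)"
  shows "slice (ev gl (elim_rep \<rho> h t) (lazard_subst t f) m) j = ev gl \<rho> f (slice m j)"
proof -
  let ?\<tau> = "elim_rep \<rho> h t"
  have r: "?\<tau> \<in> UNIV \<rightarrow> carrier gl" using elim_rep_linop by (auto simp: gl_simps)
  have f: "f \<in> polys UNIV" using free_nonassoc_mono[OF subset_UNIV assms(1)] .
  have l: "linop (lazard gl ?\<tau> t z)" if "z \<in> V" for z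
  proof -
    obtain y i where z: "z = prod_encode (y, i)" by (metis prod_decode_inverse surj_pair)
    then have "z \<in> elim_letters t UNIV" using that V by auto
    then show ?thesis
      using lazard_closed[OF gl_algebra, of ?\<tau> t UNIV z] elim_rep_linop by (simp add: gl_simps)
  qed
  have e: "slice (lazard gl ?\<tau> t z m) j = \<rho> z (slice m j)" if "z \<in> V" for z m
    using elim_rep_lazard[of "fst (prod_decode z)" "snd (prod_decode z)" m j]
      V[of "fst (prod_decode z)" "snd (prod_decode z)"] that by (simp del: lazard_encode)
  show ?thesis
    unfolding lazard_ev[OF gl_algebra r f]
    by (rule ev_intertwine[where \<Theta> = "\<lambda>m. slice m j" and X = V, OF assms(1) linop_slice l \<rho> e])
qed

text \<open>Rewriting \<open>f\<close> and reading off slices transfers the vanishing from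
  \<open>M^nat\<close> to \<open>M\<close>, once the shift has excluded a linear term in
  \<open>t\<close>.\<close>

lemma elim_rep_faithful:
  assumes f: "f \<in> graded wt P A" and W: "elim_letters t P \<subseteq> W" and 0: "ev gl (elim_rep \<rho> h t) f = (\<lambda>m i. 0)"
  shows "\<exists>g \<in> graded (elim_weight wt t) (elim_letters t P) A. f \<doteq> lazard_subst t g \<and> ev gl \<rho> g = (\<lambda>m i. 0)"
proof -
  let ?N = "free_nonassoc UNIV :: ('k, nat magma \<Rightarrow> 'k) module" and ?\<tau> = "elim_rep \<rho> h t"
  interpret N: nonassoc_algebra ?N ..
  obtain g where g: "g \<in> graded (elim_weight wt t) (elim_letters t P) A"
    and eq: "f \<doteq> (\<lambda>m. f (Gen t) * gen t m + lazard_subst t g m)"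
    using lazard_rewrite[OF f] by blast
  have gc: "g \<in> polys (elim_letters t P)" by (rule gradedD[OF g])
  have fN: "f \<in> carrier ?N" using free_nonassoc_mono[OF subset_UNIV gradedD[OF f]] .
  have LN: "lazard_subst t g \<in> carrier ?N"
    using lazard_subst_closed[OF gc, of UNIV] by simp
  have tN: "(gen t :: _ \<Rightarrow> 'k) \<in> carrier ?N" by simp
  have r: "?\<tau> \<in> UNIV \<rightarrow> carrier gl" using elim_rep_linop by (auto simp: gl_simps)
  have hom: "alg_hom ?N gl (ev gl ?\<tau>)" by (rule gl_ev_hom[OF elim_rep_linop])
  let ?f = "f (Gen t) \<odot>\<^bsub>?N\<^esub> gen t \<oplus>\<^bsub>?N\<^esub> lazard_subst t g"
  have "f \<doteq> ?f" using eq by (simp add: free_nonassoc_simps)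
  moreover have "?f \<in> carrier ?N" using LN by simp
  ultimately have "ev gl ?\<tau> f = ev gl ?\<tau> ?f"
    by (rule lie_equiv_ev[OF _ fN _ gl_lie_algebra r])
  also have "\<dots> = (\<lambda>m i. f (Gen t) * ?\<tau> t m i + ev gl ?\<tau> (lazard_subst t g) m i)"
    unfolding alg_homD(2)[OF hom N.smult_in[OF tN] LN] alg_homD(3)[OF hom tN]
    by (simp add: gl_simps gl_ev_gen[of ?\<tau>, OF elim_rep_linop])
  finally have z: "f (Gen t) * ?\<tau> t m i + ev gl ?\<tau> (lazard_subst t g) m i = 0" for m i
    using 0 by (simp add: fun_eq_iff)
  have z': "f (Gen t) * slice (?\<tau> t m) j i + ev gl \<rho> g (slice m j) i = 0" for m j i
  proof -
    have "slice (ev gl ?\<tau> (lazard_subst t g) m) j = ev gl \<rho> g (slice m j)"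
      by (rule elim_rep_subst[OF gc]) (use W in auto)
    then show ?thesis using z[of m "prod_encode (j, i)"] by (simp add: slice_def fun_eq_iff)
  qed
  have gl0: "linop (ev gl \<rho> g)" using alg_homD(1)[OF gl_ev_hom[OF \<rho>] gc] by (simp add: gl_simps)
  \<comment> \<open>The test vector is 1 in slice 1 and 0 in slice 0. In slice 0 of the result both
    \<open>h\<close> and \<open>g\<close> contribute nothing, and the shift leaves exactly the
    coefficient of \<open>t\<close>.\<close>
  have ft: "f (Gen t) = 0"
    using z'[of "unslice (\<lambda>j v. if j = 1 then 1 else 0)" 0 0] linop_zero[OF h] linop_zero[OF gl0]
    by (simp add: elim_rep_def)
  have "ev gl \<rho> g m i = 0" for m i
    using z'[of "unslice (\<lambda>j. m)" 0 i] ft by simp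
  then show ?thesis using g eq ft by (intro bexI[of _ g]) auto
qed

section \<open>The extension problem on \<open>M^nat\<close>\<close>

primrec ad_iter :: "((nat \<Rightarrow> 'k) \<Rightarrow> nat \<Rightarrow> 'k) \<Rightarrow> ((nat \<Rightarrow> 'k) \<Rightarrow> nat \<Rightarrow> 'k) \<Rightarrow> nat \<Rightarrow> (nat \<Rightarrow> 'k) \<Rightarrow> nat \<Rightarrow> 'k"
  where
    "ad_iter T A 0 = A"
  | "ad_iter T A (Suc i) = (\<lambda>m j. T (ad_iter T A i m) j - ad_iter T A i (T m) j)"

text \<open>The value on \<open>ad(t)^i y\<close> of the derivation \<open>D\<close> into
  \<open>Hom(Q, M^nat)\<close> that is \<open>\<delta>\<close> on letters. From
  \<open>D(ab) = a D(b) + D(a) b\<close> one gets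
  \<open>D[t, a] = D(t) a + t D(a) - D(a) t - a D(t)\<close>; these are the four summands, the last
  written with the diagonal action of \<open>a = ad(t)^i y\<close>.\<close>

primrec der_iter :: "nat \<Rightarrow> (nat \<Rightarrow> (nat \<Rightarrow> 'k) \<Rightarrow> nat \<Rightarrow> 'k) \<Rightarrow> (nat \<Rightarrow> (nat \<Rightarrow> 'k) \<Rightarrow> nat \<Rightarrow> 'k) \<Rightarrow>
    nat \<Rightarrow> (nat \<Rightarrow> 'k) \<Rightarrow> nat \<Rightarrow> 'k"
  where
    "der_iter y q \<delta> 0 = \<delta> y"
  | "der_iter y q \<delta> (Suc i) = (\<lambda>m j. \<delta> t (ad_iter (q t) (q y) i m) j
      + elim_rep \<rho> h t t (der_iter y q \<delta> i m) j
      - der_iter y q \<delta> i (q t m) j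
      - unslice (\<lambda>j. \<rho> (prod_encode (y, i)) (slice (\<delta> t m) j)) j)"

lemma ad_iter_linop: "linop T \<Longrightarrow> linop A \<Longrightarrow> linop (ad_iter T A i)"
  by (induction i) (auto intro!: linop_minus linop_comp[of T] linop_comp[of _ T])

lemma der_iter_linop:
  assumes "\<And>x. linop (q x)" "\<And>x. linop (\<delta> x)"
  shows "linop (der_iter y q \<delta> i)"
proof (induction i)
  case (Suc i)
  have "linop (\<lambda>m. unslice (\<lambda>j. \<rho> (prod_encode (y, i)) (slice (\<delta> t m) j)))"
    by (rule linop_unslice) (intro linop_comp[OF \<rho>] linop_comp[OF linop_slice assms(2)])
  then show ?case unfolding der_iter.simps
    by (intro linop_minus linop_plus linop_comp[OF assms(2) ad_iter_linop] linop_comp[OF elim_rep_linop Suc]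
      linop_comp[OF Suc] assms)
qed (simp add: assms)

text \<open>
  A solution \<open>H\<close> of the extension problem for \<open>M\<^sup>\<nat>\<close> is determined by its zeroth component, for
  which the problem is one over the letters \<open>prod_encode (y, i)\<close>.
\<close>

lemma elim_rep_deriv_ext:
  assumes ext: "deriv_ext \<rho> W" and W: "elim_letters t Y \<subseteq> W"
  shows "deriv_ext (elim_rep \<rho> h t) Y"
  unfolding deriv_ext_def
proof (intro allI impI)
  fix q \<delta> :: "nat \<Rightarrow> (nat \<Rightarrow> 'k) \<Rightarrow> nat \<Rightarrow> 'k"
  assume "\<forall>x. linop (q x)" "\<forall>x. linop (\<delta> x)"
  then have q: "\<And>x. linop (q x)" and \<delta>: "\<And>x. linop (\<delta> x)" by auto
  define Q where "Q y i = ad_iter (q t) (q y) i" for y i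
  define D where "D y i = der_iter y q \<delta> i" for y i
  have Q: "linop (Q y i)" for y i unfolding Q_def by (intro ad_iter_linop q)
  have D: "linop (D y i)" for y i unfolding D_def by (intro der_iter_linop q \<delta>)
  \<comment> \<open>The problem for \<open>M\<close>: the letter \<open>prod_encode (y, i)\<close>
    acts on the source as \<open>ad(t)^i y\<close> does, and its prescribed value is the zeroth
    component of \<open>D y i\<close>.\<close>
  have "\<exists>H. linop H \<and> (\<forall>z\<in>W. \<forall>m. H (case_prod Q (prod_decode z) m)
    = (\<lambda>i. \<rho> z (H m) i + slice (case_prod D (prod_decode z) m) 0 i))"
    by (rule ext[unfolded deriv_ext_def, rule_format])
      (auto split: prod.splits intro: Q linop_comp[OF linop_slice D])
  then obtain H0 where H0: "linop H0"
    and H0': "\<And>z m. z \<in> W \<Longrightarrow> H0 (case_prod Q (prod_decode z) m)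
      = (\<lambda>i. \<rho> z (H0 m) i + slice (case_prod D (prod_decode z) m) 0 i)" by blast
  \<comment> \<open>Slice \<open>j\<close> of the equation for \<open>t\<close> contains slice
    \<open>j + 1\<close> of the unknown through the shift, so it can be solved for it; the equation
    for \<open>t\<close> then holds by construction.\<close>
  define F where "F = rec_nat H0 (\<lambda>j G m v. G (q t m) v - h (G m) v - slice (\<delta> t m) j v)"
  have F0: "F 0 = H0" and FS: "F (Suc j) = (\<lambda>m v. F j (q t m) v - h (F j m) v - slice (\<delta> t m) j v)" for j
    by (simp_all add: F_def)
  have F: "linop (F j)" for j
  proof (induction j)
    case (Suc j)
    then show ?case unfolding FS
      by (intro linop_minus linop_comp[OF Suc q] linop_comp[OF h Suc] linop_comp[OF linop_slice \<delta>])
  qed (simp add: F0 H0)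
  \<comment> \<open>The equations for the other letters pass from slice \<open>j\<close> to
    \<open>j + 1\<close>. All \<open>i\<close> are treated at once because commuting with
    \<open>t\<close> raises \<open>i\<close> by one.\<close>
  have key: "F j (Q y i m) = (\<lambda>v. \<rho> (prod_encode (y, i)) (F j m) v + slice (D y i m) j v)"
    if "y \<in> Y" "y \<noteq> t" for j y i m
  proof (induction j arbitrary: i m)
    case 0
    have "prod_encode (y, i) \<in> W" using W that by auto
    from H0'[OF this] show ?case by (simp add: F0)
  next
    case (Suc j)
    have w: "prod_encode (y, i) \<in> W" using W that by auto
    let ?r = "\<rho> (prod_encode (y, i))" and ?r' = "\<rho> (prod_encode (y, Suc i))"
    have rd: "?r (\<lambda>v. a v - b v - c v) = (\<lambda>v. ?r a v - ?r b v - ?r c v)" for a b c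
      using linop_diff[OF \<rho>] by simp
    have QS: "Q y (Suc i) m = (\<lambda>v. q t (Q y i m) v - Q y i (q t m) v)" by (simp add: Q_def)
    have "F j (q t (Q y i m)) v = F j (Q y (Suc i) m) v + F j (Q y i (q t m)) v" for v
      using linop_diff[OF F] unfolding QS by simp
    then have 1: "F j (q t (Q y i m)) v = ?r' (F j m) v + slice (D y (Suc i) m) j v
      + ?r (F j (q t m)) v + slice (D y i (q t m)) j v" for v
      using Suc[of "Suc i" m] Suc[of i "q t m"] by simp
    have 2: "h (F j (Q y i m)) v = ?r (h (F j m)) v + ?r' (F j m) v + h (slice (D y i m) j) v" for v
      using Suc[of i m] shiftsD[OF w] by (simp add: linop_add[OF h])
    have 3: "slice (D y (Suc i) m) j v = slice (\<delta> t (Q y i m)) j v + h (slice (D y i m) j) v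
      + slice (D y i m) (Suc j) v - slice (D y i (q t m)) j v - ?r (slice (\<delta> t m) j) v" for v
      by (simp add: D_def Q_def elim_rep_def slice_add slice_diff)
    show ?case unfolding FS rd by (simp add: fun_eq_iff 1 2 3)
  qed
  define H where "H m = unslice (\<lambda>j. F j m)" for m
  have "linop H" unfolding H_def[abs_def] by (rule linop_unslice[OF F])
  moreover have "H (q y m) = (\<lambda>i. elim_rep \<rho> h t y (H m) i + \<delta> y m i)" if y: "y \<in> Y" for y m
  proof (rule slice_eqI)
    fix j
    show "slice (H (q y m)) j = slice (\<lambda>i. elim_rep \<rho> h t y (H m) i + \<delta> y m i) j"
    proof (cases "y = t")
      case True
      then show ?thesis by (simp add: H_def slice_add elim_rep_def FS)
    next
      case False
      then show ?thesis using key[OF y False, of j 0 m]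
        by (simp add: H_def slice_add elim_rep_def Q_def D_def)
    qed
  qed
  ultimately show "\<exists>H. linop H \<and> (\<forall>y\<in>Y. \<forall>m. H (q y m) = (\<lambda>i. elim_rep \<rho> h t y (H m) i + \<delta> y m i))"
    by blast
qed

end

subsection \<open>The cofree module\<close>

text \<open>
  Natural numbers encode words, \<open>Suc (prod_encode (y, n))\<close> being the letter \<open>y\<close> followed by the
  word \<open>n\<close>.
\<close>

definition cofree :: "nat \<Rightarrow> (nat \<Rightarrow> 'k::field) \<Rightarrow> nat \<Rightarrow> 'k"
  where "cofree y m n = m (Suc (prod_encode (y, n)))"

lemma cofree_linop: "linop (cofree y)"
  by (rule linopI) (simp_all add: cofree_def fun_eq_iff)

text \<open>The equation \<open>H (q y m) = cofree y (H m) + \<delta> y m\<close> forces the value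
  of \<open>H m\<close> at a word \<open>y n\<close> from values of \<open>H\<close> at the shorter
  word \<open>n\<close>; \<open>b\<close> is the free choice at the empty word. The test
  \<open>n \<le> k\<close> always holds and secures termination.\<close>

fun word_rec :: "((nat \<Rightarrow> 'k) \<Rightarrow> 'k::field) \<Rightarrow> (nat \<Rightarrow> (nat \<Rightarrow> 'k) \<Rightarrow> nat \<Rightarrow> 'k) \<Rightarrow>
    (nat \<Rightarrow> (nat \<Rightarrow> 'k) \<Rightarrow> nat \<Rightarrow> 'k) \<Rightarrow> nat \<Rightarrow> (nat \<Rightarrow> 'k) \<Rightarrow> 'k"
  where
    "word_rec b q \<delta> 0 m = b m"
  | "word_rec b q \<delta> (Suc k) m = (let (y, n) = prod_decode k in
      (if n \<le> k then word_rec b q \<delta> n (q y m) else 0) - \<delta> y m n)"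

lemma word_rec_step:
  "word_rec b q \<delta> (Suc (prod_encode (y, n))) m = word_rec b q \<delta> n (q y m) - \<delta> y m n"
  using le_prod_encode_2[of n y] by simp

lemma word_induct [case_names Nil Cons]:
  assumes "P 0" "\<And>y n. P n \<Longrightarrow> P (Suc (prod_encode (y, n)))"
  shows "P n"
proof (induction n rule: less_induct)
  case (less n)
  show ?case
  proof (cases n)
    case (Suc k)
    obtain y v where k: "k = prod_encode (y, v)" by (metis prod_decode_inverse surj_pair)
    then have "v < n" using Suc le_prod_encode_2[of v y] by simp
    then show ?thesis using less assms(2) Suc k by blast
  qed (simp add: assms(1))
qed

lemma word_rec_linop:
  assumes "linop (\<lambda>m i::nat. b m)" "\<And>x. linop (q x)" "\<And>x. linop (\<delta> x)"
  shows "linop (\<lambda>m n. word_rec b q \<delta> n m)"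
proof -
  have "(\<forall>m m'. word_rec b q \<delta> n (\<lambda>i. m i + m' i) = word_rec b q \<delta> n m + word_rec b q \<delta> n m') \<and>
    (\<forall>c m. word_rec b q \<delta> n (\<lambda>i. c * m i) = c * word_rec b q \<delta> n m)" for n
  proof (induction n rule: word_induct)
    case Nil
    show ?case using assms(1) by (simp add: linop_def fun_eq_iff)
  next
    case (Cons y n)
    then show ?case
      by (simp only: word_rec_step linop_add[OF assms(2)] linop_add[OF assms(3)] linop_smult[OF assms(2)]
        linop_smult[OF assms(3)]) (simp add: algebra_simps)
  qed
  then show ?thesis by (auto simp: linop_def)
qed

lemma cofree_deriv_ext: "deriv_ext cofree Y"
  unfolding deriv_ext_def
proof (intro allI impI)
  fix q \<delta> :: "nat \<Rightarrow> (nat \<Rightarrow> 'a::field) \<Rightarrow> nat \<Rightarrow> 'a"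
  assume q: "\<forall>x. linop (q x)" "\<forall>x. linop (\<delta> x)"
  let ?H = "\<lambda>m n. word_rec (\<lambda>m. 0) q \<delta> n m"
  have "linop ?H" using q by (intro word_rec_linop linop_null) auto
  moreover have "?H (q y m) = (\<lambda>i. cofree y (?H m) i + \<delta> y m i)" for y m
    by (rule ext) (simp only: cofree_def word_rec_step diff_add_cancel)
  ultimately show "\<exists>H. linop H \<and> (\<forall>y\<in>Y. \<forall>m. H (q y m) = (\<lambda>i. cofree y (H m) i + \<delta> y m i))" by blast
qed

text \<open>Every linear functional on a module extends to a homomorphism into the cofree module
  whose value at the empty word is that functional. Taking the \<open>i\<close>-th coordinate
  recovers the action of \<open>f\<close> there.\<close>

lemma cofree_universal:
  fixes \<rho> :: "nat \<Rightarrow> (nat \<Rightarrow> 'k::field) \<Rightarrow> nat \<Rightarrow> 'k"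
  assumes "f \<in> polys X" "ev gl cofree f = (\<lambda>m i. 0)" "\<And>x. linop (\<rho> x)"
  shows "ev gl \<rho> f = (\<lambda>m i. 0)"
proof (intro ext)
  fix m i
  let ?H = "\<lambda>m n. word_rec (\<lambda>m. m i) \<rho> (\<lambda>y m i. 0) n m"
  have H: "linop ?H" using assms(3) by (intro word_rec_linop linop_null) (auto simp: linop_def)
  have "?H (ev gl \<rho> f m) = ev gl cofree f (?H m)"
    by (rule ev_intertwine[where \<Theta> = ?H and X = X, OF assms(1) H assms(3) cofree_linop])
      (rule ext, simp only: cofree_def word_rec_step diff_zero)
  then have "?H (ev gl \<rho> f m) 0 = 0" using assms(2) by (metis (no_types))
  then show "ev gl \<rho> f m i = 0" by simp
qed

subsection \<open>The induction measure\<close>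

text \<open>The finitely many new letters that matter: \<open>t\<close> weighs at least 1, so an
  index above \<open>w\<close> makes a letter heavier than \<open>w\<close>.\<close>

definition elim_upto :: "nat \<Rightarrow> nat \<Rightarrow> nat set \<Rightarrow> nat set"
  where "elim_upto w t P = {prod_encode (y, i) | y i. y \<in> P - {t} \<and> i \<le> w}"

text \<open>Heavier letters count less. With \<open>Suc\<close> a letter of weight \<open>w\<close>
  still counts 1, strictly more than the letters beyond \<open>w\<close>, for which the truncated
  difference is 0.\<close>

definition weight_mset :: "nat \<Rightarrow> (nat \<Rightarrow> nat) \<Rightarrow> nat set \<Rightarrow> nat multiset"
  where "weight_mset w wt P = image_mset (\<lambda>p. Suc w - wt p) (mset_set P)"

lemma elim_upto_eq: "elim_upto w t P = prod_encode ` ((P - {t}) \<times> {..w})"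
  by (auto simp: elim_upto_def)

lemma finite_elim_upto: "finite P \<Longrightarrow> finite (elim_upto w t P)"
  by (simp add: elim_upto_eq)

lemma elim_upto_subset: "elim_upto w t P \<subseteq> elim_letters t P"
  by (auto simp: elim_upto_def elim_letters_def)

lemma weight_mset_subset:
  assumes "finite Q" "P \<subseteq> Q"
  shows "(weight_mset w wt P, weight_mset w wt Q) \<in> (mult less_than)\<^sup>="
proof -
  have "mset_set Q = mset_set P + mset_set (Q - P)"
    using assms by (metis Diff_disjoint Diff_partition finite_Diff finite_subset mset_set_Union)
  then have *: "weight_mset w wt Q = weight_mset w wt P + image_mset (\<lambda>p. Suc w - wt p) (mset_set (Q - P))"
    by (simp add: weight_mset_def)
  show ?thesis
  proof (cases "mset_set (Q - P) = {#}")
    case False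
    then show ?thesis unfolding *
      using one_step_implies_mult[of "image_mset (\<lambda>p. Suc w - wt p) (mset_set (Q - P))" "{#}" less_than
        "weight_mset w wt P"] by simp
  qed (simp add: *)
qed

text \<open>Eliminating \<open>t\<close> replaces it by finitely many heavier letters.\<close>

lemma weight_mset_elim:
  assumes P: "finite P" "t \<in> P" and t: "\<And>p. 0 < wt p" "wt t \<le> w" and Q: "Q \<subseteq> elim_upto w t P"
  shows "(weight_mset w (elim_weight wt t) Q, weight_mset w wt P) \<in> mult less_than"
proof -
  let ?f = "\<lambda>p. Suc w - wt p" and ?g = "\<lambda>p. Suc w - elim_weight wt t p"
  \<comment> \<open>Letters of index 0 keep their weight and match \<open>P - {t}\<close>; those of
    positive index are heavier than \<open>t\<close> and are dominated by it in the multiset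
    order.\<close>
  let ?A = "(\<lambda>y. prod_encode (y, 0)) ` (P - {t})" and ?B = "prod_encode ` ((P - {t}) \<times> {1..w})"
  have AB: "elim_upto w t P = ?A \<union> ?B" "?A \<inter> ?B = {}"
    unfolding elim_upto_eq
    by (auto simp: image_iff)
  have "mset_set (elim_upto w t P) = mset_set ?A + mset_set ?B"
    unfolding AB(1) using P AB(2) by (intro mset_set_Union) auto
  moreover have "mset_set ?A = image_mset (\<lambda>y. prod_encode (y, 0)) (mset_set (P - {t}))"
    by (rule image_mset_mset_set[symmetric]) (auto simp: inj_on_def)
  ultimately have 1: "weight_mset w (elim_weight wt t) (elim_upto w t P)
    = image_mset ?f (mset_set (P - {t})) + image_mset ?g (mset_set ?B)"
    by (simp add: weight_mset_def image_mset.compositionality comp_def)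
  have "mset_set P = add_mset t (mset_set (P - {t}))"
    using P by (metis finite_Diff insert_Diff mset_set.insert Diff_iff singletonI)
  then have 2: "weight_mset w wt P = image_mset ?f (mset_set (P - {t})) + {#?f t#}"
    by (simp add: weight_mset_def)
  have "(weight_mset w (elim_weight wt t) (elim_upto w t P), weight_mset w wt P) \<in> mult less_than"
    unfolding 1 2
  proof (rule one_step_implies_mult)
    show "\<forall>k\<in>#image_mset ?g (mset_set ?B). \<exists>j\<in>#{#?f t#}. (k, j) \<in> less_than"
    proof
      fix k assume "k \<in># image_mset ?g (mset_set ?B)"
      then obtain y i where "1 \<le> i" "k = Suc w - (wt y + i * wt t)"
        using P by (fastforce simp: elim_weight_def)
      moreover have "wt t \<le> i * wt t" using \<open>1 \<le> i\<close> by (cases i) simp_all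
      moreover have "0 < wt y" by (rule t(1))
      ultimately have "k < ?f t" using t(2) by linarith
      then show "\<exists>j\<in>#{#?f t#}. (k, j) \<in> less_than" by simp
    qed
  qed simp
  moreover have "(weight_mset w (elim_weight wt t) Q, weight_mset w (elim_weight wt t) (elim_upto w t P))
      \<in> (mult less_than)\<^sup>="
    by (rule weight_mset_subset[OF finite_elim_upto[OF P(1)] Q])
  ultimately show ?thesis using transD[OF trans_mult[of less_than]] by auto
qed

lemma letter_weight: "x \<in> set_magma m \<Longrightarrow> wt x \<le> magma_weight wt m"
  by (induction m) auto

lemma graded_elim_upto:
  assumes g: "g \<in> graded (elim_weight wt t) (elim_letters t P) A" and "A \<subseteq> {..w}" "0 < wt t"
  shows "g \<in> graded (elim_weight wt t) (elim_upto w t P) A"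
proof -
  have "set_magma m \<subseteq> elim_upto w t P" if m: "g m \<noteq> 0" for m
  proof
    fix z assume z: "z \<in> set_magma m"
    have "set_magma m \<subseteq> elim_letters t P" using g m by (auto simp: graded_def free_nonassoc_simps)
    then obtain y i where yi: "z = prod_encode (y, i)" "y \<in> P - {t}" using z by (auto simp: elim_letters_def)
    have "wt y + i * wt t \<le> w"
      using letter_weight[OF z, of "elim_weight wt t"] graded_weight[OF g m] assms(2) yi by auto
    moreover have "i \<le> i * wt t" using assms(3) by simp
    ultimately have "i \<le> w" by linarith
    then show "z \<in> elim_upto w t P" using yi by (auto simp: elim_upto_def)
  qed
  then show ?thesis using g by (auto simp: graded_def free_nonassoc_simps)
qed

lemma lie_equiv_lazard_kernel:
  assumes "f \<doteq> lazard_subst t g" "g \<in> lie_kernel UNIV" "f \<in> polys UNIV"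
  shows "f \<in> lie_kernel UNIV"
proof -
  let ?N = "free_nonassoc UNIV :: ('a, nat magma \<Rightarrow> 'a) module"
  interpret N: nonassoc_algebra ?N ..
  have K: "lazard_subst t g \<in> lie_kernel UNIV"
    by (rule pres_ideal_hom[where \<phi> = "lazard_subst t" and R = "{}", OF lazard_subst_hom _ lie_kernel_ideal])
      (use assms(2) pres_ideal_relators(2)[of UNIV "{}"] in \<open>simp_all add: lie_kernel_eq\<close>)
  have "(\<lambda>m. f m - lazard_subst t g m) \<oplus>\<^bsub>?N\<^esub> lazard_subst t g \<in> lie_kernel UNIV"
    by (rule alg_idealD(3)[OF _ lie_kernel_ideal _ K]) (use assms(1) in \<open>simp_all add: lie_equiv_def\<close>)
  then show ?thesis by (simp add: free_nonassoc_simps)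
qed

text \<open>Witt's theorem that the free Lie algebra embeds in the free associative algebra.\<close>

lemma cofree_faithful_aux:
  assumes "finite P" "\<And>x. 0 < wt x" "f \<in> graded wt P {..w}" "ev gl cofree f = (\<lambda>m i. 0)"
  shows "f \<in> lie_kernel UNIV"
proof -
  have "wf (inv_image (mult less_than) (\<lambda>(wt, P). weight_mset w wt P))"
    by (intro wf_inv_image wf_mult wf_less_than)
  then show ?thesis using assms
  proof (induction "(wt, P)" arbitrary: wt P f rule: wf_induct_rule)
    case less
    note f = less.prems(3)
    have fN: "f \<in> polys UNIV" using free_nonassoc_mono[OF subset_UNIV gradedD[OF f]] .
    show ?case
    proof (cases "\<exists>t\<in>P. wt t \<le> w")
      case True
      then obtain t where t: "t \<in> P" "wt t \<le> w" by blast
      obtain h :: "(nat \<Rightarrow> 'a) \<Rightarrow> nat \<Rightarrow> 'a" where h: "linop h" "shifts cofree h UNIV"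
        by (rule shifts_exist[OF cofree_deriv_ext cofree_linop])
      \<comment> \<open>What annihilates the cofree module annihilates every module, in particular
        its power with the shift. Thus the new polynomial \<open>g\<close> again annihilates the
        cofree module.\<close>
      have "ev gl (elim_rep cofree h t) f = (\<lambda>m i. 0)"
        by (rule cofree_universal[OF fN less.prems(4) elim_rep_linop[OF cofree_linop h]])
      from elim_rep_faithful[OF cofree_linop h f subset_UNIV this]
      obtain g where g: "g \<in> graded (elim_weight wt t) (elim_letters t P) {..w}" "f \<doteq> lazard_subst t g"
        "ev gl cofree g = (\<lambda>m i. 0)" by blast
      have up: "g \<in> graded (elim_weight wt t) (elim_upto w t P) {..w}"
        by (rule graded_elim_upto[OF g(1) order_refl less.prems(2)])
      have dec: "((elim_weight wt t, elim_upto w t P), wt, P)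
          \<in> inv_image (mult less_than) (\<lambda>(wt, P). weight_mset w wt P)"
        using weight_mset_elim[of P t wt w, OF less.prems(1) t(1) less.prems(2) t(2) subset_refl] by simp
      have "0 < elim_weight wt t z" for z
        using less.prems(2) by (simp add: elim_weight_def split: prod.split)
      from less.hyps[OF dec finite_elim_upto[OF less.prems(1)] this up g(3)]
      have "g \<in> lie_kernel UNIV" .
      then show ?thesis using lie_equiv_lazard_kernel[OF g(2) _ fN] by simp
    next
      case False
      \<comment> \<open>All letters are heavier than \<open>w\<close>, so no monomial has weight at
        most \<open>w\<close>.\<close>
      have "f m = 0" for m
      proof (rule ccontr)
        assume m: "f m \<noteq> 0"
        obtain x where x: "x \<in> set_magma m" by (induction m) auto
        have "x \<in> P" "magma_weight wt m \<le> w"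
          using f m x by (auto simp: graded_def free_nonassoc_simps)
        then show False using letter_weight[OF x, of wt] False by auto
      qed
      then have "f = \<zero>\<^bsub>free_nonassoc UNIV\<^esub>" by (simp add: free_nonassoc_simps fun_eq_iff)
      then show ?thesis using alg_idealD(2)[OF _ lie_kernel_ideal[of UNIV]] by simp
    qed
  qed
qed

lemma cofree_faithful: "faithful cofree Y"
  unfolding faithful_def
proof (intro ballI impI)
  fix f :: "nat magma \<Rightarrow> 'a" assume f: "f \<in> polys Y" "ev gl cofree f = (\<lambda>m i. 0)"
  \<comment> \<open>With all letters of weight 1, a single polynomial involves finitely many letters
    and bounded weights; the sum over its support is a convenient bound.\<close>
  let ?S = "{m. f m \<noteq> 0}" and ?wt = "\<lambda>x::nat. 1::nat"
  have fin: "finite ?S" using f by (simp add: free_nonassoc_simps)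
  have "finite (set_magma m)" for m :: "nat magma" by (induction m) auto
  then have P: "finite (\<Union>m\<in>?S. set_magma m)" using fin by simp
  have "magma_weight ?wt m \<le> (\<Sum>m\<in>?S. magma_weight ?wt m)" if "f m \<noteq> 0" for m
    using fin that by (intro member_le_sum) auto
  then have "f \<in> graded ?wt (\<Union>m\<in>?S. set_magma m) {..\<Sum>m\<in>?S. magma_weight ?wt m}"
    using fin by (auto simp: graded_def free_nonassoc_simps)
  then show "f \<in> lie_kernel UNIV" by (rule cofree_faithful_aux[OF P _ _ f(2), rotated]) simp
qed


subsection \<open>Solving one equation\<close>

definition solvable :: "(nat magma \<Rightarrow> 'k::field) \<Rightarrow> nat \<Rightarrow> bool"
  where "solvable r x \<longleftrightarrow> (\<exists>\<rho>. (\<forall>y. linop (\<rho> y)) \<and> ev gl \<rho> r = (\<lambda>m i. 0) \<and>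
    deriv_ext \<rho> (UNIV - {x}) \<and> faithful \<rho> (UNIV - {x}))"

lemma solvable_elim:
  assumes r: "r \<in> polys UNIV" "r \<doteq> lazard_subst t g"
    and g: "g \<in> polys V" and x: "x \<noteq> t"
    and V: "\<And>y i. prod_encode (y, i) \<in> V \<Longrightarrow> y \<noteq> t \<and> (y = x \<longrightarrow> i \<le> n)"
    and sol: "solvable g (prod_encode (x, n))"
  shows "solvable r x"
proof -
  let ?W = "UNIV - {prod_encode (x, n)}"
  obtain \<rho> where \<rho>: "\<And>y. linop (\<rho> y)" "ev gl \<rho> g = (\<lambda>m i. 0)" "deriv_ext \<rho> ?W" "faithful \<rho> ?W"
    using sol by (auto simp: solvable_def)
  obtain h where h: "linop h" "shifts \<rho> h ?W" by (rule shifts_exist[OF \<rho>(3,1)])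
  note c = \<rho>(1) h
  let ?\<tau> = "elim_rep \<rho> h t"
  have sub: "elim_letters t (UNIV - {x}) \<subseteq> ?W" by auto
  have "V \<subseteq> elim_letters t UNIV"
  proof
    fix z assume "z \<in> V"
    moreover obtain y i where "z = prod_encode (y, i)" by (metis prod_decode_inverse surj_pair)
    ultimately show "z \<in> elim_letters t UNIV" using V by auto
  qed
  then have "lazard_subst t g \<in> polys UNIV"
    by (intro lazard_subst_closed[of g t UNIV UNIV] free_nonassoc_mono[OF _ g]) auto
  then have "ev gl ?\<tau> r = ev gl ?\<tau> (lazard_subst t g)"
    by (rule lie_equiv_ev[OF r(2,1) _ gl_lie_algebra])
      (use elim_rep_linop[OF c] in \<open>auto simp: gl_simps\<close>)
  also have "\<dots> = (\<lambda>m i. 0)"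
  proof
    fix m
    \<comment> \<open>Indices of \<open>x\<close> in \<open>V\<close> are at most \<open>n\<close>,
      so the indices passed on the way up stay below \<open>n\<close> and avoid the letter missing
      from \<open>?W\<close>.\<close>
    show "ev gl ?\<tau> (lazard_subst t g) m = (\<lambda>i. 0)"
      by (rule slice_eqI, subst elim_rep_subst[OF c g]) (use V \<rho>(2) in \<open>fastforce simp: slice_zero\<close>)+
  qed
  finally have "ev gl ?\<tau> r = (\<lambda>m i. 0)" .
  moreover have "faithful ?\<tau> (UNIV - {x})"
    unfolding faithful_def
  proof (intro ballI impI)
    fix f assume f: "f \<in> polys (UNIV - {x})" "ev gl ?\<tau> f = (\<lambda>m i. 0)"
    \<comment> \<open>Faithfulness concerns arbitrary polynomials; admitting all weights turns the
      grading into no condition.\<close>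
    have "f \<in> graded (\<lambda>x. 0) (UNIV - {x}) UNIV" using f by (simp add: graded_def)
    from elim_rep_faithful[OF c this sub f(2)] obtain g' where
      g': "g' \<in> graded (elim_weight (\<lambda>x. 0) t) (elim_letters t (UNIV - {x})) UNIV" "f \<doteq> lazard_subst t g'"
      "ev gl \<rho> g' = (\<lambda>m i. 0)" by blast
    then have "g' \<in> lie_kernel UNIV"
      using \<rho>(4) free_nonassoc_mono[OF sub gradedD[OF g'(1)]] by (simp add: faithful_def)
    then show "f \<in> lie_kernel UNIV"
      using lie_equiv_lazard_kernel[OF g'(2)] free_nonassoc_mono[OF subset_UNIV f(1)] by blast
  qed
  ultimately show ?thesis
    using elim_rep_linop[OF c] elim_rep_deriv_ext[OF c \<rho>(3) sub] unfolding solvable_def by blast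
qed

lemma linop_sum: "(\<And>p. p \<in> S \<Longrightarrow> linop (A p)) \<Longrightarrow> linop (\<lambda>m i. \<Sum>p\<in>S. A p m i)"
  by (rule linopI) (simp_all add: linop_add linop_smult sum.distrib sum_distrib_left cong: sum.cong)

text \<open>A linear equation is solved by hand: the other letters act cofreely, and
  \<open>x\<close> acts as the linear combination of them that the equation dictates.\<close>

lemma solvable_linear:
  assumes r: "r \<in> polys UNIV" "r \<doteq> l" and l: "l \<in> polys P" "finite P"
    and lin: "\<And>m. l m \<noteq> 0 \<Longrightarrow> \<exists>p. m = Gen p" and x: "l (Gen x) \<noteq> 0"
  shows "solvable r x"
proof -
  define \<rho> where "\<rho> = (\<lambda>y m i. if y = x then (\<Sum>p\<in>P-{x}. (- l (Gen p) / l (Gen x)) * cofree p m i)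
    else cofree y m i)"
  have lx: "linop (\<lambda>m i. (\<Sum>p\<in>P-{x}. (- l (Gen p) / l (Gen x)) * cofree p m i))"
    by (intro linop_sum linop_times cofree_linop)
  then have \<rho>: "linop (\<rho> y)" for y
    by (cases "y = x") (simp_all add: \<rho>_def cofree_linop)
  have xP: "x \<in> P" using l x by (force simp: free_nonassoc_simps)
  note h = gl_ev_hom[of UNIV \<rho>, OF \<rho>]
  let ?N = "free_nonassoc UNIV :: ('a, nat magma \<Rightarrow> 'a) module"
  interpret N: nonassoc_algebra ?N ..
  have "finite {m. l m \<noteq> 0}" "\<forall>m. l m \<noteq> 0 \<longrightarrow> (\<exists>p\<in>P. m = Gen p)"
    using l lin by (fastforce simp: free_nonassoc_simps)+
  then have "l \<in> carrier ?N \<and> (\<forall>m i. ev gl \<rho> l m i = (\<Sum>p\<in>P. l (Gen p) * \<rho> p m i))"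
  proof (induction rule: fin_supp_induct)
    case zero
    have "ev gl \<rho> \<zero>\<^bsub>?N\<^esub> = \<zero>\<^bsub>gl\<^esub>" by (rule alg_hom_zero[OF h _ gl_algebra]) simp
    then show ?case by (simp add: gl_simps free_nonassoc_simps)
  next
    case (add m c g)
    then obtain q where q: "q \<in> P" "m = Gen q" by auto
    have qN: "(gen q :: _ \<Rightarrow> 'a) \<in> carrier ?N" by simp
    have eq: "(\<lambda>m'. g m' + c * mon m m') = g \<oplus>\<^bsub>?N\<^esub> c \<odot>\<^bsub>?N\<^esub> gen q"
      by (simp add: free_nonassoc_simps q)
    have g: "g \<in> carrier ?N" using add by simp
    have "ev gl \<rho> (\<lambda>m'. g m' + c * mon m m') n i = (\<Sum>p\<in>P. (g (Gen p) + c * mon m (Gen p)) * \<rho> p n i)" for n i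
    proof -
      have "ev gl \<rho> (\<lambda>m'. g m' + c * mon m m') n i = ev gl \<rho> g n i + c * \<rho> q n i"
        unfolding eq alg_homD(2)[OF h g N.smult_in[OF qN]] alg_homD(3)[OF h qN]
        by (simp add: gl_simps gl_ev_gen[of \<rho>, OF \<rho>])
      also have "c * \<rho> q n i = (\<Sum>p\<in>P. c * mon m (Gen p) * \<rho> p n i)"
        using q l(2) by (simp add: mon_def if_distrib[of "\<lambda>a. _ * a * _"] sum.delta' cong: if_cong)
      finally show ?thesis using add by (simp add: algebra_simps sum.distrib)
    qed
    then show ?case using eq N.a_closed[OF g N.smult_in[OF qN, of c]] by simp
  qed
  then have e: "ev gl \<rho> l m i = l (Gen x) * \<rho> x m i + (\<Sum>p\<in>P-{x}. l (Gen p) * \<rho> p m i)" for m i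
    using l(2) xP by (simp add: sum.remove)
  have "l (Gen x) * \<rho> x m i = - (\<Sum>p\<in>P-{x}. l (Gen p) * \<rho> p m i)" for m i
    using x by (simp add: \<rho>_def sum_distrib_left sum_negf[symmetric] field_simps)
  then have "ev gl \<rho> l = (\<lambda>m i. 0)" by (simp add: fun_eq_iff e)
  moreover have "ev gl \<rho> r = ev gl \<rho> l"
    by (rule lie_equiv_ev[OF r(2,1) free_nonassoc_mono[OF subset_UNIV l(1)] gl_lie_algebra])
      (use \<rho> in \<open>auto simp: gl_simps\<close>)
  moreover have "deriv_ext \<rho> (UNIV - {x})"
    using cofree_deriv_ext[of "UNIV - {x}"] unfolding deriv_ext_def by (simp add: \<rho>_def)
  moreover have "faithful \<rho> (UNIV - {x})"
    unfolding faithful_def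
  proof (intro ballI impI)
    fix f assume f: "f \<in> polys (UNIV - {x})" "ev gl \<rho> f = (\<lambda>m i. 0)"
    have "ev gl \<rho> f = ev gl cofree f"
      by (rule ev_cong[OF f(1) gl_algebra]) (use \<rho> in \<open>auto simp: gl_simps \<rho>_def fun_eq_iff\<close>)
    then have "ev gl cofree f = (\<lambda>m i. 0)" using f(2) by (rule trans[OF sym])
    then show "f \<in> lie_kernel UNIV"
      using cofree_faithful[of "UNIV - {x}", unfolded faithful_def] f(1) by blast
  qed
  ultimately show ?thesis unfolding solvable_def using \<rho> by auto
qed

section \<open>HNN-extensions\<close>

text \<open>
  The tensor product with the dual numbers.  A homomorphism into it whose first component is
  \<open>\<phi>\<close> has a derivation along \<open>\<phi>\<close> as second component.
\<close>

definition dual :: "('k::field, 'a) module \<Rightarrow> ('k, 'a \<times> 'a) module"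
  where "dual B = \<lparr>carrier = carrier B \<times> carrier B,
    monoid.mult = (\<lambda>x y. (fst x \<otimes>\<^bsub>B\<^esub> fst y, fst x \<otimes>\<^bsub>B\<^esub> snd y \<oplus>\<^bsub>B\<^esub> snd x \<otimes>\<^bsub>B\<^esub> fst y)),
    one = (\<zero>\<^bsub>B\<^esub>, \<zero>\<^bsub>B\<^esub>), ring.zero = (\<zero>\<^bsub>B\<^esub>, \<zero>\<^bsub>B\<^esub>),
    add = (\<lambda>x y. (fst x \<oplus>\<^bsub>B\<^esub> fst y, snd x \<oplus>\<^bsub>B\<^esub> snd y)),
    module.smult = (\<lambda>c x. (c \<odot>\<^bsub>B\<^esub> fst x, c \<odot>\<^bsub>B\<^esub> snd x))\<rparr>"

lemma dual_simps:
  "carrier (dual B) = carrier B \<times> carrier B"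
  "x \<otimes>\<^bsub>dual B\<^esub> y = (fst x \<otimes>\<^bsub>B\<^esub> fst y, fst x \<otimes>\<^bsub>B\<^esub> snd y \<oplus>\<^bsub>B\<^esub> snd x \<otimes>\<^bsub>B\<^esub> fst y)"
  "x \<oplus>\<^bsub>dual B\<^esub> y = (fst x \<oplus>\<^bsub>B\<^esub> fst y, snd x \<oplus>\<^bsub>B\<^esub> snd y)"
  "\<zero>\<^bsub>dual B\<^esub> = (\<zero>\<^bsub>B\<^esub>, \<zero>\<^bsub>B\<^esub>)" "c \<odot>\<^bsub>dual B\<^esub> x = (c \<odot>\<^bsub>B\<^esub> fst x, c \<odot>\<^bsub>B\<^esub> snd x)"
  by (simp_all add: dual_def)

lemma dual_lie_algebra:
  assumes "lie_algebra B"
  shows "lie_algebra (dual B)"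
proof -
  interpret lie_algebra B by fact
  have a: "nonassoc_algebra (dual B)"
    by (rule nonassoc_algebraI)
      (auto simp: dual_simps smult_add_left smult_add_right smult_smult bracket_add_left
        bracket_add_right bracket_smult_left bracket_smult_right a_ac)
  have "x \<otimes>\<^bsub>B\<^esub> y \<oplus>\<^bsub>B\<^esub> y \<otimes>\<^bsub>B\<^esub> x = \<zero>\<^bsub>B\<^esub>" if "x \<in> carrier B" "y \<in> carrier B" for x y
    using that bracket_anti[of x y] by (simp add: l_neg)
  then have 1: "x \<otimes>\<^bsub>dual B\<^esub> x = \<zero>\<^bsub>dual B\<^esub>" if "x \<in> carrier (dual B)" for x
    using that by (auto simp: dual_simps bracket_self)
  have 2: "x \<otimes>\<^bsub>dual B\<^esub> (y \<otimes>\<^bsub>dual B\<^esub> z) \<oplus>\<^bsub>dual B\<^esub> y \<otimes>\<^bsub>dual B\<^esub> (z \<otimes>\<^bsub>dual B\<^esub> x)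
      \<oplus>\<^bsub>dual B\<^esub> z \<otimes>\<^bsub>dual B\<^esub> (x \<otimes>\<^bsub>dual B\<^esub> y) = \<zero>\<^bsub>dual B\<^esub>"
    if "x \<in> carrier (dual B)" "y \<in> carrier (dual B)" "z \<in> carrier (dual B)" for x y z
  proof -
    obtain x0 x1 y0 y1 z0 z1 where e: "x = (x0, x1)" "y = (y0, y1)" "z = (z0, z1)"
      by (metis surj_pair)
    then have c: "x0 \<in> carrier B" "x1 \<in> carrier B" "y0 \<in> carrier B" "y1 \<in> carrier B"
      "z0 \<in> carrier B" "z1 \<in> carrier B" using that by (auto simp: dual_simps)
    \<comment> \<open>The second component is a sum of three Jacobi identities of \<open>B\<close>,
      one for each position of the infinitesimal part.\<close>
    have "x0 \<otimes>\<^bsub>B\<^esub> (y0 \<otimes>\<^bsub>B\<^esub> z1 \<oplus>\<^bsub>B\<^esub> y1 \<otimes>\<^bsub>B\<^esub> z0) \<oplus>\<^bsub>B\<^esub> x1 \<otimes>\<^bsub>B\<^esub> (y0 \<otimes>\<^bsub>B\<^esub> z0) \<oplus>\<^bsub>B\<^esub>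
        (y0 \<otimes>\<^bsub>B\<^esub> (z0 \<otimes>\<^bsub>B\<^esub> x1 \<oplus>\<^bsub>B\<^esub> z1 \<otimes>\<^bsub>B\<^esub> x0) \<oplus>\<^bsub>B\<^esub> y1 \<otimes>\<^bsub>B\<^esub> (z0 \<otimes>\<^bsub>B\<^esub> x0)) \<oplus>\<^bsub>B\<^esub>
        (z0 \<otimes>\<^bsub>B\<^esub> (x0 \<otimes>\<^bsub>B\<^esub> y1 \<oplus>\<^bsub>B\<^esub> x1 \<otimes>\<^bsub>B\<^esub> y0) \<oplus>\<^bsub>B\<^esub> z1 \<otimes>\<^bsub>B\<^esub> (x0 \<otimes>\<^bsub>B\<^esub> y0))
      = (x0 \<otimes>\<^bsub>B\<^esub> (y0 \<otimes>\<^bsub>B\<^esub> z1) \<oplus>\<^bsub>B\<^esub> y0 \<otimes>\<^bsub>B\<^esub> (z1 \<otimes>\<^bsub>B\<^esub> x0) \<oplus>\<^bsub>B\<^esub> z1 \<otimes>\<^bsub>B\<^esub> (x0 \<otimes>\<^bsub>B\<^esub> y0)) \<oplus>\<^bsub>B\<^esub>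
        (x0 \<otimes>\<^bsub>B\<^esub> (y1 \<otimes>\<^bsub>B\<^esub> z0) \<oplus>\<^bsub>B\<^esub> y1 \<otimes>\<^bsub>B\<^esub> (z0 \<otimes>\<^bsub>B\<^esub> x0) \<oplus>\<^bsub>B\<^esub> z0 \<otimes>\<^bsub>B\<^esub> (x0 \<otimes>\<^bsub>B\<^esub> y1)) \<oplus>\<^bsub>B\<^esub>
        (x1 \<otimes>\<^bsub>B\<^esub> (y0 \<otimes>\<^bsub>B\<^esub> z0) \<oplus>\<^bsub>B\<^esub> y0 \<otimes>\<^bsub>B\<^esub> (z0 \<otimes>\<^bsub>B\<^esub> x1) \<oplus>\<^bsub>B\<^esub> z0 \<otimes>\<^bsub>B\<^esub> (x1 \<otimes>\<^bsub>B\<^esub> y0))"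
      using c by (simp add: bracket_add_right a_ac)
    also have "\<dots> = \<zero>\<^bsub>B\<^esub>" using c jacobi by simp
    finally show ?thesis using c jacobi by (simp add: e dual_simps)
  qed
  show ?thesis unfolding lie_algebra_iff using a 1 2 by blast
qed

section \<open>Lie subalgebras\<close>

lemma lie_subalgebraD:
  assumes "nonassoc_algebra L" "lie_subalgebra L S"
  shows "S \<subseteq> carrier L" and "\<zero>\<^bsub>L\<^esub> \<in> S"
    and "\<lbrakk>x \<in> S; y \<in> S\<rbrakk> \<Longrightarrow> x \<oplus>\<^bsub>L\<^esub> y \<in> S"
    and "x \<in> S \<Longrightarrow> c \<odot>\<^bsub>L\<^esub> x \<in> S"
    and "\<lbrakk>x \<in> S; y \<in> S\<rbrakk> \<Longrightarrow> x \<otimes>\<^bsub>L\<^esub> y \<in> S"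
proof -
  interpret nonassoc_algebra L by fact
  have s: "submodule S scalars L" using assms(2) by (simp add: lie_subalgebra_def)
  then interpret s: subgroup S "add_monoid L" by (simp add: submodule_def)
  show "S \<subseteq> carrier L" "\<zero>\<^bsub>L\<^esub> \<in> S" "\<lbrakk>x \<in> S; y \<in> S\<rbrakk> \<Longrightarrow> x \<oplus>\<^bsub>L\<^esub> y \<in> S"
    using s.subset s.one_closed s.m_closed by auto
  show "x \<in> S \<Longrightarrow> c \<odot>\<^bsub>L\<^esub> x \<in> S" using submoduleE(4)[OF s, of c x] by simp
  show "\<lbrakk>x \<in> S; y \<in> S\<rbrakk> \<Longrightarrow> x \<otimes>\<^bsub>L\<^esub> y \<in> S" using assms(2) by (simp add: lie_subalgebra_def)
qed

lemma lie_subalgebra_image: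
  assumes "alg_hom N L \<pi>" "nonassoc_algebra N" "nonassoc_algebra L"
  shows "lie_subalgebra L (\<pi> ` carrier N)"
proof -
  interpret N: nonassoc_algebra N by fact
  interpret L: nonassoc_algebra L by fact
  note h = alg_homD[OF assms(1)]
  have sm: "c \<odot>\<^bsub>L\<^esub> x \<in> \<pi> ` carrier N" if x: "x \<in> \<pi> ` carrier N" for c x
  proof -
    obtain f where f: "f \<in> carrier N" "x = \<pi> f" using x by auto
    have "c \<odot>\<^bsub>L\<^esub> x = \<pi> (c \<odot>\<^bsub>N\<^esub> f)" using f h(3) by simp
    then show ?thesis using f by blast
  qed
  have "submodule (\<pi> ` carrier N) scalars L"
  proof (rule L.submoduleI)
    show "\<pi> ` carrier N \<subseteq> carrier L" using h(1) by auto
    show "\<zero>\<^bsub>L\<^esub> \<in> \<pi> ` carrier N" using alg_hom_zero[OF assms] N.zero_closed by (metis image_eqI)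
    show "\<ominus>\<^bsub>L\<^esub> x \<in> \<pi> ` carrier N" if "x \<in> \<pi> ` carrier N" for x
    proof -
      have "x \<in> carrier L" using that h(1) by auto
      then show ?thesis using sm[OF that, of "- 1"] by (simp add: L.minus_conv)
    qed
    show "x \<oplus>\<^bsub>L\<^esub> y \<in> \<pi> ` carrier N" if xy: "x \<in> \<pi> ` carrier N" "y \<in> \<pi> ` carrier N" for x y
    proof -
      obtain f g where f: "f \<in> carrier N" "x = \<pi> f" "g \<in> carrier N" "y = \<pi> g" using xy by auto
      have "x \<oplus>\<^bsub>L\<^esub> y = \<pi> (f \<oplus>\<^bsub>N\<^esub> g)" using f h(2) by simp
      then show ?thesis using f by blast
    qed
  qed (use sm in auto)
  moreover have "x \<otimes>\<^bsub>L\<^esub> y \<in> \<pi> ` carrier N" if xy: "x \<in> \<pi> ` carrier N" "y \<in> \<pi> ` carrier N" for x y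
  proof -
    obtain f g where f: "f \<in> carrier N" "x = \<pi> f" "g \<in> carrier N" "y = \<pi> g" using xy by auto
    have "x \<otimes>\<^bsub>L\<^esub> y = \<pi> (f \<otimes>\<^bsub>N\<^esub> g)" using f h(4) by simp
    then show ?thesis using f by blast
  qed
  ultimately show ?thesis by (simp add: lie_subalgebra_def)
qed

lemma lie_subalgebra_lie_algebra:
  assumes "lie_algebra L" "lie_subalgebra L S"
  shows "lie_algebra (L\<lparr>carrier := S\<rparr>)"
proof -
  interpret lie_algebra L by fact
  note D = lie_subalgebraD[OF nonassoc_algebra_axioms assms(2)]
  have in_L: "x \<in> S \<Longrightarrow> x \<in> carrier L" for x using D(1) by auto
  have "nonassoc_algebra (L\<lparr>carrier := S\<rparr>)"
    by (rule nonassoc_algebraI)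
      (use D(2-5) in_L in \<open>simp_all add: smult_add_left smult_add_right smult_smult bracket_add_left
        bracket_add_right bracket_smult_left bracket_smult_right a_ac\<close>)
  then show ?thesis unfolding lie_algebra_iff using in_L bracket_self jacobi by simp
qed

text \<open>The relators of the HNN-extension lifted from the free Lie algebra to polynomials, which
  is the form that \<open>presents\<close> takes.\<close>

definition hnn_polys ::
    "('k::field, 'b) module \<Rightarrow> 'b set \<Rightarrow> ('b \<Rightarrow> 'b) \<Rightarrow> ('b option magma \<Rightarrow> 'k) set"
  where "hnn_polys B S d =
    (let N = free_nonassoc (hnn_gens B); \<iota> = (\<lambda>b. gen (Some b)); h = gen None
     in {\<iota> (x \<oplus>\<^bsub>B\<^esub> y) \<ominus>\<^bsub>N\<^esub> (\<iota> x \<oplus>\<^bsub>N\<^esub> \<iota> y) | x y. x \<in> carrier B \<and> y \<in> carrier B} \<union>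
        {\<iota> (c \<odot>\<^bsub>B\<^esub> x) \<ominus>\<^bsub>N\<^esub> (c \<odot>\<^bsub>N\<^esub> \<iota> x) | c x. x \<in> carrier B} \<union>
        {\<iota> (x \<otimes>\<^bsub>B\<^esub> y) \<ominus>\<^bsub>N\<^esub> (\<iota> x \<otimes>\<^bsub>N\<^esub> \<iota> y) | x y. x \<in> carrier B \<and> y \<in> carrier B} \<union>
        {(h \<otimes>\<^bsub>N\<^esub> \<iota> a) \<ominus>\<^bsub>N\<^esub> \<iota> (d a) | a. a \<in> S})"

context
  fixes B :: "('k::field, 'b) module" and S d
  assumes B: "lie_algebra B" and S: "S \<subseteq> carrier B" and d: "d \<in> S \<rightarrow> carrier B"
begin

interpretation B: lie_algebra B by (rule B)

abbreviation (input) "HN \<equiv> free_nonassoc (hnn_gens B) :: ('k, 'b option magma \<Rightarrow> 'k) module"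

interpretation N: nonassoc_algebra HN ..

lemma hnn_gens_in: "b \<in> carrier B \<Longrightarrow> Some b \<in> hnn_gens B" "None \<in> hnn_gens B"
  by (auto simp: hnn_gens_def)

lemma hnn_polys_closed: "hnn_polys B S d \<subseteq> carrier HN"
proof -
  have g: "b \<in> carrier B \<Longrightarrow> (gen (Some b) :: _ \<Rightarrow> 'k) \<in> carrier HN" "(gen None :: _ \<Rightarrow> 'k) \<in> carrier HN" for b
    using hnn_gens_in by auto
  have Sd: "a \<in> S \<Longrightarrow> a \<in> carrier B \<and> d a \<in> carrier B" for a using S d by auto
  show ?thesis unfolding hnn_polys_def Let_def by (auto simp: g Sd simp del: gen_closed)
qed

lemma hnn_polys_hom:
  assumes "alg_hom HN L \<phi>" "lie_algebra L"
    and "\<And>x y. \<lbrakk>x \<in> carrier B; y \<in> carrier B\<rbrakk> \<Longrightarrow> \<phi> (gen (Some (x \<oplus>\<^bsub>B\<^esub> y))) = \<phi> (gen (Some x)) \<oplus>\<^bsub>L\<^esub> \<phi> (gen (Some y))"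
    and "\<And>c x. x \<in> carrier B \<Longrightarrow> \<phi> (gen (Some (c \<odot>\<^bsub>B\<^esub> x))) = c \<odot>\<^bsub>L\<^esub> \<phi> (gen (Some x))"
    and "\<And>x y. \<lbrakk>x \<in> carrier B; y \<in> carrier B\<rbrakk> \<Longrightarrow> \<phi> (gen (Some (x \<otimes>\<^bsub>B\<^esub> y))) = \<phi> (gen (Some x)) \<otimes>\<^bsub>L\<^esub> \<phi> (gen (Some y))"
    and "\<And>a. a \<in> S \<Longrightarrow> \<phi> (gen None) \<otimes>\<^bsub>L\<^esub> \<phi> (gen (Some a)) = \<phi> (gen (Some (d a)))"
    and "p \<in> hnn_polys B S d"
  shows "\<phi> p = \<zero>\<^bsub>L\<^esub>"
proof -
  interpret L: lie_algebra L by fact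
  note h = alg_homD[OF assms(1)]
  have g: "b \<in> carrier B \<Longrightarrow> (gen (Some b) :: _ \<Rightarrow> 'k) \<in> carrier HN" "(gen None :: _ \<Rightarrow> 'k) \<in> carrier HN" for b
    using hnn_gens_in by auto
  have \<phi>g: "b \<in> carrier B \<Longrightarrow> \<phi> (gen (Some b)) \<in> carrier L" "\<phi> (gen None) \<in> carrier L" for b
    using h(1) g by auto
  have df: "\<phi> (a \<ominus>\<^bsub>HN\<^esub> b) = \<zero>\<^bsub>L\<^esub>" if "a \<in> carrier HN" "b \<in> carrier HN" "\<phi> a = \<phi> b" for a b
    using that h(1) by (simp add: alg_hom_diff[OF assms(1) N.nonassoc_algebra_axioms L.nonassoc_algebra_axioms] L.diff_zero_iff)
  have Sd: "a \<in> S \<Longrightarrow> a \<in> carrier B \<and> d a \<in> carrier B" for a using S d by auto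
  from assms(7) show ?thesis
    unfolding hnn_polys_def Let_def
    by (elim UnE CollectE exE conjE) (use g Sd in \<open>auto intro!: df simp: h assms(3-6)\<close>)
qed

lemma image_Collect2:
  "(\<And>x y. P x y \<Longrightarrow> f (g x y) = h x y) \<Longrightarrow> f ` {g x y | x y. P x y} = {h x y | x y. P x y}"
proof -
  assume *: "\<And>x y. P x y \<Longrightarrow> f (g x y) = h x y"
  have "f ` {g x y | x y. P x y} = {f (g x y) | x y. P x y}" by blast
  also have "\<dots> = {h x y | x y. P x y}" by (rule Collect_cong) (metis *)
  finally show ?thesis .
qed

lemma image_Collect1:
  "(\<And>x. P x \<Longrightarrow> f (g x) = h x) \<Longrightarrow> f ` {g x | x. P x} = {h x | x. P x}"
  using image_Collect2[of "\<lambda>x _. P x" f "\<lambda>x _. g x" "\<lambda>x _. h x"] by simp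

lemma hnn_presents: "\<exists>\<pi>. presents (hnn_gens B) (hnn_polys B S d) (hnn_extension B S d) \<pi>"
proof -
  let ?X = "hnn_gens B" and ?F = "free_lie (hnn_gens B) :: ('k, ('k, 'b option) free_lie_elem) module"
  define cls where "cls f = lie_kernel ?X +>\<^bsub>HN\<^esub> f" for f :: "'b option magma \<Rightarrow> 'k"
  have k: "alg_ideal HN (lie_kernel ?X)" by (rule lie_kernel_ideal)
  have cls: "alg_hom HN ?F cls" unfolding free_lie_def cls_def[abs_def] by (rule alg_quot_hom[OF _ k]) simp
  have F: "nonassoc_algebra ?F" unfolding free_lie_def by (rule alg_quot_algebra[OF _ k]) simp
  have g: "free_lie_gen ?X y = cls (gen y)" for y
    by (simp add: free_lie_gen_def cls_def mon_def)
  note h = alg_homD[OF cls] alg_hom_diff[OF cls N.nonassoc_algebra_axioms F]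
  have gc: "b \<in> carrier B \<Longrightarrow> (gen (Some b) :: _ \<Rightarrow> 'k) \<in> carrier HN" "(gen None :: _ \<Rightarrow> 'k) \<in> carrier HN" for b
    using hnn_gens_in by auto
  have Sd: "a \<in> S \<Longrightarrow> a \<in> carrier B" "a \<in> S \<Longrightarrow> d a \<in> carrier B" for a using S d by auto
  have e1: "cls (gen (Some (x \<oplus>\<^bsub>B\<^esub> y)) \<ominus>\<^bsub>HN\<^esub> (gen (Some x) \<oplus>\<^bsub>HN\<^esub> gen (Some y)))
      = cls (gen (Some (x \<oplus>\<^bsub>B\<^esub> y))) \<ominus>\<^bsub>?F\<^esub> (cls (gen (Some x)) \<oplus>\<^bsub>?F\<^esub> cls (gen (Some y)))"
    if "x \<in> carrier B" "y \<in> carrier B" for x y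
    using gc that by (simp add: h)
  have e2: "cls (gen (Some (c \<odot>\<^bsub>B\<^esub> x)) \<ominus>\<^bsub>HN\<^esub> (c \<odot>\<^bsub>HN\<^esub> gen (Some x)))
      = cls (gen (Some (c \<odot>\<^bsub>B\<^esub> x))) \<ominus>\<^bsub>?F\<^esub> (c \<odot>\<^bsub>?F\<^esub> cls (gen (Some x)))"
    if "x \<in> carrier B" for c x
    using gc that by (simp add: h)
  have e3: "cls (gen (Some (x \<otimes>\<^bsub>B\<^esub> y)) \<ominus>\<^bsub>HN\<^esub> (gen (Some x) \<otimes>\<^bsub>HN\<^esub> gen (Some y)))
      = cls (gen (Some (x \<otimes>\<^bsub>B\<^esub> y))) \<ominus>\<^bsub>?F\<^esub> (cls (gen (Some x)) \<otimes>\<^bsub>?F\<^esub> cls (gen (Some y)))"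
    if "x \<in> carrier B" "y \<in> carrier B" for x y
    using gc that by (simp add: h)
  have e4: "cls ((gen None \<otimes>\<^bsub>HN\<^esub> gen (Some a)) \<ominus>\<^bsub>HN\<^esub> gen (Some (d a)))
      = (cls (gen None) \<otimes>\<^bsub>?F\<^esub> cls (gen (Some a))) \<ominus>\<^bsub>?F\<^esub> cls (gen (Some (d a)))"
    if "a \<in> S" for a
    using gc Sd[OF that] by (simp add: h)
  have "hnn_relators B S d = cls ` hnn_polys B S d"
    unfolding hnn_relators_def hnn_polys_def Let_def g image_Un
    by (intro arg_cong2[where f = "(\<union>)"] image_Collect2[symmetric] image_Collect1[symmetric])
      (simp_all only: e1 e2 e3 e4)
  then show ?thesis
    using presents_lie_presentation[OF hnn_polys_closed] unfolding hnn_extension_def cls_def[abs_def] by simp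
qed

text \<open>An HNN-extension is recognised by its universal property. The existence part is tested
  only on algebras of the type of \<open>hnn_extension\<close>, the uniqueness part only on
  endomorphisms of \<open>L\<close>: this is enough for two mutually inverse maps.\<close>

lemma hnn_lie_iso:
  fixes L :: "('k, 'c) module"
  assumes L: "lie_algebra L" and \<beta>: "alg_hom B L \<beta>" and \<tau>: "\<tau> \<in> carrier L"
    and rel: "\<And>s. s \<in> S \<Longrightarrow> \<tau> \<otimes>\<^bsub>L\<^esub> \<beta> s = \<beta> (d s)"
    and universal: "\<And>(H :: ('k, ('k, 'b option) free_lie_elem set) module) \<eta> \<theta>.
      \<lbrakk>lie_algebra H; alg_hom B H \<eta>; \<theta> \<in> carrier H; \<And>s. s \<in> S \<Longrightarrow> \<theta> \<otimes>\<^bsub>H\<^esub> \<eta> s = \<eta> (d s)\<rbrakk>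
      \<Longrightarrow> \<exists>\<Phi>. alg_hom L H \<Phi> \<and> (\<forall>b\<in>carrier B. \<Phi> (\<beta> b) = \<eta> b) \<and> \<Phi> \<tau> = \<theta>"
    and generated: "\<And>\<Phi> l. \<lbrakk>alg_hom L L \<Phi>; \<And>b. b \<in> carrier B \<Longrightarrow> \<Phi> (\<beta> b) = \<beta> b; \<Phi> \<tau> = \<tau>; l \<in> carrier L\<rbrakk>
      \<Longrightarrow> \<Phi> l = l"
  shows "lie_iso (hnn_extension B S d) L"
proof -
  let ?H = "hnn_extension B S d"
  interpret L: lie_algebra L by fact
  obtain \<pi> where \<pi>: "presents (hnn_gens B) (hnn_polys B S d) ?H \<pi>" using hnn_presents by blast
  interpret H: lie_algebra ?H by (rule presentsD(1)[OF \<pi>])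
  note h = alg_homD[OF presentsD(4)[OF \<pi>]]
  have gc: "b \<in> carrier B \<Longrightarrow> (gen (Some b) :: _ \<Rightarrow> 'k) \<in> carrier HN" "(gen None :: _ \<Rightarrow> 'k) \<in> carrier HN" for b
    using hnn_gens_in by auto
  define \<eta> where "\<eta> b = \<pi> (gen (Some b))" for b
  define \<theta> where "\<theta> = \<pi> (gen None)"
  have eq: "\<pi> a = \<pi> b" if "a \<ominus>\<^bsub>HN\<^esub> b \<in> hnn_polys B S d" "a \<in> carrier HN" "b \<in> carrier HN" for a b
  proof -
    have "\<pi> a \<ominus>\<^bsub>?H\<^esub> \<pi> b = \<zero>\<^bsub>?H\<^esub>"
      using presentsD(6)[OF \<pi> that(1)] that(2,3)
      by (simp add: alg_hom_diff[OF presentsD(4)[OF \<pi>] N.nonassoc_algebra_axioms H.nonassoc_algebra_axioms])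
    then show ?thesis using that h(1) by (simp add: H.diff_zero_iff)
  qed
  have \<eta>: "alg_hom B ?H \<eta>"
  proof (rule alg_homI)
    fix x y c assume x: "x \<in> carrier B"
    show "\<eta> x \<in> carrier ?H" using x gc h(1) by (simp add: \<eta>_def)
    have "\<pi> (gen (Some (c \<odot>\<^bsub>B\<^esub> x))) = \<pi> (c \<odot>\<^bsub>HN\<^esub> gen (Some x))"
      by (rule eq) (use x gc in \<open>auto simp: hnn_polys_def Let_def\<close>)
    then show "\<eta> (c \<odot>\<^bsub>B\<^esub> x) = c \<odot>\<^bsub>?H\<^esub> \<eta> x" using x gc by (simp add: h \<eta>_def)
    assume y: "y \<in> carrier B"
    have "\<pi> (gen (Some (x \<oplus>\<^bsub>B\<^esub> y))) = \<pi> (gen (Some x) \<oplus>\<^bsub>HN\<^esub> gen (Some y))"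
      by (rule eq) (use x y gc in \<open>auto simp: hnn_polys_def Let_def\<close>)
    then show "\<eta> (x \<oplus>\<^bsub>B\<^esub> y) = \<eta> x \<oplus>\<^bsub>?H\<^esub> \<eta> y" using x y gc by (simp add: h \<eta>_def)
    have "\<pi> (gen (Some (x \<otimes>\<^bsub>B\<^esub> y))) = \<pi> (gen (Some x) \<otimes>\<^bsub>HN\<^esub> gen (Some y))"
      by (rule eq) (use x y gc in \<open>auto simp: hnn_polys_def Let_def\<close>)
    then show "\<eta> (x \<otimes>\<^bsub>B\<^esub> y) = \<eta> x \<otimes>\<^bsub>?H\<^esub> \<eta> y" using x y gc by (simp add: h \<eta>_def)
  qed
  have \<theta>: "\<theta> \<in> carrier ?H" using gc h(1) by (simp add: \<theta>_def)
  have "\<theta> \<otimes>\<^bsub>?H\<^esub> \<eta> s = \<eta> (d s)" if s: "s \<in> S" for s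
  proof -
    have sc: "s \<in> carrier B" "d s \<in> carrier B" using s S d by auto
    have "\<pi> (gen None \<otimes>\<^bsub>HN\<^esub> gen (Some s)) = \<pi> (gen (Some (d s)))"
      by (rule eq) (use s sc gc in \<open>auto simp: hnn_polys_def Let_def\<close>)
    then show ?thesis using sc gc by (simp add: h \<eta>_def \<theta>_def)
  qed
  from universal[OF H.lie_algebra_axioms \<eta> \<theta> this] obtain \<Phi> where
    \<Phi>: "alg_hom L ?H \<Phi>" "\<And>b. b \<in> carrier B \<Longrightarrow> \<Phi> (\<beta> b) = \<eta> b" "\<Phi> \<tau> = \<theta>" by blast
  define \<phi> where "\<phi> = case_option \<tau> \<beta>"
  have \<phi>: "\<phi> \<in> hnn_gens B \<rightarrow> carrier L" using \<tau> alg_homD(1)[OF \<beta>] by (auto simp: \<phi>_def hnn_gens_def)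
  have \<phi>g: "b \<in> carrier B \<Longrightarrow> ev L \<phi> (gen (Some b)) = \<beta> b" "ev L \<phi> (gen None) = \<tau>" for b
    using L.ev_gen[OF \<phi>] hnn_gens_in by (auto simp: \<phi>_def)
  have "ev L \<phi> p = \<zero>\<^bsub>L\<^esub>" if "p \<in> hnn_polys B S d" for p
    by (rule hnn_polys_hom[OF L.ev_hom[OF \<phi>] L _ _ _ _ that])
      (use rel alg_homD[OF \<beta>] S d in \<open>auto simp: \<phi>g subset_iff Pi_iff\<close>)
  from presents_lift[OF \<pi> L \<phi> this] obtain \<Psi> where
    \<Psi>: "alg_hom ?H L \<Psi>" "\<And>f. f \<in> carrier HN \<Longrightarrow> \<Psi> (\<pi> f) = ev L \<phi> f" by blast
  have \<Psi>g: "b \<in> carrier B \<Longrightarrow> \<Psi> (\<eta> b) = \<beta> b" "\<Psi> \<theta> = \<tau>" for b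
    using \<Psi>(2) gc \<phi>g by (auto simp: \<eta>_def \<theta>_def)
  show ?thesis
  proof (rule mutually_inverse_lie_iso[OF \<Psi>(1) \<Phi>(1)])
    show "\<Phi> (\<Psi> x) = x" if x: "x \<in> carrier ?H" for x
    proof (rule presents_hom_eq[OF \<pi> H.nonassoc_algebra_axioms alg_hom_comp[OF \<Psi>(1) \<Phi>(1)] alg_hom_id _ x])
      show "\<Phi> (\<Psi> (\<pi> (gen y))) = \<pi> (gen y)" if "y \<in> hnn_gens B" for y
        using that \<Psi>g \<Phi>(2,3) by (auto simp: hnn_gens_def \<eta>_def \<theta>_def)
    qed
    show "\<Psi> (\<Phi> l) = l" if "l \<in> carrier L" for l
      by (rule generated[OF alg_hom_comp[OF \<Phi>(1) \<Psi>(1)] _ _ that]) (auto simp: \<Phi>(2,3) \<Psi>g)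
  qed
qed

end

section \<open>The elimination step as an HNN-extension\<close>

lemma lie_algebra_nonassoc: "lie_algebra L \<Longrightarrow> nonassoc_algebra L"
  by (simp add: lie_algebra_iff)

lemma hom_lazard:
  assumes "alg_hom L H \<Phi>" "nonassoc_algebra L" "\<And>x. a x \<in> carrier L"
  shows "\<Phi> (lazard L a t z) = lazard H (\<lambda>x. \<Phi> (a x)) t z"
proof -
  interpret nonassoc_algebra L by fact
  have "((\<lambda>x. a t \<otimes>\<^bsub>L\<^esub> x) ^^ i) (a y) \<in> carrier L \<and>
    \<Phi> (((\<lambda>x. a t \<otimes>\<^bsub>L\<^esub> x) ^^ i) (a y)) = ((\<lambda>x. \<Phi> (a t) \<otimes>\<^bsub>H\<^esub> x) ^^ i) (\<Phi> (a y))" for i y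
    by (induction i) (auto simp: assms alg_homD(4)[OF assms(1)])
  then show ?thesis by (simp add: lazard_def split: prod.split)
qed

text \<open>The Freiheitssatz: \<open>g\<close> acts as zero under \<open>\<rho>\<close>, so
  \<open>\<rho>\<close> is a representation of \<open>B\<close>; a relation in \<open>B\<close>
  among letters other than \<open>x\<close> then holds in \<open>\<rho>\<close>, and faithfulness
  makes it trivial.\<close>

lemma solvable_kernel:
  fixes B :: "('k::field, 'a) module"
  assumes "presents V {g} B \<pi>" "solvable g x" "f \<in> polys (V - {x})" "\<pi> f = \<zero>\<^bsub>B\<^esub>"
  shows "f \<in> lie_kernel (V - {x})"
proof -
  obtain \<rho> :: "nat \<Rightarrow> (nat \<Rightarrow> 'k) \<Rightarrow> nat \<Rightarrow> 'k"
    where \<rho>: "\<And>y. linop (\<rho> y)" "ev gl \<rho> g = (\<lambda>m i. 0)" "faithful \<rho> (UNIV - {x})"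
    using assms(2) by (auto simp: solvable_def)
  have fV: "f \<in> polys V" by (rule free_nonassoc_mono[OF _ assms(3)]) auto
  then have fV': "f \<in> pres_ideal V {g}" using presentsD(7)[OF assms(1)] assms(4) by simp
  have "ev gl \<rho> f = \<zero>\<^bsub>gl\<^esub>"
  proof (rule hom_pres_ideal[where \<phi> = "ev gl \<rho>" and X = V and R = "{g}"])
    show "alg_hom (free_nonassoc V) gl (ev gl \<rho>)" by (rule gl_ev_hom[OF \<rho>(1)])
    show "ev gl \<rho> p = \<zero>\<^bsub>gl\<^esub>" if "p \<in> {g}" for p using that \<rho>(2) by (simp add: gl_simps)
  qed (use presentsD(3)[OF assms(1)] fV' in \<open>auto simp: gl_lie_algebra\<close>)
  moreover have "f \<in> polys (UNIV - {x})" by (rule free_nonassoc_mono[OF _ assms(3)]) auto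
  ultimately have "f \<in> lie_kernel UNIV" using \<rho>(3) by (simp add: faithful_def gl_simps)
  then show ?thesis by (rule lie_kernel_retract[OF assms(3) _ subset_UNIV])
qed

lemma dual_fst: "nonassoc_algebra B \<Longrightarrow> alg_hom (dual B) B fst"
  by (rule alg_homI) (auto simp: dual_simps)

lemma dual_map:
  assumes "alg_hom B L \<beta>" "nonassoc_algebra B"
  shows "alg_hom (dual B) (dual L) (\<lambda>x. (\<beta> (fst x), \<beta> (snd x)))"
proof -
  interpret nonassoc_algebra B by fact
  show ?thesis by (rule alg_homI) (auto simp: dual_simps alg_homD[OF assms(1)])
qed

text \<open>The inner derivation by \<open>\<tau>\<close> as a homomorphism into the dual numbers;
  comparing it with another derivation thereby reduces to comparing homomorphisms on
  generators.\<close>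

lemma dual_ad:
  assumes "alg_hom N L \<phi>" "lie_algebra L" "\<tau> \<in> carrier L"
  shows "alg_hom N (dual L) (\<lambda>f. (\<phi> f, \<tau> \<otimes>\<^bsub>L\<^esub> \<phi> f))"
proof -
  interpret lie_algebra L by fact
  show ?thesis
    by (rule alg_homI)
      (use alg_homD[OF assms(1)] assms(3) bracket_leibniz[OF assms(3)] a_comm in
        \<open>auto simp: dual_simps bracket_add_right bracket_smult_right\<close>)
qed

lemma hnn_step:
  fixes L B :: "('k::field, 'a) module" and j :: "nat \<Rightarrow> 'a"
  assumes L: "presents X {r} L \<pi>" and X: "t \<in> X" "x \<in> X" "x \<noteq> t"
    and r: "r \<doteq> lazard_subst t g"
    and V: "V = {prod_encode (y, i) | y i. y \<in> X - {t} \<and> (y = x \<longrightarrow> i \<le> n)}"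
    and B: "presents V {g} B \<pi>B" and sol: "solvable g (prod_encode (x, n))" and j: "inj j"
  shows "\<exists>S d. lie_subalgebra B S \<and> lie_derivation B S d \<and> lie_iso (hnn_extension B S d) L \<and>
    is_free_lie (B\<lparr>carrier := S\<rparr>)"
proof -
  interpret L: lie_algebra L by (rule presentsD(1)[OF L])
  interpret B: lie_algebra B by (rule presentsD(1)[OF B])
  define z0 where "z0 = prod_encode (x, n)"
  define W where "W = V - {z0}"
  have WV: "W \<subseteq> V" by (auto simp: W_def)
  have V_iff: "prod_encode (y, i) \<in> V \<longleftrightarrow> y \<in> X \<and> y \<noteq> t \<and> (y = x \<longrightarrow> i \<le> n)" for y i
    by (auto simp: V)
  \<comment> \<open>The letter \<open>z0\<close> removed from \<open>V\<close> is the only one whose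
    successor leaves \<open>V\<close>.\<close>
  have succ: "succ_letter z \<in> V" if "z \<in> W" for z
    using that by (auto simp: W_def V z0_def le_Suc_eq)
  have pred: "prod_encode (y, i) \<in> W" if "prod_encode (y, Suc i) \<in> V" for y i
    using that by (auto simp: W_def V_iff z0_def)
  have V_elim: "V \<subseteq> elim_letters t UNIV" by (auto simp: V)
  define b where "b z = \<pi>B (gen z)" for z
  have b: "b z \<in> carrier B" if "z \<in> V" for z
    using that alg_homD(1)[OF presentsD(4)[OF B]] by (simp add: b_def)

  define S where "S = \<pi>B ` polys W"
  let ?S = "B\<lparr>carrier := S\<rparr>"
  have \<pi>W: "alg_hom (free_nonassoc W) B \<pi>B" by (rule alg_hom_restrict[OF presentsD(4)[OF B] WV])
  have sub: "lie_subalgebra B S"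
    unfolding S_def by (rule lie_subalgebra_image[OF \<pi>W]) (auto intro: B.nonassoc_algebra_axioms)
  note SD = lie_subalgebraD[OF B.nonassoc_algebra_axioms sub]
  have presS: "presents W {} ?S \<pi>B"
  proof (rule presentsI)
    show "lie_algebra ?S" by (rule lie_subalgebra_lie_algebra[OF B.lie_algebra_axioms sub])
    show "alg_hom (free_nonassoc W) ?S \<pi>B"
      by (rule alg_homI) (auto simp: alg_homD[OF \<pi>W] S_def)
    show "f \<in> pres_ideal W {}" if "f \<in> polys W" "\<pi>B f = \<zero>\<^bsub>?S\<^esub>" for f
      using solvable_kernel[OF B sol, of f] that by (simp add: W_def z0_def lie_kernel_eq)
  qed (auto simp: S_def)
  have free: "is_free_lie ?S"
    by (rule is_free_lieI[OF presS inj_on_subset[OF j subset_UNIV]])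

  \<comment> \<open>\<open>S\<close> is free on the letters of \<open>W\<close>, so these pairs
    determine a homomorphism into the dual numbers, whose second component is the derivation
    sought.\<close>
  define e where "e z = (b z, b (succ_letter z))" for z
  have e: "e \<in> W \<rightarrow> carrier (dual B)" using b succ WV by (auto simp: e_def dual_simps)
  note dB = dual_lie_algebra[OF B.lie_algebra_axioms]
  interpret dB: lie_algebra "dual B" by (rule dB)
  obtain E where E: "alg_hom ?S (dual B) E"
    "\<And>f. f \<in> polys W \<Longrightarrow> E (\<pi>B f) = ev (dual B) e f"
    using presents_lift[OF presS dB e] by auto
  define d where "d s = snd (E s)" for s
  have Eg: "E (b z) = e z" if "z \<in> W" for z
    using E(2)[of "gen z"] that dB.ev_gen[OF e that] by (simp add: b_def)
  have Efst: "fst (E s) = s" if s: "s \<in> S" for s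
  proof (rule presents_hom_eq[OF presS B.nonassoc_algebra_axioms
      alg_hom_comp[OF E(1) dual_fst[OF B.nonassoc_algebra_axioms]], where \<Psi> = "\<lambda>s. s"])
    show "alg_hom ?S B (\<lambda>s. s)" by (rule alg_homI) (use SD(1) in auto)
    show "fst (E (\<pi>B (gen z))) = \<pi>B (gen z)" if "z \<in> W" for z
      using Eg[OF that] by (simp add: b_def e_def)
  qed (simp add: s)
  have Epair: "E s = (s, d s)" if "s \<in> S" for s using Efst[OF that] by (simp add: d_def prod_eq_iff)
  have dS: "d \<in> S \<rightarrow> carrier B"
    using alg_homD(1)[OF E(1)] by (auto simp: d_def dual_simps mem_Times_iff)
  have der: "lie_derivation B S d"
    unfolding lie_derivation_def
  proof (intro conjI ballI allI)
    fix s u c assume s: "s \<in> S"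
    show "d (c \<odot>\<^bsub>B\<^esub> s) = c \<odot>\<^bsub>B\<^esub> d s"
      using alg_homD(3)[OF E(1), of s c] s SD(4)[OF s, of c] by (simp add: Epair dual_simps)
    assume u: "u \<in> S"
    show "d (s \<oplus>\<^bsub>B\<^esub> u) = d s \<oplus>\<^bsub>B\<^esub> d u"
      using alg_homD(2)[OF E(1), of s u] s u SD(3)[OF s u] by (simp add: Epair dual_simps)
    show "d (s \<otimes>\<^bsub>B\<^esub> u) = s \<otimes>\<^bsub>B\<^esub> d u \<oplus>\<^bsub>B\<^esub> d s \<otimes>\<^bsub>B\<^esub> u"
      using alg_homD(4)[OF E(1), of s u] s u SD(5)[OF s u] by (simp add: Epair dual_simps)
  qed (rule dS)
  have bS: "b z \<in> S" and db: "d (b z) = b (succ_letter z)" if "z \<in> W" for z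
    using that Eg[OF that] by (auto simp: S_def b_def d_def e_def)

  \<comment> \<open>The default zero makes the assignment total, because \<open>\<doteq>\<close> is
    evaluated below over the alphabet \<open>UNIV\<close>.\<close>
  define a where "a y = (if y \<in> X then \<pi> (gen y) else \<zero>\<^bsub>L\<^esub>)" for y
  have a: "a y \<in> carrier L" for y using alg_homD(1)[OF presentsD(4)[OF L]] by (simp add: a_def)
  then have aU: "a \<in> UNIV \<rightarrow> carrier L" by auto
  have \<pi>a: "\<pi> f = ev L a f" if "f \<in> polys X" for f
    by (rule ev_unique[OF presentsD(4)[OF L] L.nonassoc_algebra_axioms _ that]) (simp add: a_def)
  have gV: "g \<in> polys V" using presentsD(3)[OF B] by simp
  have gU: "g \<in> polys UNIV" by (rule free_nonassoc_mono[OF subset_UNIV gV])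
  have rX: "r \<in> polys X" using presentsD(3)[OF L] by simp
  have rU: "r \<in> polys UNIV" by (rule free_nonassoc_mono[OF subset_UNIV rX])
  have \<Lambda>g: "lazard_subst t g \<in> polys UNIV"
    by (rule lazard_subst_closed[OF free_nonassoc_mono[OF V_elim gV]]) auto
  have lift_r: "ev H \<phi> r = ev H (lazard H \<phi> t) g"
    if "lie_algebra H" "\<phi> \<in> UNIV \<rightarrow> carrier H" for H :: "('k, 'h) module" and \<phi>
  proof -
    have H: "nonassoc_algebra H" by (rule lie_algebra_nonassoc[OF that(1)])
    show ?thesis
      using lie_equiv_ev[OF r rU \<Lambda>g that] lazard_ev[OF H that(2) gU] by simp
  qed
  let ?l = "lazard L a t"
  have l: "?l \<in> V \<rightarrow> carrier L"
    using lazard_closed[OF L.nonassoc_algebra_axioms, of a t UNIV] a V_elim by auto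
  have "ev L a r = \<zero>\<^bsub>L\<^esub>" using presentsD(6)[OF L, of r] \<pi>a[OF rX] by simp
  then have "ev L ?l g = \<zero>\<^bsub>L\<^esub>"
    using lie_equiv_ev[OF r rU \<Lambda>g L.lie_algebra_axioms aU] lazard_ev[OF L.nonassoc_algebra_axioms aU gU, of t]
    by simp
  then obtain \<beta> where \<beta>: "alg_hom B L \<beta>"
    "\<And>f. f \<in> polys V \<Longrightarrow> \<beta> (\<pi>B f) = ev L ?l f"
    using presents_lift[OF B L.lie_algebra_axioms l] by auto
  have \<beta>b: "\<beta> (b z) = ?l z" if "z \<in> V" for z
    using \<beta>(2)[of "gen z"] that L.ev_gen[OF l that] by (simp add: b_def)
  have rel: "a t \<otimes>\<^bsub>L\<^esub> \<beta> s = \<beta> (d s)" if s: "s \<in> S" for s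
  proof -
    have \<beta>S: "alg_hom ?S L \<beta>"
      using alg_homD[OF \<beta>(1)] SD(1) by (intro alg_homI) (simp_all add: subset_iff)
    \<comment> \<open>Both sides are homomorphisms from \<open>?S\<close> into the dual numbers over
      \<open>L\<close>, so agreement on the letters of \<open>W\<close> suffices; there it is the
      recursion for \<open>ad(t)^i y\<close>.\<close>
    have "(\<beta> s, a t \<otimes>\<^bsub>L\<^esub> \<beta> s) = (\<beta> (fst (E s)), \<beta> (snd (E s)))"
    proof (rule presents_hom_eq[OF presS _ dual_ad[OF \<beta>S L.lie_algebra_axioms a]
          alg_hom_comp[OF E(1) dual_map[OF \<beta>(1) B.nonassoc_algebra_axioms]]])
      show "nonassoc_algebra (dual L)" by (rule lie_algebra_nonassoc[OF dual_lie_algebra[OF L.lie_algebra_axioms]])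
      show "(\<beta> (\<pi>B (gen z)), a t \<otimes>\<^bsub>L\<^esub> \<beta> (\<pi>B (gen z))) = (\<beta> (fst (E (\<pi>B (gen z)))), \<beta> (snd (E (\<pi>B (gen z)))))"
        if z: "z \<in> W" for z
        using Eg[OF z] \<beta>b[of z] \<beta>b[OF succ[OF z]] z WV
        by (auto simp: b_def[symmetric] e_def lazard_succ)
    qed (simp add: s)
    then show ?thesis unfolding d_def by (metis prod.inject)
  qed
  have "lie_iso (hnn_extension B S d) L"
  proof (rule hnn_lie_iso[where \<beta> = \<beta> and \<tau> = "a t", OF B.lie_algebra_axioms SD(1) dS L.lie_algebra_axioms \<beta>(1) a rel])
    fix H :: "('k, ('k, 'a option) free_lie_elem set) module" and \<eta> \<theta>
    assume H: "lie_algebra H" and \<eta>: "alg_hom B H \<eta>" and \<theta>: "\<theta> \<in> carrier H"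
      and st: "\<And>s. s \<in> S \<Longrightarrow> \<theta> \<otimes>\<^bsub>H\<^esub> \<eta> s = \<eta> (d s)"
    interpret H: lie_algebra H by fact
    define \<phi> where "\<phi> y = (if y = t then \<theta> else if y \<in> X then \<eta> (b (prod_encode (y, 0))) else \<zero>\<^bsub>H\<^esub>)" for y
    have \<phi>: "\<phi> y \<in> carrier H" for y
      using \<theta> alg_homD(1)[OF \<eta>] b by (simp add: \<phi>_def V_iff)
    \<comment> \<open>The stable letter relations in \<open>H\<close> force the iterated brackets
      with \<open>\<theta>\<close> to be the images of the letters of \<open>B\<close>; each step
      starts at a letter of \<open>W\<close> by \<open>pred\<close>.\<close>
    have laz: "lazard H \<phi> t (prod_encode (y, i)) = \<eta> (b (prod_encode (y, i)))" if "prod_encode (y, i) \<in> V" for y i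
      using that
    proof (induction i)
      case 0
      then show ?case by (simp add: \<phi>_def V_iff)
    next
      case (Suc i)
      have w: "prod_encode (y, i) \<in> W" by (rule pred[OF Suc.prems])
      have "lazard H \<phi> t (prod_encode (y, Suc i)) = \<theta> \<otimes>\<^bsub>H\<^esub> lazard H \<phi> t (prod_encode (y, i))"
        by (simp add: \<phi>_def)
      also have "\<dots> = \<eta> (d (b (prod_encode (y, i))))" using Suc.IH w WV st[OF bS[OF w]] by auto
      finally show ?case using db[OF w] by simp
    qed
    have laz: "lazard H \<phi> t z = \<eta> (b z)" if "z \<in> V" for z
      using laz[of "fst (prod_decode z)" "snd (prod_decode z)"] that by (simp del: lazard_encode)
    have bV: "b \<in> V \<rightarrow> carrier B" using b by auto
    have H1: "ev H \<phi> r = ev H (lazard H \<phi> t) g" by (rule lift_r) (use H \<phi> in auto)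
    also have "\<dots> = ev H (\<lambda>z. \<eta> (b z)) g"
      by (rule ev_cong[OF gV H.nonassoc_algebra_axioms]) (use laz b alg_homD(1)[OF \<eta>] in auto)
    also have "\<dots> = \<eta> (ev B b g)"
      by (rule hom_ev[OF \<eta> B.nonassoc_algebra_axioms H.nonassoc_algebra_axioms bV gV, symmetric])
    also have "ev B b g = \<pi>B g" using presents_ev[OF B gV] by (simp add: b_def[abs_def])
    also have "\<eta> (\<pi>B g) = \<zero>\<^bsub>H\<^esub>"
      using presentsD(6)[OF B, of g] alg_hom_zero[OF \<eta> B.nonassoc_algebra_axioms H.nonassoc_algebra_axioms] by simp
    finally have r0: "ev H \<phi> r = \<zero>\<^bsub>H\<^esub>" .
    have \<phi>X: "\<phi> \<in> X \<rightarrow> carrier H" using \<phi> by auto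
    obtain \<Phi> where \<Phi>: "alg_hom L H \<Phi>" "\<And>f. f \<in> polys X \<Longrightarrow> \<Phi> (\<pi> f) = ev H \<phi> f"
      using presents_lift[OF L H \<phi>X] r0 by auto
    have \<Phi>a: "\<Phi> (a y) = \<phi> y" for y
    proof (cases "y \<in> X")
      case True
      then show ?thesis using \<Phi>(2)[of "gen y"] H.ev_gen[OF \<phi>X] by (simp add: a_def)
    next
      case False
      then show ?thesis
        using alg_hom_zero[OF \<Phi>(1) L.nonassoc_algebra_axioms H.nonassoc_algebra_axioms] X(1)
        by (auto simp: a_def \<phi>_def)
    qed
    have "\<Phi> (\<beta> c) = \<eta> c" if c: "c \<in> carrier B" for c
    proof (rule presents_hom_eq[OF B H.nonassoc_algebra_axioms alg_hom_comp[OF \<beta>(1) \<Phi>(1)] \<eta> _ c])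
      show "\<Phi> (\<beta> (\<pi>B (gen z))) = \<eta> (\<pi>B (gen z))" if z: "z \<in> V" for z
        using hom_lazard[OF \<Phi>(1) L.nonassoc_algebra_axioms a, where t = t and z = z] laz[OF z] \<beta>b[OF z]
        by (simp add: \<Phi>a b_def)
    qed
    moreover have "\<Phi> (a t) = \<theta>" by (simp add: \<Phi>a \<phi>_def)
    ultimately show "\<exists>\<Phi>. alg_hom L H \<Phi> \<and> (\<forall>b\<in>carrier B. \<Phi> (\<beta> b) = \<eta> b) \<and> \<Phi> (a t) = \<theta>"
      using \<Phi>(1) by blast
  next
    fix \<Phi> l assume \<Phi>: "alg_hom L L \<Phi>" "\<And>c. c \<in> carrier B \<Longrightarrow> \<Phi> (\<beta> c) = \<beta> c" "\<Phi> (a t) = a t"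
      and l: "l \<in> carrier L"
    show "\<Phi> l = l"
    proof (rule presents_hom_eq[OF L L.nonassoc_algebra_axioms \<Phi>(1) alg_hom_id _ l])
      fix y assume y: "y \<in> X"
      show "\<Phi> (\<pi> (gen y)) = \<pi> (gen y)"
      proof (cases "y = t")
        case True
        then show ?thesis using \<Phi>(3) y by (simp add: a_def)
      next
        case False
        then have v: "prod_encode (y, 0) \<in> V" using y by (simp add: V_iff)
        have "\<pi> (gen y) = \<beta> (b (prod_encode (y, 0)))" using \<beta>b[OF v] y by (simp add: a_def)
        then show ?thesis using \<Phi>(2)[OF b[OF v]] by simp
      qed
    qed
  qed
  then show ?thesis using sub der free by blast
qed

section \<open>The case of a linear relator\<close>

lemma lie_equiv_sym: "f \<doteq> g \<Longrightarrow> g \<doteq> f"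
  using alg_idealD(4)[OF free_nonassoc_algebra lie_kernel_ideal, of "\<lambda>m. f m - g m" UNIV "- 1"]
  by (simp add: lie_equiv_def free_nonassoc_simps)

lemma lie_equiv_trans: "f \<doteq> g \<Longrightarrow> g \<doteq> h \<Longrightarrow> f \<doteq> h"
  using alg_idealD(3)[OF free_nonassoc_algebra lie_kernel_ideal, of "\<lambda>m. f m - g m" UNIV "\<lambda>m. g m - h m"]
  by (simp add: lie_equiv_def free_nonassoc_simps)

text \<open>A Tietze move. The substitution \<open>\<theta>\<close> of \<open>- l0 / c\<close> for
  \<open>x\<close> fixes the other letters, does not change values under \<open>\<pi>\<close>, and
  sends \<open>r\<close> into the Lie kernel; so it carries relations of \<open>L\<close> to Lie
  identities.\<close>

lemma presents_linear_free:
  fixes l :: "nat magma \<Rightarrow> 'k::field"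
  assumes L: "presents X {r} L \<pi>" and r: "r \<doteq> l" and l: "l \<in> polys X"
    and lin: "\<And>m. l m \<noteq> 0 \<Longrightarrow> \<exists>p. m = Gen p" and x: "x \<in> X" "l (Gen x) \<noteq> 0"
  shows "presents (X - {x}) {} L \<pi>"
proof -
  let ?N = "free_nonassoc X :: ('k, nat magma \<Rightarrow> 'k) module"
    and ?M = "free_nonassoc (X - {x}) :: ('k, nat magma \<Rightarrow> 'k) module"
  interpret L: lie_algebra L by (rule presentsD(1)[OF L])
  interpret N: nonassoc_algebra ?N ..
  interpret M: nonassoc_algebra ?M ..
  define c where "c = l (Gen x)"
  define l0 where "l0 = l(Gen x := 0)"
  have l0: "l0 \<in> carrier ?M"
  proof -
    have "{m. l0 m \<noteq> 0} \<subseteq> {m. l m \<noteq> 0}" by (auto simp: l0_def)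
    then have "finite {m. l0 m \<noteq> 0}" using l finite_subset by (auto simp: free_nonassoc_simps)
    moreover have "set_magma m \<subseteq> X - {x}" if m: "l0 m \<noteq> 0" for m
    proof -
      have "l m \<noteq> 0" "m \<noteq> Gen x" using m by (auto simp: l0_def split: if_splits)
      then show ?thesis using lin[of m] l by (auto simp: free_nonassoc_simps)
    qed
    ultimately show ?thesis by (simp add: free_nonassoc_simps)
  qed
  have l0N: "l0 \<in> carrier ?N" by (rule free_nonassoc_mono[OF _ l0]) auto
  have xN: "(gen x :: _ \<Rightarrow> 'k) \<in> carrier ?N" using x by simp
  have l_eq: "l = c \<odot>\<^bsub>?N\<^esub> gen x \<oplus>\<^bsub>?N\<^esub> l0"
    by (auto simp: free_nonassoc_simps c_def l0_def mon_def)
  have rN: "r \<in> carrier ?N" using presentsD(3)[OF L] by simp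
  define \<phi> where "\<phi> y = (if y = x then (- inverse c) \<odot>\<^bsub>?M\<^esub> l0 else gen y)" for y
  have \<phi>: "\<phi> \<in> X \<rightarrow> carrier ?M" using l0 by (auto simp: \<phi>_def)
  define \<theta> where "\<theta> = ev ?M \<phi>"
  have \<theta>: "alg_hom ?N ?M \<theta>" unfolding \<theta>_def by (rule M.ev_hom[OF \<phi>])
  note \<pi> = presentsD(4)[OF L]
  have MN: "alg_hom ?M L \<pi>" by (rule alg_hom_restrict[OF \<pi>]) auto
  have \<pi>l: "\<pi> l = \<zero>\<^bsub>L\<^esub>"
  proof -
    have g: "(\<lambda>x. \<pi> (gen x)) \<in> X \<rightarrow> carrier L" using alg_homD(1)[OF \<pi>] by auto
    have "\<pi> l = \<pi> r"
      using lie_equiv_ev[OF r rN l L.lie_algebra_axioms g] presents_ev[OF L rN] presents_ev[OF L l] by simp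
    then show ?thesis using presentsD(6)[OF L] by simp
  qed
  have cin: "\<pi> (gen x) \<in> carrier L" "\<pi> l0 \<in> carrier L" using alg_homD(1)[OF \<pi>] xN l0N by auto
  have \<pi>x: "\<pi> ((- inverse c) \<odot>\<^bsub>?M\<^esub> l0) = \<pi> (gen x)"
  proof -
    have "c \<odot>\<^bsub>L\<^esub> \<pi> (gen x) \<oplus>\<^bsub>L\<^esub> \<pi> l0 = \<zero>\<^bsub>L\<^esub>"
      using \<pi>l xN l0N unfolding l_eq by (simp add: alg_homD(2,3)[OF \<pi>])
    then have "inverse c \<odot>\<^bsub>L\<^esub> (c \<odot>\<^bsub>L\<^esub> \<pi> (gen x) \<oplus>\<^bsub>L\<^esub> \<pi> l0) = \<zero>\<^bsub>L\<^esub>" by simp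
    then have "\<pi> (gen x) \<oplus>\<^bsub>L\<^esub> inverse c \<odot>\<^bsub>L\<^esub> \<pi> l0 = \<zero>\<^bsub>L\<^esub>"
      using cin x(2) by (simp add: L.smult_add_right L.smult_smult c_def)
    then have "\<pi> (gen x) = \<ominus>\<^bsub>L\<^esub> (inverse c \<odot>\<^bsub>L\<^esub> \<pi> l0)"
      using cin L.minus_equality[of "\<pi> (gen x)" "inverse c \<odot>\<^bsub>L\<^esub> \<pi> l0"] by simp
    then show ?thesis
      using cin l0 alg_homD(3)[OF MN l0] by (simp add: L.minus_conv L.smult_smult)
  qed
  have \<pi>\<theta>: "\<pi> (\<theta> f) = \<pi> f" if "f \<in> carrier ?N" for f
  proof (rule free_nonassoc_hom_eq[OF alg_hom_comp[OF \<theta> MN] \<pi> L.nonassoc_algebra_axioms _ that])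
    show "\<pi> (\<theta> (gen y)) = \<pi> (gen y)" if "y \<in> X" for y
      using M.ev_gen[OF \<phi> that] \<pi>x by (simp add: \<theta>_def \<phi>_def)
  qed
  have \<theta>id: "\<theta> f = f" if "f \<in> carrier ?M" for f
  proof (rule free_nonassoc_hom_eq[OF alg_hom_restrict[OF \<theta>] alg_hom_id _ _ that])
    show "\<theta> (gen y) = gen y" if "y \<in> X - {x}" for y
      using M.ev_gen[OF \<phi>, of y] that by (simp add: \<theta>_def \<phi>_def)
  qed auto
  have "\<theta> l = \<zero>\<^bsub>?M\<^esub>"
  proof -
    have "\<theta> l = c \<odot>\<^bsub>?M\<^esub> ((- inverse c) \<odot>\<^bsub>?M\<^esub> l0) \<oplus>\<^bsub>?M\<^esub> l0"
      unfolding l_eq using xN l0N \<theta>id[OF l0] M.ev_gen[OF \<phi> x(1)]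
      by (simp add: alg_homD(2,3)[OF \<theta>]) (simp add: \<theta>_def \<phi>_def)
    then show ?thesis using x(2) by (simp add: free_nonassoc_simps c_def fun_eq_iff mult.assoc[symmetric])
  qed
  have \<theta>K: "\<theta> f \<in> lie_kernel (X - {x})"
    if "R \<subseteq> carrier ?N" "\<And>\<rho>. \<rho> \<in> R \<Longrightarrow> \<theta> \<rho> \<in> lie_kernel (X - {x})" "f \<in> pres_ideal X R" for R f
    by (rule pres_ideal_hom[where \<phi> = \<theta>, OF \<theta> M.nonassoc_algebra_axioms lie_kernel_ideal _ that])
      (auto simp: lie_kernel_eq pres_ideal_relators)
  have "r \<ominus>\<^bsub>?N\<^esub> l \<in> lie_kernel X" by (rule lie_equiv_diff[OF r rN l])
  then have "\<theta> (r \<ominus>\<^bsub>?N\<^esub> l) \<in> lie_kernel (X - {x})"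
    using \<theta>K[of "{}"] by (simp add: lie_kernel_eq)
  moreover have "\<theta> (r \<ominus>\<^bsub>?N\<^esub> l) = \<theta> r"
    using \<open>\<theta> l = \<zero>\<^bsub>?M\<^esub>\<close> rN l alg_homD(1)[OF \<theta>]
    by (simp add: alg_hom_diff[OF \<theta> N.nonassoc_algebra_axioms M.nonassoc_algebra_axioms] M.minus_eq M.minus_conv)
  ultimately have \<theta>r: "\<theta> r \<in> lie_kernel (X - {x})" by simp
  show ?thesis
  proof (rule presentsI[OF L.lie_algebra_axioms _ MN])
    show "carrier L \<subseteq> \<pi> ` carrier ?M"
    proof
      fix y assume "y \<in> carrier L"
      then obtain f where "f \<in> carrier ?N" "y = \<pi> f" using presentsD(5)[OF L] by auto
      then show "y \<in> \<pi> ` carrier ?M" using \<pi>\<theta> alg_homD(1)[OF \<theta>] by (intro image_eqI[of _ _ "\<theta> f"]) auto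
    qed
    show "f \<in> pres_ideal (X - {x}) {}" if f: "f \<in> carrier ?M" "\<pi> f = \<zero>\<^bsub>L\<^esub>" for f
    proof -
      have fN: "f \<in> carrier ?N" by (rule free_nonassoc_mono[OF _ f(1)]) auto
      then have "f \<in> pres_ideal X {r}" using presentsD(7)[OF L fN] f(2) by simp
      then have "\<theta> f \<in> lie_kernel (X - {x})"
        by (rule \<theta>K[of "{r}", rotated 2]) (use \<theta>r rN in auto)
      then show ?thesis using \<theta>id[OF f(1)] by (simp add: lie_kernel_eq)
    qed
  qed auto
qed

section \<open>One relator Lie algebras\<close>

lemma presents_change:
  assumes P: "presents X R L \<pi>" and R': "R' \<subseteq> pres_ideal X R" "R' \<subseteq> polys X"
    and R: "R \<subseteq> pres_ideal X R'"
  shows "presents X R' L \<pi>"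
proof (rule presentsI[OF presentsD(1)[OF P] R'(2) presentsD(4)[OF P]])
  show "carrier L \<subseteq> \<pi> ` polys X" using presentsD(5)[OF P] by simp
  show "\<pi> r = \<zero>\<^bsub>L\<^esub>" if "r \<in> R'" for r using presentsD(7)[OF P] R' that by blast
  show "f \<in> pres_ideal X R'" if f: "f \<in> polys X" "\<pi> f = \<zero>\<^bsub>L\<^esub>" for f
  proof -
    have "f \<in> pres_ideal X R" using presentsD(7)[OF P f(1)] f(2) by simp
    then show ?thesis
      unfolding pres_ideal_def[of X R]
      using alg_ideal_gen_min[OF pres_ideal_ideal[OF R'(2)], of "lie_relators (free_nonassoc X) \<union> R"] R
        pres_ideal_relators(2)[of X R'] by blast
  qed
qed

lemma lie_equiv_pres_ideal:
  fixes q r :: "'x magma \<Rightarrow> 'k::field"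
  assumes "q \<doteq> r" "q \<in> polys X" "r \<in> polys X"
  shows "q \<in> pres_ideal X {r}"
proof -
  let ?N = "free_nonassoc X :: ('k, 'x magma \<Rightarrow> 'k) module"
  interpret N: nonassoc_algebra ?N ..
  note d = free_nonassoc_diff[OF assms(2,3)]
  have "q \<ominus>\<^bsub>?N\<^esub> r \<in> lie_kernel X" by (rule lie_equiv_diff[OF assms])
  then have "q \<ominus>\<^bsub>?N\<^esub> r \<in> pres_ideal X {r}" using lie_kernel_subset[of "{r}" X] assms(3) by auto
  moreover have "r \<in> pres_ideal X {r}" using pres_ideal_relators(1)[of "{r}" X] by simp
  ultimately have "q \<ominus>\<^bsub>?N\<^esub> r \<oplus>\<^bsub>?N\<^esub> r \<in> pres_ideal X {r}"
    using alg_idealD(3)[OF N.nonassoc_algebra_axioms pres_ideal_ideal[of "{r}" X]] assms(3) by simp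
  then show ?thesis unfolding d by (simp add: free_nonassoc_simps)
qed

lemma presents_equiv:
  assumes "presents X {r} L \<pi>" "q \<doteq> r" "q \<in> polys X"
  shows "presents X {q} L \<pi>"
proof -
  have "r \<in> polys X" using presentsD(3)[OF assms(1)] by simp
  then show ?thesis
    using lie_equiv_pres_ideal[OF assms(2,3)] lie_equiv_pres_ideal[OF lie_equiv_sym[OF assms(2)] _ assms(3)] assms(3)
    by (intro presents_change[OF assms(1)]) auto
qed

section \<open>Realising an algebra on a given element type\<close>

lemma lie_algebra_transport:
  fixes B :: "('k::field, 'b) module" and e :: "'b \<Rightarrow> 'a"
  assumes "lie_algebra B" "inj_on e (carrier B)"
  obtains A :: "('k, 'a) module"
  where "lie_algebra A" "alg_hom B A e" "bij_betw e (carrier B) (carrier A)"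
proof -
  interpret lie_algebra B by fact
  define e' where "e' = inv_into (carrier B) e"
  have e': "e' (e x) = x" if "x \<in> carrier B" for x
    using that assms(2) by (simp add: e'_def)
  define A where "A = \<lparr>carrier = e ` carrier B, monoid.mult = (\<lambda>x y. e (e' x \<otimes>\<^bsub>B\<^esub> e' y)),
    one = e \<zero>\<^bsub>B\<^esub>, ring.zero = e \<zero>\<^bsub>B\<^esub>, add = (\<lambda>x y. e (e' x \<oplus>\<^bsub>B\<^esub> e' y)),
    module.smult = (\<lambda>c x. e (c \<odot>\<^bsub>B\<^esub> e' x))\<rparr>"
  have s: "carrier A = e ` carrier B" "\<And>x y. x \<otimes>\<^bsub>A\<^esub> y = e (e' x \<otimes>\<^bsub>B\<^esub> e' y)" "\<zero>\<^bsub>A\<^esub> = e \<zero>\<^bsub>B\<^esub>"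
    "\<And>x y. x \<oplus>\<^bsub>A\<^esub> y = e (e' x \<oplus>\<^bsub>B\<^esub> e' y)" "\<And>c x. c \<odot>\<^bsub>A\<^esub> x = e (c \<odot>\<^bsub>B\<^esub> e' x)"
    by (simp_all add: A_def)
  have "nonassoc_algebra A"
    by (rule nonassoc_algebraI)
      (auto simp: s e' smult_add_left smult_add_right smult_smult bracket_add_left bracket_add_right
        bracket_smult_left bracket_smult_right a_ac)
  then have "lie_algebra A"
    unfolding lie_algebra_iff by (auto simp: s e' bracket_self jacobi)
  moreover have "alg_hom B A e" by (rule alg_homI) (auto simp: s e')
  moreover have "bij_betw e (carrier B) (carrier A)" using assms(2) by (simp add: bij_betw_def s)
  ultimately show ?thesis by (rule that)
qed

text \<open>
  This makes it unnecessary to embed the base of an HNN-extension into the extension: the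
  base can be realised on the element type of the extension as it is.
\<close>

lemma presents_on_type:
  fixes R :: "('x magma \<Rightarrow> 'k::field) set" and \<iota> :: "('x magma \<Rightarrow> 'k) \<Rightarrow> 'a"
  assumes \<iota>: "inj \<iota>" and R: "R \<subseteq> polys V"
  shows "\<exists>(B :: ('k, 'a) module) \<pi>. presents V R B \<pi>"
proof -
  \<comment> \<open>A coset is determined by any of its elements, so coding a chosen representative
    by \<open>\<iota>\<close> embeds the quotient into \<open>'a\<close>.\<close>
  let ?B = "alg_quot (free_nonassoc V) (pres_ideal V R)" and ?e = "\<lambda>A. \<iota> (SOME f. f \<in> A)"
  note I = pres_ideal_ideal[OF R] and P = presents_quot[OF R]
  have *: "pres_ideal V R +>\<^bsub>free_nonassoc V\<^esub> (SOME f. f \<in> D) = D" if D: "D \<in> carrier ?B" for D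
  proof -
    obtain f where f: "f \<in> polys V" "D = pres_ideal V R +>\<^bsub>free_nonassoc V\<^esub> f"
      using D alg_quot_simps(1)[OF _ I] by auto
    then have "f \<in> D" using alg_coset_mem[OF _ I f(1), of f] by simp
    then have "(SOME f. f \<in> D) \<in> D" by (rule someI[of "\<lambda>f. f \<in> D"])
    then show ?thesis using alg_coset_mem[OF _ I f(1)] f(2) by simp
  qed
  have "inj_on ?e (carrier ?B)"
    by (rule inj_onI) (metis * injD[OF \<iota>])
  then obtain B :: "('k, 'a) module" where "lie_algebra B" "alg_hom ?B B ?e" "bij_betw ?e (carrier ?B) (carrier B)"
    by (rule lie_algebra_transport[OF presentsD(1)[OF P]])
  then show ?thesis using presents_transport[OF P] by blast
qed

section \<open>Weights under substitution\<close>

lemma ev_graded: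
  fixes f :: "'x magma \<Rightarrow> 'k::field" and \<phi> :: "'x \<Rightarrow> 'y magma \<Rightarrow> 'k"
  assumes f: "f \<in> graded wt X A" and \<phi>: "\<And>x. x \<in> X \<Longrightarrow> \<phi> x \<in> graded wt' Y {wt x}"
  shows "ev (free_nonassoc Y) \<phi> f \<in> graded wt' Y A"
proof -
  interpret N: nonassoc_algebra "free_nonassoc Y :: ('k, 'y magma \<Rightarrow> 'k) module" ..
  interpret M: nonassoc_algebra "free_nonassoc X :: ('k, 'x magma \<Rightarrow> 'k) module" ..
  have \<phi>': "\<phi> \<in> X \<rightarrow> polys Y" using \<phi> gradedD by blast
  note h = N.ev_hom[OF \<phi>']
  have m: "ev (free_nonassoc Y) \<phi> (mon m) \<in> graded wt' Y {magma_weight wt m}" if "set_magma m \<subseteq> X" for m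
    using that by (induction m) (auto simp: N.ev_mon[OF \<phi>'] \<phi> intro!: graded_mult)
  show ?thesis
    using f
  proof (induction rule: graded_singleton_induct)
    case zero
    show ?case using graded_zero[of Y wt' A] alg_hom_zero[OF h] by simp
  next
    case (add m c g)
    have "(mon m :: _ \<Rightarrow> 'k) \<in> polys X" using add by (intro mon_closed)
    moreover have "ev (free_nonassoc Y) \<phi> (mon m) \<in> graded wt' Y A"
      using graded_mono[OF m[OF add(1)]] add(2) by auto
    ultimately show ?case
      using add(4) gradedD[OF add(3)] by (auto simp: alg_homD(2,3)[OF h] intro!: graded_add graded_smult)
  qed
qed

lemma lazard_subst_graded:
  fixes f :: "nat magma \<Rightarrow> 'k::field"
  assumes f: "f \<in> graded (elim_weight wt t) (elim_letters t P) A" and Q: "t \<in> Q" "P \<subseteq> Q"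
  shows "lazard_subst t f \<in> graded wt Q A"
proof -
  let ?N = "free_nonassoc UNIV :: ('k, nat magma \<Rightarrow> 'k) module"
  have "((\<lambda>x. gen t \<otimes>\<^bsub>?N\<^esub> x) ^^ i) (gen y) \<in> graded wt UNIV {wt y + i * wt t}" for i y
  proof (induction i)
    case 0
    then show ?case using mon_graded[of "Gen y" UNIV wt] by simp
  next
    case (Suc i)
    then show ?case using graded_mult[OF mon_graded[of "Gen t" UNIV wt] Suc] by (simp add: add_ac)
  qed
  then have "lazard_subst t f \<in> graded wt UNIV A"
    by (intro ev_graded[OF f]) (auto simp: elim_letters_def)
  then show ?thesis using lazard_subst_closed[OF gradedD[OF f] Q] by (simp add: graded_def)
qed

lemma lazard_subst_equiv:
  fixes f g :: "nat magma \<Rightarrow> 'k::field"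
  assumes "f \<doteq> g" "f \<in> polys UNIV" "g \<in> polys UNIV"
  shows "lazard_subst t f \<doteq> lazard_subst t g"
proof -
  let ?N = "free_nonassoc UNIV :: ('k, nat magma \<Rightarrow> 'k) module"
  interpret N: nonassoc_algebra ?N ..
  note h = lazard_subst_hom[of t, where 'k = 'k]
  have "f \<ominus>\<^bsub>?N\<^esub> g \<in> lie_kernel UNIV" by (rule lie_equiv_diff[OF assms])
  then have "lazard_subst t (f \<ominus>\<^bsub>?N\<^esub> g) \<in> lie_kernel UNIV"
    by (intro pres_ideal_hom[where \<phi> = "lazard_subst t" and R = "{}" and X = UNIV and f = "f \<ominus>\<^bsub>?N\<^esub> g", OF h _ lie_kernel_ideal])
      (use pres_ideal_relators(2)[of UNIV "{}"] in \<open>simp_all add: lie_kernel_eq\<close>)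
  moreover have "lazard_subst t (f \<ominus>\<^bsub>?N\<^esub> g) = lazard_subst t f \<ominus>\<^bsub>?N\<^esub> lazard_subst t g"
    by (rule alg_hom_diff[OF h _ _ assms(2,3)]) auto
  ultimately show ?thesis using alg_homD(1)[OF h] assms by (simp add: free_nonassoc_diff lie_equiv_def)
qed

section \<open>Letters that cannot be removed from the relator\<close>

lemma set_magma_nonempty: "set_magma m \<noteq> {}"
  by (induction m) auto

text \<open>The free Lie algebra on one letter is one-dimensional: \<open>[x, x]\<close> vanishes,
  and a longer bracket has a vanishing factor.\<close>

lemma single_letter:
  assumes "set_magma m \<subseteq> {x}"
  shows "m = Gen x \<or> (mon m :: _ \<Rightarrow> 'k::field) \<in> lie_kernel UNIV"
  using assms
proof (induction m)
  case (Br u v)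
  let ?N = "free_nonassoc UNIV :: ('k, 'a magma \<Rightarrow> 'k) module"
  note I = alg_idealD[of ?N "lie_kernel UNIV", OF free_nonassoc_algebra lie_kernel_ideal]
  have c: "(mon m :: _ \<Rightarrow> 'k) \<in> carrier ?N" for m :: "'a magma" by (rule mon_closed) simp
  have b: "mon (Br u v) = mon u \<otimes>\<^bsub>?N\<^esub> mon v" by (rule mon_Br)
  show ?case
  proof (cases "u = Gen x \<and> v = Gen x")
    case True
    then have "mon (Br u v) \<in> lie_relators ?N" unfolding b lie_relators_def using c by blast
    then show ?thesis using pres_ideal_relators(2)[of UNIV "{}"] by (auto simp: lie_kernel_eq)
  next
    case False
    then show ?thesis using Br I(5)[OF c[of u], of "mon v"] I(6)[OF c[of v], of "mon u"] unfolding b by auto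
  qed
qed simp

text \<open>Stated modulo \<open>\<doteq>\<close>, since a letter may occur in the polynomial
  \<open>r\<close> and still cancel in the free Lie algebra.\<close>

definition essential :: "(nat \<Rightarrow> nat) \<Rightarrow> nat set \<Rightarrow> nat \<Rightarrow> nat \<Rightarrow> (nat magma \<Rightarrow> 'k::field) \<Rightarrow> bool"
  where "essential wt P w x r \<longleftrightarrow> (\<forall>f \<in> graded wt (P - {x}) {w}. \<not> f \<doteq> r)"

text \<open>A proper bracket of weight \<open>w\<close> contains only letters lighter than
  \<open>w\<close>, hence only \<open>x\<close>, and vanishes by \<open>single_letter\<close>. So
  \<open>r\<close> is equivalent to its linear part, in which \<open>x\<close> must occur because it
  is essential.\<close>

lemma essential_linear:
  fixes r :: "nat magma \<Rightarrow> 'k::field"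
  assumes r: "r \<in> graded wt P {w}" and wt: "\<And>y. 0 < wt y" and ess: "essential wt P w x r"
    and big: "\<And>t. t \<in> P \<Longrightarrow> t \<noteq> x \<Longrightarrow> w \<le> wt t"
  obtains l where "r \<doteq> l" "l \<in> polys P" "\<And>m. l m \<noteq> 0 \<Longrightarrow> \<exists>p. m = Gen p" "l (Gen x) \<noteq> 0"
proof -
  let ?N = "free_nonassoc UNIV :: ('k, nat magma \<Rightarrow> 'k) module"
  interpret N: nonassoc_algebra ?N ..
  define l where "l m = (case m of Gen p \<Rightarrow> r m | Br u v \<Rightarrow> 0)" for m
  have lr: "l m \<noteq> 0 \<Longrightarrow> l m = r m \<and> (\<exists>p. m = Gen p)" for m by (cases m) (auto simp: l_def)
  have rP: "finite {m. r m \<noteq> 0}" "r m \<noteq> 0 \<Longrightarrow> set_magma m \<subseteq> P \<and> magma_weight wt m = w" for m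
    using r by (auto simp: graded_def free_nonassoc_simps)
  have fl: "finite {m. l m \<noteq> 0}" by (rule finite_subset[OF _ rP(1)]) (use lr in force)
  have l: "l \<in> graded wt P {w}"
    using fl lr rP(2) by (auto simp: graded_def free_nonassoc_simps)
  have "finite {m. r m - l m \<noteq> 0}"
    by (rule finite_subset[of _ "{m. r m \<noteq> 0} \<union> {m. l m \<noteq> 0}"]) (use rP(1) fl in auto)
  moreover have "\<forall>m. r m - l m \<noteq> 0 \<longrightarrow> (mon m :: _ \<Rightarrow> 'k) \<in> lie_kernel UNIV"
  proof (intro allI impI)
    fix m assume m: "r m - l m \<noteq> 0"
    then obtain u v where uv: "m = Br u v" by (cases m) (auto simp: l_def)
    then have rm: "r m \<noteq> 0" using m by (simp add: l_def)
    have pos: "0 < magma_weight wt m" for m by (induction m) (auto simp: wt)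
    have "set_magma m \<subseteq> {x}"
    proof
      fix y assume y: "y \<in> set_magma m"
      have "wt y < w"
        using y rP(2)[OF rm] letter_weight[of y u wt] letter_weight[of y v wt] pos[of u] pos[of v] uv by auto
      then show "y \<in> {x}" using big[of y] rP(2)[OF rm] y by auto
    qed
    then show "(mon m :: _ \<Rightarrow> 'k) \<in> lie_kernel UNIV" using single_letter[of m x] uv by auto
  qed
  ultimately have "(\<lambda>m. r m - l m) \<in> lie_kernel UNIV"
  proof (induction rule: fin_supp_induct)
    case zero
    show ?case using alg_idealD(2)[OF free_nonassoc_algebra lie_kernel_ideal[of UNIV]]
      by (simp add: free_nonassoc_simps)
  next
    case (add m c g)
    note I = alg_idealD[of ?N "lie_kernel UNIV", OF free_nonassoc_algebra lie_kernel_ideal]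
    show ?case using I(3)[OF add(4) I(4)[OF add(1), of c]] by (simp add: free_nonassoc_simps)
  qed
  then have eq: "r \<doteq> l" by (simp add: lie_equiv_def)
  have "l (Gen x) \<noteq> 0"
  proof
    assume 0: "l (Gen x) = 0"
    have "set_magma m \<subseteq> P - {x}" if "l m \<noteq> 0" for m
      using lr[OF that] that 0 rP(2)[of m] by auto
    then have "l \<in> graded wt (P - {x}) {w}" using l by (auto simp: graded_def free_nonassoc_simps)
    then show False using ess lie_equiv_sym[OF eq] by (simp add: essential_def)
  qed
  then show ?thesis using that[OF eq gradedD[OF l]] lr by blast
qed

text \<open>
  The elimination step: rewriting \<open>r\<close> with the top \<open>x\<close>-index \<open>n\<close> as small as possible makes the
  letter \<open>ad(t)\<^sup>n x\<close> essential.
\<close>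

lemma essential_elim:
  fixes r :: "nat magma \<Rightarrow> 'k::field"
  assumes r: "r \<in> graded wt P {w}" and wt: "\<And>y. 0 < wt y" and ess: "essential wt P w x r"
    and t: "t \<in> P" "t \<noteq> x" "wt t < w"
  obtains Q n g where "Q \<subseteq> elim_upto w t P" "\<forall>y i. prod_encode (y, i) \<in> Q \<longrightarrow> y = x \<longrightarrow> i \<le> n"
    "g \<in> graded (elim_weight wt t) Q {w}" "r \<doteq> lazard_subst t g"
    "essential (elim_weight wt t) Q w (prod_encode (x, n)) g"
proof -
  let ?wt = "elim_weight wt t"
  define Q where "Q n = {z \<in> elim_upto w t P. \<exists>y i. z = prod_encode (y, i) \<and> (y = x \<longrightarrow> i \<le> n)}" for n
  define good where "good n \<longleftrightarrow> (\<exists>g \<in> graded ?wt (Q n) {w}. r \<doteq> lazard_subst t g)" for n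
  \<comment> \<open>A letter lighter than \<open>w\<close> cannot be a monomial of weight
    \<open>w\<close>, so the linear term in the rewriting disappears.\<close>
  have rt: "r (Gen t) = 0" using graded_weight[OF r, of "Gen t"] t(3) by auto
  obtain g0 where g0: "g0 \<in> graded ?wt (elim_letters t P) {w}"
    "r \<doteq> (\<lambda>m. r (Gen t) * gen t m + lazard_subst t g0 m)"
    using lazard_rewrite[OF r, of t] by blast
  have "g0 \<in> graded ?wt (elim_upto w t P) {w}"
    by (rule graded_elim_upto[OF g0(1) _ wt]) simp
  moreover have "Q w = elim_upto w t P" by (auto simp: Q_def elim_upto_def)
  ultimately have "good w" unfolding good_def using g0(2) rt by (intro bexI[of _ g0]) auto
  define n where "n = (LEAST n. good n)"
  have "good n" unfolding n_def using \<open>good w\<close> by (rule LeastI)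
  then obtain g where g: "g \<in> graded ?wt (Q n) {w}" "r \<doteq> lazard_subst t g" unfolding good_def by blast
  have QE: "Q n \<subseteq> elim_letters t P" for n using elim_upto_subset by (auto simp: Q_def)
  have "essential ?wt (Q n) w (prod_encode (x, n)) g"
    unfolding essential_def
  proof (intro ballI notI)
    fix f assume f: "f \<in> graded ?wt (Q n - {prod_encode (x, n)}) {w}" and fg: "f \<doteq> g"
    have fN: "f \<in> polys UNIV" using free_nonassoc_mono[OF subset_UNIV gradedD[OF f]] .
    have gN: "g \<in> polys UNIV" using free_nonassoc_mono[OF subset_UNIV gradedD[OF g(1)]] .
    have rf: "r \<doteq> lazard_subst t f"
      by (rule lie_equiv_trans[OF g(2) lie_equiv_sym[OF lazard_subst_equiv[OF fg fN gN]]])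
    show False
    \<comment> \<open>Suppose \<open>x_n\<close> could be removed from \<open>g\<close>. For
      \<open>n = 0\<close> no letter \<open>x_i\<close> would remain, and substituting back would
      remove \<open>x\<close> from \<open>r\<close>; otherwise \<open>n - 1\<close> would be good,
      against the choice of \<open>n\<close>.\<close>
    proof (cases n)
      case 0
      have "Q n - {prod_encode (x, n)} \<subseteq> elim_letters t (P - {x})"
        using 0 by (auto simp: Q_def elim_upto_def elim_letters_def)
      then have "f \<in> graded ?wt (elim_letters t (P - {x})) {w}" by (rule graded_mono[OF f _ subset_refl])
      then have "lazard_subst t f \<in> graded wt (P - {x}) {w}"
        by (rule lazard_subst_graded) (use t in auto)
      then show False using ess lie_equiv_sym[OF rf] by (simp add: essential_def)
    next
      case (Suc n')
      have "Q n - {prod_encode (x, n)} \<subseteq> Q n'"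
        using Suc by (auto simp: Q_def le_Suc_eq)
      then have "f \<in> graded ?wt (Q n') {w}" by (rule graded_mono[OF f _ subset_refl])
      then have "good n'" using rf unfolding good_def by blast
      then have "n \<le> n'" unfolding n_def by (rule Least_le)
      then show False using Suc by simp
    qed
  qed
  moreover have "Q n \<subseteq> elim_upto w t P" by (auto simp: Q_def)
  moreover have "\<forall>y i. prod_encode (y, i) \<in> Q n \<longrightarrow> y = x \<longrightarrow> i \<le> n" by (auto simp: Q_def)
  ultimately show ?thesis using that[of "Q n" n g] g by blast
qed

text \<open>The induction is on the finite set \<open>P\<close> of letters carrying the relator,
  while \<open>L\<close> is presented over an arbitrary \<open>X\<close> containing
  \<open>P\<close>, since elimination makes alphabets infinite. Solvability is proved alongside
  because the HNN step needs it for \<open>g\<close>.\<close>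

lemma one_relator_induction:
  fixes r :: "nat magma \<Rightarrow> 'k::field" and j :: "nat \<Rightarrow> 'a" and \<iota> :: "(nat magma \<Rightarrow> 'k) \<Rightarrow> 'a"
  assumes j: "inj j" and \<iota>: "inj \<iota>"
    and "finite P" "\<And>y. 0 < wt y" "r \<in> graded wt P {w}" "essential wt P w x r"
  shows "solvable r x \<and> (\<forall>X L \<pi>. P \<subseteq> X \<longrightarrow> presents X {r} (L :: ('k, 'a) module) \<pi> \<longrightarrow>
    (\<exists>A Ss. iterated_hnn A Ss L \<and> is_free_lie A \<and> (\<forall>S\<in>set Ss. is_free_lie S)))"
proof -
  have "wf (inv_image (mult less_than) (\<lambda>(wt, P). weight_mset w wt P))"
    by (intro wf_inv_image wf_mult wf_less_than)
  then show ?thesis using assms(3-)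
  proof (induction "(wt, P)" arbitrary: wt P r x rule: wf_induct_rule)
    case less
    note fin = less.prems(1) and wt = less.prems(2) and r = less.prems(3) and ess = less.prems(4)
    have rP: "r \<in> polys P" by (rule gradedD[OF r])
    have rU: "r \<in> polys UNIV" by (rule free_nonassoc_mono[OF subset_UNIV rP])
    have xP: "x \<in> P"
    proof (rule ccontr)
      assume "x \<notin> P"
      then show False using ess r lie_equiv_refl[of r] by (auto simp: essential_def)
    qed
    show ?case
    proof (cases "\<exists>t\<in>P. t \<noteq> x \<and> wt t < w")
      case False
      then obtain l where l: "r \<doteq> l" "l \<in> polys P" "\<And>m. l m \<noteq> 0 \<Longrightarrow> \<exists>p. m = Gen p"
        "l (Gen x) \<noteq> 0" using essential_linear[OF r wt ess] by (metis not_le)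
      have "solvable r x" by (rule solvable_linear[OF rU l(1,2) fin l(3,4)])
      moreover have "\<exists>A Ss. iterated_hnn A Ss L \<and> is_free_lie A \<and> (\<forall>S\<in>set Ss. is_free_lie S)"
        if X: "P \<subseteq> X" and L: "presents X {r} L \<pi>" for X \<pi> and L :: "('k, 'a) module"
      proof -
        have "presents (X - {x}) {} L \<pi>"
          by (rule presents_linear_free[OF L l(1) free_nonassoc_mono[OF X l(2)] l(3) _ l(4)]) (use X xP in auto)
        then have "is_free_lie L" by (rule is_free_lieI[OF _ inj_on_subset[OF j subset_UNIV]])
        then show ?thesis
          using iterated_hnn.base[OF presentsD(1)[OF L]] by (intro exI[of _ L] exI[of _ "[]"]) auto
      qed
      ultimately show ?thesis by blast
    next
      case True
      then obtain t where t: "t \<in> P" "t \<noteq> x" "wt t < w" by blast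
      obtain Q n g where Q: "Q \<subseteq> elim_upto w t P" "\<forall>y i. prod_encode (y, i) \<in> Q \<longrightarrow> y = x \<longrightarrow> i \<le> n"
        and g: "g \<in> graded (elim_weight wt t) Q {w}" "r \<doteq> lazard_subst t g"
        and ess': "essential (elim_weight wt t) Q w (prod_encode (x, n)) g"
        by (rule essential_elim[OF r wt ess t])
      have dec: "((elim_weight wt t, Q), wt, P) \<in> inv_image (mult less_than) (\<lambda>(wt, P). weight_mset w wt P)"
        using weight_mset_elim[of P t wt w, OF fin t(1) wt _ Q(1)] t(3) by simp
      have pos: "0 < elim_weight wt t z" for z using wt by (simp add: elim_weight_def split: prod.split)
      have finQ: "finite Q" by (rule finite_subset[OF Q(1) finite_elim_upto[OF fin]])
      note IH = less.hyps[OF dec finQ pos g(1) ess']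
      have QV: "y \<noteq> t \<and> y \<in> P \<and> (y = x \<longrightarrow> i \<le> n)" if "prod_encode (y, i) \<in> Q" for y i
        using that Q by (auto simp: elim_upto_def)
      have "solvable r x"
        by (rule solvable_elim[OF rU g(2) gradedD[OF g(1)] _ _ conjunct1[OF IH]]) (use t QV in auto)
      moreover have "\<exists>A Ss. iterated_hnn A Ss L \<and> is_free_lie A \<and> (\<forall>S\<in>set Ss. is_free_lie S)"
        if X: "P \<subseteq> X" and L: "presents X {r} L \<pi>" for X \<pi> and L :: "('k, 'a) module"
      proof -
        define V where "V = {prod_encode (y, i) | y i. y \<in> X - {t} \<and> (y = x \<longrightarrow> i \<le> n)}"
        have QsubV: "Q \<subseteq> V"
        proof
          fix z assume z: "z \<in> Q"
          obtain y i where "z = prod_encode (y, i)" by (metis prod_decode_inverse surj_pair)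
          then show "z \<in> V" using QV[of y i] X z by (auto simp: V_def)
        qed
        have gV: "{g} \<subseteq> polys V" using free_nonassoc_mono[OF QsubV gradedD[OF g(1)]] by simp
        obtain B :: "('k, 'a) module" and \<pi>B where pB: "presents V {g} B \<pi>B"
          using presents_on_type[OF \<iota> gV] by blast
        obtain A Ss where A: "iterated_hnn A Ss B" "is_free_lie A" "\<forall>S\<in>set Ss. is_free_lie S"
          using conjunct2[OF IH] QsubV pB by blast
        obtain S d where S: "lie_subalgebra B S" "lie_derivation B S d" "lie_iso (hnn_extension B S d) L"
          "is_free_lie (B\<lparr>carrier := S\<rparr>)"
          using hnn_step[OF L _ _ _ g(2) V_def pB conjunct1[OF IH] j] t X xP by blast
        have "iterated_hnn A (B\<lparr>carrier := S\<rparr> # Ss) L"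
          by (rule iterated_hnn.step[OF A(1) S(1,2) presentsD(1)[OF L] S(3)])
        then show ?thesis using A S(4) by (intro exI[of _ A] exI[of _ "B\<lparr>carrier := S\<rparr> # Ss"]) auto
      qed
      ultimately show ?thesis by blast
    qed
  qed
qed

section \<open>Coding polynomials by elements of the presented algebra's type\<close>

primrec left_comb :: "nat \<Rightarrow> 'x magma"
  where "left_comb 0 = Gen undefined" | "left_comb (Suc n) = Br (left_comb n) (Gen undefined)"

lemma inj_left_comb: "inj left_comb"
proof (rule injI)
  show "left_comb m = left_comb n \<Longrightarrow> m = n" for m n
  proof (induction m arbitrary: n)
    case 0
    then show ?case by (cases n) auto
  next
    case (Suc m)
    then show ?case by (cases n) auto
  qed
qed

primrec magma_code :: "nat magma \<Rightarrow> nat"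
  where "magma_code (Gen n) = prod_encode (0, n)"
  | "magma_code (Br u v) = prod_encode (Suc (magma_code u), magma_code v)"

lemma inj_magma_code: "inj magma_code"
proof (rule injI)
  show "magma_code u = magma_code v \<Longrightarrow> u = v" for u v
  proof (induction u arbitrary: v)
    case (Gen x)
    then show ?case by (cases v) auto
  next
    case (Br u1 u2)
    then show ?case by (cases v) auto
  qed
qed

text \<open>All intermediate algebras have to live on the element type of \<open>L\<close>. However
  small \<open>'x\<close> is, one unspecified letter yields infinitely many magma elements, enough
  to code all monomials in natural number letters. Coefficients are copied along this code, and the
  two pairs of braces reach the type of sets of cosets.\<close>

lemma ex_inj_presentation: "\<exists>\<iota> :: (nat magma \<Rightarrow> 'k::field) \<Rightarrow> ('k, 'x) free_lie_elem set. inj \<iota>"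
proof -
  define c :: "nat magma \<Rightarrow> 'x magma" where "c m = left_comb (magma_code m)" for m
  have c: "inj c" unfolding c_def[abs_def] using inj_compose[OF inj_left_comb inj_magma_code] by (simp add: comp_def)
  define \<iota> :: "(nat magma \<Rightarrow> 'k) \<Rightarrow> ('k, 'x) free_lie_elem set"
    where "\<iota> f = {{\<lambda>m. if m \<in> range c then f (inv_into UNIV c m) else 0}}" for f
  have "inj \<iota>"
  proof (rule injI, rule ext)
    fix f g m assume "\<iota> f = \<iota> g"
    then have "(\<lambda>m. if m \<in> range c then f (inv_into UNIV c m) else 0) = (\<lambda>m. if m \<in> range c then g (inv_into UNIV c m) else 0)"
      by (simp add: \<iota>_def)
    from fun_cong[OF this, of "c m"] show "f m = g m" using c by simp
  qed
  then show ?thesis by blast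
qed

theorem theoremB:
  fixes X :: "'x set" and \<omega> :: "'x \<Rightarrow> nat" and r :: "('k::field, 'x) free_lie_elem"
  assumes "finite X"
    and "\<omega> \<in> X \<rightarrow> {1..}"
    and "r \<in> carrier (free_lie X)"
    and "weight_homogeneous \<omega> X r"
  shows "\<exists>A Ss. iterated_hnn A Ss (lie_presentation X {r}) \<and>
    is_free_lie A \<and> (\<forall>S\<in>set Ss. is_free_lie S)"
proof -
  let ?L = "lie_presentation X {r}"
  obtain \<iota> :: "(nat magma \<Rightarrow> 'k) \<Rightarrow> ('k, 'x) free_lie_elem set" where \<iota>: "inj \<iota>"
    using ex_inj_presentation by blast
  define j where "j n = \<iota> (gen n)" for n
  have "inj (\<lambda>n. gen n :: nat magma \<Rightarrow> 'k)"
  proof (rule injI)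
    fix m n assume "(gen m :: nat magma \<Rightarrow> 'k) = gen n"
    from fun_cong[OF this, of "Gen m"] show "m = n" by (simp add: mon_def split: if_splits)
  qed
  then have j: "inj j" unfolding j_def[abs_def] using inj_compose[OF \<iota>] by (simp add: comp_def)
  obtain w f where f: "f \<in> polys X" "\<And>m. f m \<noteq> 0 \<Longrightarrow> magma_weight \<omega> m = w"
    "r = lie_kernel X +>\<^bsub>free_nonassoc X\<^esub> f"
    using assms(4) by (auto simp: weight_homogeneous_def free_lie_degree_def)
  obtain \<pi> where \<pi>: "presents X {f} ?L \<pi>"
    using presents_lie_presentation[of "{f}" X] f by auto
  obtain i :: "'x \<Rightarrow> nat" where i: "inj_on i X" using finite_imp_inj_to_nat_seg[OF assms(1)] by blast
  let ?X = "i ` X"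
  define q where "q = ev (free_nonassoc ?X) (\<lambda>x. gen (i x)) f"
  obtain \<pi>' where \<pi>': "presents ?X {q} ?L \<pi>'"
    using presents_relabel[OF \<pi> i] by (auto simp: q_def)
  \<comment> \<open>The default 1 keeps the weight positive on all natural numbers, as the induction
    demands.\<close>
  define wt where "wt y = (if y \<in> ?X then \<omega> (inv_into X i y) else 1)" for y
  have wt: "0 < wt y" for y
    using assms(2) i by (auto simp: wt_def Pi_iff Suc_le_eq)
  have "f \<in> graded \<omega> X {w}" using f by (simp add: graded_def)
  then have q: "q \<in> graded wt ?X {w}"
    unfolding q_def
  proof (rule ev_graded)
    fix x assume "x \<in> X"
    then show "gen (i x) \<in> graded wt ?X {\<omega> x}"
      using mon_graded[of "Gen (i x)" ?X wt] i by (simp add: wt_def)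
  qed
  show ?thesis
  proof (cases "q \<in> lie_kernel UNIV")
    case True
    \<comment> \<open>Here the relator is zero in the free Lie algebra, so no letter is essential,
      but \<open>L\<close> itself is free.\<close>
    have "q \<in> pres_ideal ?X {}"
      using lie_kernel_retract[OF gradedD[OF q] True subset_UNIV] by (simp add: lie_kernel_eq)
    then have "presents ?X {} ?L \<pi>'" by (intro presents_change[OF \<pi>']) auto
    then have "is_free_lie ?L" by (rule is_free_lieI[OF _ inj_on_subset[OF j subset_UNIV]])
    then show ?thesis using iterated_hnn.base[OF presentsD(1)[OF \<pi>']] by (intro exI[of _ ?L] exI[of _ "[]"]) auto
  next
    case False
    \<comment> \<open>A set of letters of least size in which the relator can be rewritten has only
      essential letters, and it is nonempty because the relator is not zero.\<close>
    define ok where "ok P \<longleftrightarrow> P \<subseteq> ?X \<and> (\<exists>p \<in> graded wt P {w}. p \<doteq> q)" for P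
    have "ok ?X" using q lie_equiv_refl unfolding ok_def by blast
    then obtain P where P: "ok P" and min: "\<And>P'. ok P' \<Longrightarrow> card P \<le> card P'"
      using ex_has_least_nat[of ok ?X card] by blast
    obtain p where p: "p \<in> graded wt P {w}" "p \<doteq> q" and PX: "P \<subseteq> ?X" using P by (auto simp: ok_def)
    have finP: "finite P" using PX assms(1) finite_subset by blast
    have "P \<noteq> {}"
    proof
      assume "P = {}"
      then have "p m = 0" for m using p(1) using set_magma_nonempty[of m] by (auto simp: graded_def free_nonassoc_simps)
      then have "(\<lambda>m. q m - 0) \<in> lie_kernel UNIV" using lie_equiv_sym[OF p(2)] by (simp add: lie_equiv_def)
      then show False using False by simp
    qed
    then obtain x where x: "x \<in> P" by blast
    have "essential wt P w x p"
      unfolding essential_def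
    proof (intro ballI notI)
      fix h assume "h \<in> graded wt (P - {x}) {w}" "h \<doteq> p"
      then have "ok (P - {x})" using lie_equiv_trans[OF _ p(2)] PX unfolding ok_def by blast
      then have "card P \<le> card (P - {x})" by (rule min)
      moreover have "card (P - {x}) < card P" using x finP by (rule card_Diff1_less[rotated])
      ultimately show False by simp
    qed
    from conjunct2[OF one_relator_induction[OF j \<iota> finP wt p(1) this], rule_format, OF PX]
      presents_equiv[OF \<pi>' p(2) free_nonassoc_mono[OF PX gradedD[OF p(1)]]]
    show ?thesis .
  qed
qed

end
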